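(* For each $\nu\in\mathcal N_G$, the set $$X_\nu=\{c\in\mathbb{A}(F)_\nu:\ \exists\,a\in A(\overline F)\text{ with } c=c(a)\text{ and }\mathrm{val}\,\Omega(a)=m_\nu\}$$ is non-empty, and for any $a\in A(\overline F)$ with $c(a)\in X_\nu$, any element $h\in W$ with $\sigma(a)=h(a)$ is conjugate in $W$ to $w(\nu)$.
   Context: Let $G$ be a connected reductive group over $\mathbb{C}$ of rank $n$ whose derived group $G_{sc}$ is simply connected, of rank $l$. Fix a maximal torus $A$ and a Borel subgroup $B\supseteq A$; $A_{sc}=A\cap G_{sc}$. $R\subset X^*(A)$ are the roots, $\Delta=\{\alpha_i\}_{i\in I}$, $I=\{1,\dots,l\}$, the simple roots for $B$; $Q(R),Q(R^\vee)$ root and coroot lattices, $P(R),P(R^\vee)$ the dual lattices, $\varpi_i$ the fundamental weights. Choose a $\mathbb{Z}$-basis $\omega_1,\dots,\omega_n$ of $X^*(A)$ with $\omega_i|_{A_{sc}}=\varpi_i$ for $i\le l$ and $\omega_{l+1},\dots,\omega_n$ a basis of the kernel of restriction. $W$ is the Weyl group, $c_i=\sum_{\lambda\in W\omega_i}e^\lambda$, $\mathbb{A}=\mathbb{G}_a^l\times\mathbb{G}_m^{n-l}$, $c=(c_1,\dots,c_n):A\to\mathbb{A}$ (identifying $A/W\cong\mathbb{A}$). $\Omega=\prod_{\alpha\in R}(1-e^\alpha)\in\mathbb{C}[X^*(A)]$ and $m_\nu=\sum_{\alpha\in R}\max\{0,\langle\alpha,\nu\rangle\}$. $F=\mathbb{C}((\epsilon))$,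 $\overline F=\bigcup_n\mathbb{C}((\epsilon^{1/n}))$ with compatible roots, $\sigma$ the Galois generator with $\sigma(\epsilon^{1/n})=e^{2\pi\sqrt{-1}/n}\epsilon^{1/n}$, $\mathrm{val}$ the valuation with $\mathrm{val}(\epsilon^{1/n})=-1/n$. $\mathfrak a=X_*(A)\otimes\mathbb{R}$. For a standard parabolic $P=MN\supseteq B$ with Levi $M\supseteq A$, simple roots $\Delta_M$, roots $R_M$, Weyl group $W_M$: $A_M$ is the identity component of the center of $M$, $\mathfrak a_M=X_*(A_M)\otimes\mathbb{R}=\mathfrak a^{W_M}$, $p_M$ the $W_M$-average, $\Lambda_M=p_M(X_*(A))\cong X_*(A)/Q(R_M^\vee)$, $\Lambda_P^+=\{\nu\in\Lambda_M:\langle\alpha,\nu\rangle>0\ \forall\alpha\in\Delta\setminus\Delta_M\}$, $\mathcal N_G=\coprod_P\Lambda_P^+$. For $\nu\in\mathcal N_G$, $\mathbb{A}(F)_\nu$ is the set of $c\in\mathbb{A}(\overline F)$ for which there is $a\in A(\overline F)$ with $c=c(a)$, $\sigma(a)=g(a)$ for some $g\in W$, and $\langle\lambda,\nu\rangle=\mathrm{val}\,\lambda(a)$ for all $\lambda\in X^*(A)$. $\psi$: for a reduced irreducible root system $R$ with basis $\{\alpha_i\}$, highest root $\tilde\alpha$, let $W_e=P(R^\vee)\rtimes W$ act on $V^*$ ($V=Q(R)\otimes\mathbb{R}$), $P(R^\vee)$ by translations; $C=\{v:\langle\alpha_i,v\rangle>0\ \forall i,\ \langle\tilde\alpha,v\rangle<1\}$;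 the stabilizer $\Gamma_C$ of $C$ in $W_e$ maps isomorphically ($\xi$) onto $W_e/(Q(R^\vee)\rtimes W)\cong P(R^\vee)/Q(R^\vee)$, and $\psi=\mathrm{pr}\circ\xi^{-1}$, $\mathrm{pr}:W_e\to W$; for reducible $R$ take the product over components. $\psi_M$ is the composite $\Lambda_M\cong X_*(A)/Q(R_M^\vee)\to P(R_M^\vee)/Q(R_M^\vee)\xrightarrow{\psi}W_M$, the first map induced by $\lambda\mapsto\langle\cdot,\lambda\rangle|_{Q(R_M)}$. For $\nu\in\Lambda_P^+$, $w(\nu)=\psi_M(\nu)$. *)

theory Defs
  imports Complex_Main
begin

text \<open>
The reductive group G enters the statement only through its root datum relative to A.
We fix coordinates as in the paper: X^*(A) = Z^n with basis omega_1..omega_n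
(here indexed 0..n-1), and X_*(A) = Z^n with the dual basis.  Because
omega_i restricts to the fundamental weight varpi_i on A_sc for i < l and
omega_{l+1..n} restrict trivially, and G_sc is simply connected, the simple coroots
alpha_j^vee (j < l) are exactly the dual basis vectors e_j of X_*(A).  The root datum is
thus determined by the simple roots al i :: nat => int (i < l), vectors in Z^n,
subject to: Cartan matrix conditions for (<alpha_i, alpha_j^vee>) = (al i j),
linear independence, and finiteness of the Weyl group.
Vectors are functions nat => int / nat => real; only coordinates < n matter.
\<close>

definition charlat :: "nat \<Rightarrow> (nat \<Rightarrow> int) set" where
  "charlat n = {lam. \<forall>j\<ge>n. lam j = 0}"

definition pair :: "nat \<Rightarrow> (nat \<Rightarrow> int) \<Rightarrow> (nat \<Rightarrow> real) \<Rightarrow> real" where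
  "pair n lam x = (\<Sum>j<n. of_int (lam j) * x j)"

definition unitvec :: "nat \<Rightarrow> nat \<Rightarrow> int" where
  "unitvec i = (\<lambda>j. if j = i then 1 else 0)"

text \<open>Simple reflection on X^*(A): lam - <lam, alpha_i^vee> alpha_i, with alpha_i^vee = e_i.\<close>
definition reflX :: "(nat \<Rightarrow> nat \<Rightarrow> int) \<Rightarrow> nat \<Rightarrow> (nat \<Rightarrow> int) \<Rightarrow> (nat \<Rightarrow> int)" where
  "reflX al i lam = (\<lambda>j. lam j - lam i * al i j)"

text \<open>Simple reflection on a = X_*(A) (x) R: x - <alpha_i, x> alpha_i^vee.\<close>
definition refla :: "nat \<Rightarrow> (nat \<Rightarrow> nat \<Rightarrow> int) \<Rightarrow> nat \<Rightarrow> (nat \<Rightarrow> real) \<Rightarrow> (nat \<Rightarrow> real)" where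
  "refla n al i x = (\<lambda>j. x j - (if j = i then pair n (al i) x else 0))"

text \<open>Weyl group W_J generated by simple reflections s_i, i in J (J = Delta_M).
An element is represented by the pair (its action on X^*(A), its action on a).\<close>
inductive_set Wgrp :: "nat \<Rightarrow> nat \<Rightarrow> (nat \<Rightarrow> nat \<Rightarrow> int) \<Rightarrow> nat set \<Rightarrow>
    (((nat \<Rightarrow> int) \<Rightarrow> (nat \<Rightarrow> int)) \<times> ((nat \<Rightarrow> real) \<Rightarrow> (nat \<Rightarrow> real))) set"
  for n l al J where
  Wid: "(id, id) \<in> Wgrp n l al J"
| Wstep: "\<lbrakk>w \<in> Wgrp n l al J; i \<in> J; i < l\<rbrakk>
          \<Longrightarrow> (reflX al i \<circ> fst w, refla n al i \<circ> snd w) \<in> Wgrp n l al J"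

abbreviation Weyl :: "nat \<Rightarrow> nat \<Rightarrow> (nat \<Rightarrow> nat \<Rightarrow> int) \<Rightarrow>
    (((nat \<Rightarrow> int) \<Rightarrow> (nat \<Rightarrow> int)) \<times> ((nat \<Rightarrow> real) \<Rightarrow> (nat \<Rightarrow> real))) set" where
  "Weyl n l al \<equiv> Wgrp n l al {..<l}"

text \<open>Standing assumptions: root datum of a connected reductive group with simply
connected derived group of rank l, in the chosen coordinates.\<close>
definition root_datum :: "nat \<Rightarrow> nat \<Rightarrow> (nat \<Rightarrow> nat \<Rightarrow> int) \<Rightarrow> bool" where
  "root_datum n l al \<longleftrightarrow>
     l \<le> n \<and>
     (\<forall>i<l. al i \<in> charlat n) \<and>
     (\<forall>i<l. al i i = 2) \<and>
     (\<forall>i<l. \<forall>j<l. i \<noteq> j \<longrightarrow> al i j \<le> 0 \<and> (al i j = 0 \<longleftrightarrow> al j i = 0)) \<and>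
     (\<forall>c :: nat \<Rightarrow> real. (\<forall>j<n. (\<Sum>i<l. c i * of_int (al i j)) = 0) \<longrightarrow> (\<forall>i<l. c i = 0)) \<and>
     finite (Weyl n l al)"

definition rootsJ :: "nat \<Rightarrow> nat \<Rightarrow> (nat \<Rightarrow> nat \<Rightarrow> int) \<Rightarrow> nat set \<Rightarrow> (nat \<Rightarrow> int) set" where
  "rootsJ n l al J = {fst w (al i) | w i. w \<in> Wgrp n l al J \<and> i \<in> J \<and> i < l}"

abbreviation roots :: "nat \<Rightarrow> nat \<Rightarrow> (nat \<Rightarrow> nat \<Rightarrow> int) \<Rightarrow> (nat \<Rightarrow> int) set" where
  "roots n l al \<equiv> rootsJ n l al {..<l}"

definition posroots :: "nat \<Rightarrow> (nat \<Rightarrow> nat \<Rightarrow> int) \<Rightarrow> (nat \<Rightarrow> int) set" where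
  "posroots l al = {a. \<exists>c :: nat \<Rightarrow> nat. a = (\<lambda>j. \<Sum>i<l. int (c i) * al i j)}"

definition m_nu :: "nat \<Rightarrow> nat \<Rightarrow> (nat \<Rightarrow> nat \<Rightarrow> int) \<Rightarrow> (nat \<Rightarrow> real) \<Rightarrow> real" where
  "m_nu n l al nu = (\<Sum>a\<in>roots n l al. max 0 (pair n a nu))"

definition pM :: "nat \<Rightarrow> nat \<Rightarrow> (nat \<Rightarrow> nat \<Rightarrow> int) \<Rightarrow> nat set \<Rightarrow> (nat \<Rightarrow> real) \<Rightarrow> (nat \<Rightarrow> real)" where
  "pM n l al J x = (\<lambda>j. (\<Sum>w\<in>Wgrp n l al J. snd w x j) / real (card (Wgrp n l al J)))"

definition LambdaM :: "nat \<Rightarrow> nat \<Rightarrow> (nat \<Rightarrow> nat \<Rightarrow> int) \<Rightarrow> nat set \<Rightarrow> (nat \<Rightarrow> real) set" where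
  "LambdaM n l al J = {pM n l al J (\<lambda>j. of_int (lam j)) | lam. lam \<in> charlat n}"

definition LambdaPplus :: "nat \<Rightarrow> nat \<Rightarrow> (nat \<Rightarrow> nat \<Rightarrow> int) \<Rightarrow> nat set \<Rightarrow> (nat \<Rightarrow> real) set" where
  "LambdaPplus n l al J = {nu \<in> LambdaM n l al J. \<forall>i<l. i \<notin> J \<longrightarrow> pair n (al i) nu > 0}"

text \<open>psi_M.  The alcove of R_M (product of the alcoves of its irreducible components),
pulled back to a: points x with 0 < <alpha,x> < 1 for all positive roots alpha of R_M.
Q(R_M^vee) is spanned by the simple coroots e_j, j in J.  psi_M(nu) is the Weyl part w
of the unique element t_mu o w of the stabiliser of the alcove in P(R_M^vee) x| W_M
with mu congruent mod Q(R_M^vee) to a lift lam in X_*(A) of nu.\<close>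
definition alcove :: "nat \<Rightarrow> nat \<Rightarrow> (nat \<Rightarrow> nat \<Rightarrow> int) \<Rightarrow> nat set \<Rightarrow> (nat \<Rightarrow> real) set" where
  "alcove n l al J = {x. \<forall>a\<in>rootsJ n l al J \<inter> posroots l al. 0 < pair n a x \<and> pair n a x < 1}"

definition corootlatJ :: "nat set \<Rightarrow> (nat \<Rightarrow> int) set" where
  "corootlatJ J = {k. \<forall>j. j \<notin> J \<longrightarrow> k j = 0}"

definition psiM :: "nat \<Rightarrow> nat \<Rightarrow> (nat \<Rightarrow> nat \<Rightarrow> int) \<Rightarrow> nat set \<Rightarrow> (nat \<Rightarrow> real) \<Rightarrow>
    (((nat \<Rightarrow> int) \<Rightarrow> (nat \<Rightarrow> int)) \<times> ((nat \<Rightarrow> real) \<Rightarrow> (nat \<Rightarrow> real)))" where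
  "psiM n l al J nu = (THE w. w \<in> Wgrp n l al J \<and>
      (\<exists>lam\<in>charlat n. pM n l al J (\<lambda>j. of_int (lam j)) = nu \<and>
        (\<exists>k\<in>corootlatJ J.
           (\<lambda>x. (\<lambda>j. snd w x j + of_int (lam j + k j))) ` alcove n l al J = alcove n l al J)))"

definition W_conj :: "nat \<Rightarrow> nat \<Rightarrow> (nat \<Rightarrow> nat \<Rightarrow> int) \<Rightarrow>
    (((nat \<Rightarrow> int) \<Rightarrow> (nat \<Rightarrow> int)) \<times> ((nat \<Rightarrow> real) \<Rightarrow> (nat \<Rightarrow> real))) \<Rightarrow>
    (((nat \<Rightarrow> int) \<Rightarrow> (nat \<Rightarrow> int)) \<times> ((nat \<Rightarrow> real) \<Rightarrow> (nat \<Rightarrow> real))) \<Rightarrow> bool" where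
  "W_conj n l al h w \<longleftrightarrow> (\<exists>g\<in>Weyl n l al. fst h \<circ> fst g = fst g \<circ> fst w \<and> snd h \<circ> snd g = snd g \<circ> snd w)"

text \<open>An element sum_q f(q) eps^q of Fbar = union of C((eps^(1/d))) is represented by its
coefficient function f :: rat => complex, whose support is bounded below and contained in
(1/d)Z for some d > 0.\<close>
definition puiseux :: "(rat \<Rightarrow> complex) set" where
  "puiseux = {f. \<exists>d::nat. d > 0 \<and> (\<exists>N::rat. \<forall>q. f q \<noteq> 0 \<longrightarrow>
                 N \<le> q \<and> (\<exists>k::int. q = of_int k / of_nat d))}"

definition p_zero :: "rat \<Rightarrow> complex" where "p_zero = (\<lambda>_. 0)"
definition p_one :: "rat \<Rightarrow> complex" where "p_one = (\<lambda>q. if q = 0 then 1 else 0)"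
definition p_sub :: "(rat \<Rightarrow> complex) \<Rightarrow> (rat \<Rightarrow> complex) \<Rightarrow> (rat \<Rightarrow> complex)" where
  "p_sub f g = (\<lambda>q. f q - g q)"
definition p_sum :: "'a set \<Rightarrow> ('a \<Rightarrow> rat \<Rightarrow> complex) \<Rightarrow> (rat \<Rightarrow> complex)" where
  "p_sum S g = (\<lambda>q. \<Sum>x\<in>S. g x q)"
definition p_mult :: "(rat \<Rightarrow> complex) \<Rightarrow> (rat \<Rightarrow> complex) \<Rightarrow> (rat \<Rightarrow> complex)" where
  "p_mult f g = (\<lambda>q. \<Sum>r\<in>{r. f r \<noteq> 0 \<and> g (q - r) \<noteq> 0}. f r * g (q - r))"

text \<open>Galois generator: sigma(eps^(k/d)) = exp(2 pi i k/d) eps^(k/d).\<close>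
definition p_sigma :: "(rat \<Rightarrow> complex) \<Rightarrow> (rat \<Rightarrow> complex)" where
  "p_sigma f = (\<lambda>q. exp (2 * of_real pi * \<i> * of_real (of_rat q)) * f q)"

text \<open>Valuation with val(eps^(1/n)) = -1/n; None encodes the zero element.\<close>
definition p_val :: "(rat \<Rightarrow> complex) \<Rightarrow> real option" where
  "p_val f = (if f = p_zero then None
              else Some (- of_rat (THE m. f m \<noteq> 0 \<and> (\<forall>q. f q \<noteq> 0 \<longrightarrow> m \<le> q))))"

text \<open>A point a of A(Fbar) is given by the homomorphism lam |-> lam(a), X^*(A) -> Fbar^*.\<close>
definition torus_pt :: "nat \<Rightarrow> ((nat \<Rightarrow> int) \<Rightarrow> (rat \<Rightarrow> complex)) \<Rightarrow> bool" where
  "torus_pt n chi \<longleftrightarrow> (\<forall>lam\<in>charlat n. chi lam \<in> puiseux) \<and> chi (\<lambda>_. 0) = p_one \<and>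
     (\<forall>lam\<in>charlat n. \<forall>mu\<in>charlat n. chi (\<lambda>j. lam j + mu j) = p_mult (chi lam) (chi mu))"

text \<open>sigma(a) = h(a), where lam(h a) = (h^-1 lam)(a); equivalently sigma((h mu)(a)) = mu(a).\<close>
definition sigma_eq :: "nat \<Rightarrow> ((nat \<Rightarrow> int) \<Rightarrow> (rat \<Rightarrow> complex)) \<Rightarrow>
    (((nat \<Rightarrow> int) \<Rightarrow> (nat \<Rightarrow> int)) \<times> ((nat \<Rightarrow> real) \<Rightarrow> (nat \<Rightarrow> real))) \<Rightarrow> bool" where
  "sigma_eq n chi h \<longleftrightarrow> (\<forall>mu\<in>charlat n. p_sigma (chi (fst h mu)) = chi mu)"

definition orbit :: "nat \<Rightarrow> nat \<Rightarrow> (nat \<Rightarrow> nat \<Rightarrow> int) \<Rightarrow> nat \<Rightarrow> (nat \<Rightarrow> int) set" where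
  "orbit n l al i = {fst w (unitvec i) | w. w \<in> Weyl n l al}"

definition cmap :: "nat \<Rightarrow> nat \<Rightarrow> (nat \<Rightarrow> nat \<Rightarrow> int) \<Rightarrow> ((nat \<Rightarrow> int) \<Rightarrow> (rat \<Rightarrow> complex)) \<Rightarrow>
    (nat \<Rightarrow> rat \<Rightarrow> complex)" where
  "cmap n l al chi = (\<lambda>i. if i < n then p_sum (orbit n l al i) chi else p_zero)"

text \<open>Omega(a) = prod over roots of (1 - alpha(a)) (the product is commutative on Fbar).\<close>
definition Omega :: "nat \<Rightarrow> nat \<Rightarrow> (nat \<Rightarrow> nat \<Rightarrow> int) \<Rightarrow> ((nat \<Rightarrow> int) \<Rightarrow> (rat \<Rightarrow> complex)) \<Rightarrow>
    (rat \<Rightarrow> complex)" where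
  "Omega n l al chi = Finite_Set.fold (\<lambda>a p. p_mult (p_sub p_one (chi a)) p) p_one (roots n l al)"

definition AF_nu :: "nat \<Rightarrow> nat \<Rightarrow> (nat \<Rightarrow> nat \<Rightarrow> int) \<Rightarrow> (nat \<Rightarrow> real) \<Rightarrow> (nat \<Rightarrow> rat \<Rightarrow> complex) set" where
  "AF_nu n l al nu = {c. \<exists>chi. torus_pt n chi \<and> c = cmap n l al chi \<and>
      (\<exists>g\<in>Weyl n l al. sigma_eq n chi g) \<and>
      (\<forall>lam\<in>charlat n. p_val (chi lam) = Some (pair n lam nu))}"

definition X_nu :: "nat \<Rightarrow> nat \<Rightarrow> (nat \<Rightarrow> nat \<Rightarrow> int) \<Rightarrow> (nat \<Rightarrow> real) \<Rightarrow> (nat \<Rightarrow> rat \<Rightarrow> complex) set" where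
  "X_nu n l al nu = {c \<in> AF_nu n l al nu. \<exists>chi. torus_pt n chi \<and> c = cmap n l al chi \<and>
      p_val (Omega n l al chi) = Some (m_nu n l al nu)}"

end

theory Submission
  imports Defs "HOL-Computational_Algebra.Formal_Laurent_Series"
begin

text \<open>
Let \<open>a\<close> satisfy \<open>\<sigma>(a) = g(a)\<close> with \<open>val \<lambda>(a) = \<langle>\<lambda>, \<nu>\<rangle>\<close>. Comparing valuations shows that \<open>g\<close> fixes \<open>\<nu>\<close>, so
\<open>g \<in> W\<^sub>M\<close>; comparing leading coefficients, which form a character \<open>\<lambda> \<mapsto> exp (2 \<pi> i \<langle>\<lambda>, x\<rangle>)\<close>, gives
\<open>z = g z + \<lambda>\<^sub>0 - \<nu>\<close> for \<open>z = -x\<close> and a lift \<open>\<lambda>\<^sub>0\<close> of \<open>\<nu>\<close>. The condition \<open>val \<Omega>(a) = m\<^sub>\<nu>\<close> says exactly that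
\<open>\<langle>\<alpha>, x\<rangle>\<close> is not an integer for any root \<open>\<alpha>\<close> of \<open>M\<close>. Moving \<open>z\<close> into the fundamental alcove of \<open>M\<close> by the
affine Weyl group conjugates \<open>g\<close> into the linear part of an element stabilizing that alcove, which is
\<open>\<psi>\<^sub>M(\<nu>)\<close> because the affine Weyl group permutes the alcoves simply transitively. Conversely, a fixed
point of the stabilizing element inside the alcove yields a monomial point of \<open>X\<^sub>\<nu>\<close>. Any other
\<open>a\<close> with the same image in \<open>A/W\<close> is a \<open>W\<close>-translate: the values of all orbit sums are determined by
those at the fundamental weights, and distinct characters are linearly independent.
\<close>

section \<open>The Weyl group and an invariant form\<close>

text \<open>The hypotheses supply a Cartan-like matrix, linear independence and a finite group, so
  the root theory is built from these alone. Since the derived group is simply connected, the simple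
  coroots are the basis vectors \<open>ev i\<close>; positivity, supports and lattice membership are
  therefore read off from the coordinates of coroots, and every root is carried along with its
  coroot. An inner product, made invariant by summing over the group, replaces hyperplane geometry:
  a shortest-vector argument reaches the alcove, and freeness holds because alcove points lie
  strictly nearer to 0 than to any other point of the coroot lattice. Two obstacles shape the rest.
  Leading coefficients need not have modulus one, so their character has a modulus part, which is
  folded into a real vector by a small multiple (\<open>avoid_integers\<close>). And
  \<open>X_nu\<close> allows the point with the prescribed valuations to differ from the point at
  which Omega is measured; they agree up to the Weyl group because \<open>cmap\<close> separates its
  orbits.\<close>

definition ev :: "nat \<Rightarrow> nat \<Rightarrow> real" where
  "ev i = (\<lambda>j. if j = i then 1 else 0)"

abbreviation rv :: "(nat \<Rightarrow> int) \<Rightarrow> nat \<Rightarrow> real" where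
  "rv k \<equiv> (\<lambda>j. of_int (k j))"

lemma pair_lin: "pair n a (\<lambda>j. c * x j + d * y j) = c * pair n a x + d * pair n a y"
  by (simp add: pair_def sum_distrib_left sum.distrib algebra_simps)

lemma pair_add: "pair n a (\<lambda>j. x j + y j) = pair n a x + pair n a y"
  using pair_lin[of n a 1 x 1 y] by simp

lemma pair_diff: "pair n a (\<lambda>j. x j - y j) = pair n a x - pair n a y"
  using pair_lin[of n a 1 x "-1" y] by simp

lemma pair_scale: "pair n a (\<lambda>j. c * x j) = c * pair n a x"
  using pair_lin[of n a c x 0 x] by simp

lemma pair_zero [simp]: "pair n a (\<lambda>j. 0) = 0"
  by (simp add: pair_def)

lemma pair_sum: "pair n a (\<lambda>j. \<Sum>i\<in>S. v i j) = (\<Sum>i\<in>S. pair n a (v i))"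
  by (simp add: pair_def sum_distrib_left sum.swap[of _ S])

lemma pair_sum_left: "pair n (\<lambda>j. \<Sum>i\<in>S. c i * v i j) x = (\<Sum>i\<in>S. of_int (c i) * pair n (v i) x)"
  by (simp add: pair_def sum_distrib_left sum_distrib_right sum.swap[of _ S] mult_ac)

lemma pair_ev: "i < n \<Longrightarrow> pair n a (ev i) = of_int (a i)"
proof -
  assume "i < n"
  have "pair n a (ev i) = (\<Sum>j<n. if j = i then of_int (a j) else 0)"
    unfolding pair_def ev_def by (intro sum.cong) auto
  then show ?thesis using \<open>i < n\<close> by simp
qed

lemma pair_uminus_left: "pair n (\<lambda>j. - a j) x = - pair n a x"
  by (simp add: pair_def sum_negf)

lemma pair_add_left: "pair n (\<lambda>j. a j + b j) x = pair n a x + pair n b x"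
  by (simp add: pair_def sum.distrib algebra_simps)

lemma pair_diff_left: "pair n (\<lambda>j. a j - b j) x = pair n a x - pair n b x"
  by (simp add: pair_def sum_subtractf algebra_simps)

lemma pair_scale_left: "pair n (\<lambda>j. c * a j) x = of_int c * pair n a x"
  by (simp add: pair_def sum_distrib_left algebra_simps)

lemma pair_unitvec: "j < n \<Longrightarrow> pair n (unitvec j) x = x j"
proof -
  assume "j < n"
  have "pair n (unitvec j) x = (\<Sum>i<n. if i = j then x i else 0)"
    unfolding pair_def unitvec_def by (intro sum.cong) auto
  then show ?thesis using \<open>j < n\<close> by simp
qed

lemma pair_Ints: "pair n a (rv k) \<in> \<int>"
  unfolding pair_def by (intro Ints_sum) (simp flip: of_int_mult)

section \<open>Weyl group elements as pairs of dual linear maps\<close>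

locale weyl =
  fixes n l :: nat and al :: "nat \<Rightarrow> nat \<Rightarrow> int"
  assumes rd: "root_datum n l al"
begin

abbreviation W where "W \<equiv> Wgrp n l al"
abbreviation I where "I \<equiv> {..<l}"
abbreviation sX where "sX \<equiv> reflX al"
abbreviation sa where "sa \<equiv> refla n al"
abbreviation pr where "pr \<equiv> pair n"

lemma l_le_n: "l \<le> n" and al_char: "i < l \<Longrightarrow> al i \<in> charlat n" and al2: "i < l \<Longrightarrow> al i i = 2"
  and al_le: "i < l \<Longrightarrow> j < l \<Longrightarrow> i \<noteq> j \<Longrightarrow> al i j \<le> 0"
  and al_indep: "(\<And>j. j < n \<Longrightarrow> (\<Sum>i<l. c i * of_int (al i j)) = (0::real)) \<Longrightarrow> i < l \<Longrightarrow> c i = 0"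
  and finI: "finite (W I)"
  using rd unfolding root_datum_def by blast+

lemma W_mono: "J \<subseteq> K \<Longrightarrow> W J \<subseteq> W K"
proof
  fix w assume "J \<subseteq> K" "w \<in> W J"
  show "w \<in> W K" using \<open>w \<in> W J\<close> \<open>J \<subseteq> K\<close>
    by (induction rule: Wgrp.induct) (auto intro: Wgrp.intros)
qed

text \<open>Generators are taken from J only below \<open>l\<close>, so further indices in J are
  inert.\<close>

lemma W_restrict: "w \<in> W J \<Longrightarrow> w \<in> W (J \<inter> I)"
  by (induction rule: Wgrp.induct) (auto intro: Wgrp.intros)

lemma W_sub: "W J \<subseteq> W I"
  using W_restrict W_mono[of "J \<inter> I" I] by auto

lemma finW: "finite (W J)"
  using W_sub finI finite_subset by blast

lemma W_id: "(id, id) \<in> W J" by (rule Wgrp.Wid)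

lemma W_nonempty: "W J \<noteq> {}" using W_id by blast

lemma W_comp: "u \<in> W J \<Longrightarrow> w \<in> W J \<Longrightarrow> (fst u \<circ> fst w, snd u \<circ> snd w) \<in> W J"
proof (induction rule: Wgrp.induct)
  case (Wstep u i)
  then show ?case using Wgrp.Wstep[of "(fst u \<circ> fst w, snd u \<circ> snd w)" n l al J i] by (simp only: comp_assoc fst_conv snd_conv simp_thms)
qed simp

lemma W_gen: "i \<in> J \<Longrightarrow> i < l \<Longrightarrow> (sX i, sa i) \<in> W J"
  using Wgrp.Wstep[OF W_id] by fastforce

lemma sX_invol: "i < l \<Longrightarrow> sX i (sX i x) = x"
  by (auto simp: reflX_def al2 fun_eq_iff algebra_simps)

lemma sa_alt: "sa i x = (\<lambda>j. x j - pr (al i) x * ev i j)"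
  by (auto simp: refla_def ev_def)

lemma pr_al_ev: "i < l \<Longrightarrow> j < l \<Longrightarrow> pr (al i) (ev j) = al i j"
  using l_le_n by (simp add: pair_ev)

lemma sa_pr: "i < l \<Longrightarrow> pr a (sa i x) = pr a x - pr (al i) x * a i"
  using l_le_n by (simp add: sa_alt pair_diff pair_scale pair_ev)

lemma sa_invol: "i < l \<Longrightarrow> sa i (sa i x) = x"
  unfolding sa_alt[of i "sa i x"] using l_le_n by (auto simp: sa_pr al2) (auto simp: sa_alt)

lemma sX_pr: "i < l \<Longrightarrow> pr (sX i a) x = pr a x - a i * pr (al i) x"
  by (simp add: reflX_def pair_diff_left pair_scale_left)

lemma s_pair: "i < l \<Longrightarrow> pr (sX i a) (sa i x) = pr a x"
  by (simp add: sX_pr sa_pr al2) (simp add: reflX_def al2 sX_pr algebra_simps pair_diff_left pair_scale_left)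

text \<open>Contragredience of the two components, inherited from each simple reflection; it is the
  device for moving a group element across the pairing.\<close>

lemma W_pair: "w \<in> W J \<Longrightarrow> pr (fst w a) (snd w x) = pr a x"
  by (induction arbitrary: a x rule: Wgrp.induct) (auto simp: s_pair)

lemma sX_lin: "sX i (\<lambda>j. c * x j + d * y j) = (\<lambda>j. c * sX i x j + d * sX i y j)"
  by (auto simp: reflX_def fun_eq_iff algebra_simps)

lemma sa_lin: "sa i (\<lambda>j. c * x j + d * y j) = (\<lambda>j. c * sa i x j + d * sa i y j)"
  by (auto simp: refla_def fun_eq_iff algebra_simps pair_lin)

lemma WX_lin: "w \<in> W J \<Longrightarrow> fst w (\<lambda>j. c * x j + d * y j) = (\<lambda>j. c * fst w x j + d * fst w y j)"
  by (induction arbitrary: c d x y rule: Wgrp.induct) (auto simp: sX_lin)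

lemma Wa_lin: "w \<in> W J \<Longrightarrow> snd w (\<lambda>j. c * x j + d * y j) = (\<lambda>j. c * snd w x j + d * snd w y j)"
  by (induction arbitrary: c d x y rule: Wgrp.induct) (auto simp: sa_lin)

lemma WX_add: "w \<in> W J \<Longrightarrow> fst w (\<lambda>j. x j + y j) = (\<lambda>j. fst w x j + fst w y j)"
  using WX_lin[of w J 1 x 1 y] by simp
lemma WX_diff: "w \<in> W J \<Longrightarrow> fst w (\<lambda>j. x j - y j) = (\<lambda>j. fst w x j - fst w y j)"
  using WX_lin[of w J 1 x "-1" y] by simp
lemma WX_scale: "w \<in> W J \<Longrightarrow> fst w (\<lambda>j. c * x j) = (\<lambda>j. c * fst w x j)"
  using WX_lin[of w J c x 0 x] by simp
lemma WX_uminus: "w \<in> W J \<Longrightarrow> fst w (\<lambda>j. - x j) = (\<lambda>j. - fst w x j)"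
  using WX_scale[of w J "-1" x] by simp
lemma WX_zero: "w \<in> W J \<Longrightarrow> fst w (\<lambda>j. 0) = (\<lambda>j. 0)"
  using WX_scale[of w J 0 "\<lambda>_. 0"] by simp
lemma Wa_add: "w \<in> W J \<Longrightarrow> snd w (\<lambda>j. x j + y j) = (\<lambda>j. snd w x j + snd w y j)"
  using Wa_lin[of w J 1 x 1 y] by simp
lemma Wa_diff: "w \<in> W J \<Longrightarrow> snd w (\<lambda>j. x j - y j) = (\<lambda>j. snd w x j - snd w y j)"
  using Wa_lin[of w J 1 x "-1" y] by simp
lemma Wa_scale: "w \<in> W J \<Longrightarrow> snd w (\<lambda>j. c * x j) = (\<lambda>j. c * snd w x j)"
  using Wa_lin[of w J c x 0 x] by simp
lemma Wa_uminus: "w \<in> W J \<Longrightarrow> snd w (\<lambda>j. - x j) = (\<lambda>j. - snd w x j)"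
  using Wa_scale[of w J "-1" x] by simp
lemma Wa_zero: "w \<in> W J \<Longrightarrow> snd w (\<lambda>j. 0) = (\<lambda>j. 0)"
  using Wa_scale[of w J 0 "\<lambda>_. 0"] by simp
lemma Wa_sum: "w \<in> W J \<Longrightarrow> snd w (\<lambda>j. \<Sum>i\<in>S. v i j) = (\<lambda>j. \<Sum>i\<in>S. snd w (v i) j)"
  by (induction S rule: infinite_finite_induct) (auto simp: Wa_zero Wa_add)

lemma W_inv:
  assumes "w \<in> W J"
  obtains v where "v \<in> W J" "fst v \<circ> fst w = id" "fst w \<circ> fst v = id" "snd v \<circ> snd w = id" "snd w \<circ> snd v = id"
proof -
  have "\<exists>v\<in>W J. fst v \<circ> fst w = id \<and> fst w \<circ> fst v = id \<and> snd v \<circ> snd w = id \<and> snd w \<circ> snd v = id"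
    using assms
  proof (induction rule: Wgrp.induct)
    case Wid
    then show ?case using W_id[of J] by (intro bexI[of _ "(id,id)"]) auto
  next
    case (Wstep w i)
    then obtain v where v: "v \<in> W J" "fst v \<circ> fst w = id" "fst w \<circ> fst v = id" "snd v \<circ> snd w = id" "snd w \<circ> snd v = id"
      by blast
    have "(fst v \<circ> sX i, snd v \<circ> sa i) \<in> W J"
      using W_comp[OF v(1) W_gen[of i J]] Wstep by simp
    moreover have "fst v (fst w x) = x" "fst w (fst v x) = x" "snd v (snd w y) = y" "snd w (snd v y) = y" for x y
      using v by (simp_all add: pointfree_idE)
    ultimately show ?case using Wstep(3)
      by (intro bexI[of _ "(fst v \<circ> sX i, snd v \<circ> sa i)"] conjI ext) (simp_all add: sX_invol sa_invol)
  qed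
  then show ?thesis using that by blast
qed

lemma W_bij: assumes "w \<in> W J" shows "bij (fst w)" "bij (snd w)"
  using W_inv[OF assms] by (metis o_bij)+

lemma W_left_bij:
  assumes u: "u \<in> W J"
  shows "bij_betw (\<lambda>w. (fst u \<circ> fst w, snd u \<circ> snd w)) (W J) (W J)"
proof -
  obtain v where v: "v \<in> W J" "fst v \<circ> fst u = id" "fst u \<circ> fst v = id" "snd v \<circ> snd u = id" "snd u \<circ> snd v = id"
    using W_inv[OF u] by blast
  show ?thesis
    by (rule bij_betw_byWitness[where f' = "\<lambda>w. (fst v \<circ> fst w, snd v \<circ> snd w)"])
       (use v in \<open>auto simp: comp_assoc[symmetric] intro: W_comp[OF u] W_comp[OF v(1)]\<close>)
qed

lemma W_right_bij:
  assumes u: "u \<in> W J"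
  shows "bij_betw (\<lambda>w. (fst w \<circ> fst u, snd w \<circ> snd u)) (W J) (W J)"
proof -
  obtain v where v: "v \<in> W J" "fst v \<circ> fst u = id" "fst u \<circ> fst v = id" "snd v \<circ> snd u = id" "snd u \<circ> snd v = id"
    using W_inv[OF u] by blast
  show ?thesis
    by (rule bij_betw_byWitness[where f' = "\<lambda>w. (fst w \<circ> fst v, snd w \<circ> snd v)"])
       (use v u in \<open>auto simp: comp_assoc intro: W_comp\<close>)
qed

lemma W_sum_left: "u \<in> W J \<Longrightarrow> (\<Sum>w\<in>W J. f (fst u \<circ> fst w) (snd u \<circ> snd w)) = (\<Sum>w\<in>W J. f (fst w) (snd w))"
  using sum.reindex_bij_betw[OF W_left_bij, of u J "\<lambda>w. f (fst w) (snd w)"] by simp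

lemma W_sum_right: "u \<in> W J \<Longrightarrow> (\<Sum>w\<in>W J. f (fst w \<circ> fst u) (snd w \<circ> snd u)) = (\<Sum>w\<in>W J. f (fst w) (snd w))"
  using sum.reindex_bij_betw[OF W_right_bij, of u J "\<lambda>w. f (fst w) (snd w)"] by simp

lemma WX_char: "w \<in> W J \<Longrightarrow> a \<in> charlat n \<Longrightarrow> fst w a \<in> charlat n"
proof (induction rule: Wgrp.induct)
  case (Wstep w i)
  then show ?case using al_char[of i] by (auto simp: charlat_def reflX_def)
qed simp

text \<open>A simple reflection on cocharacters subtracts a multiple of \<open>ev i\<close> only.
  Bookkeeping modulo the coroot lattice of J thus reduces to comparing coordinates outside
  J.\<close>

lemma Wa_support: "w \<in> W J \<Longrightarrow> j \<notin> J \<Longrightarrow> snd w x j = x j"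
  by (induction rule: Wgrp.induct) (auto simp: refla_def)

lemma Wa_int: "w \<in> W J \<Longrightarrow> \<exists>k'. snd w (rv k) = rv k'"
proof (induction rule: Wgrp.induct)
  case Wid
  then show ?case by auto
next
  case (Wstep w i)
  then obtain k' where "snd w (rv k) = rv k'" by blast
  moreover have "sa i (rv k') = rv (\<lambda>j. k' j - (if j = i then (\<Sum>j<n. al i j * k' j) else 0))"
    by (rule ext) (simp add: refla_def pair_def of_int_sum)
  ultimately have "snd (sX i \<circ> fst w, sa i \<circ> snd w) (rv k) = rv (\<lambda>j. k' j - (if j = i then (\<Sum>j<n. al i j * k' j) else 0))"
    by (simp only: snd_conv o_apply)
  then show ?case by (intro exI[of _ "\<lambda>j. k' j - (if j = i then (\<Sum>j<n. al i j * k' j) else 0)"])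
qed

lemma Wa_int_support: "w \<in> W J \<Longrightarrow> (\<And>j. j \<notin> J \<Longrightarrow> k j = 0) \<Longrightarrow> \<exists>k'. snd w (rv k) = rv k' \<and> (\<forall>j. j \<notin> J \<longrightarrow> k' j = 0)"
  using Wa_int[of w J k] Wa_support[of w J _ "rv k"] by (metis of_int_eq_0_iff)

text \<open>Finiteness of the Weyl group enters here: summing the dot product over the group makes
  it invariant, while the summand of the identity keeps it positive on the first \<open>n\<close>
  coordinates.\<close>

definition B :: "(nat \<Rightarrow> real) \<Rightarrow> (nat \<Rightarrow> real) \<Rightarrow> real" where
  "B x y = (\<Sum>w\<in>W I. \<Sum>j<n. snd w x j * snd w y j)"

lemma B_W: assumes "u \<in> W J" shows "B (snd u x) (snd u y) = B x y"
  using W_sum_right[of u I "\<lambda>f g. \<Sum>j<n. g x j * g y j"] assms W_sub unfolding B_def by auto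

lemma B_sym: "B x y = B y x" by (simp add: B_def mult.commute)

lemma B_lin: "B (\<lambda>j. c * x j + d * y j) z = c * B x z + d * B y z"
proof -
  have "B (\<lambda>j. c * x j + d * y j) z = (\<Sum>w\<in>W I. \<Sum>j<n. c * (snd w x j * snd w z j) + d * (snd w y j * snd w z j))"
    unfolding B_def by (intro sum.cong refl) (simp add: Wa_lin algebra_simps)
  then show ?thesis by (simp add: B_def sum.distrib sum_distrib_left)
qed

lemma B_add: "B (\<lambda>j. x j + y j) z = B x z + B y z" using B_lin[of 1 x 1 y z] by simp
lemma B_diff: "B (\<lambda>j. x j - y j) z = B x z - B y z" using B_lin[of 1 x "-1" y z] by simp
lemma B_scale: "B (\<lambda>j. c * x j) z = c * B x z" using B_lin[of c x 0 x z] by simp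
lemma B_uminus: "B (\<lambda>j. - x j) z = - B x z" using B_scale[of "-1" x z] by simp
lemma B_zero: "B (\<lambda>j. 0) z = 0" using B_scale[of 0 z z] by simp
lemma B_add': "B z (\<lambda>j. x j + y j) = B z x + B z y" using B_add B_sym by metis
lemma B_diff': "B z (\<lambda>j. x j - y j) = B z x - B z y" using B_diff B_sym by metis
lemma B_scale': "B z (\<lambda>j. c * x j) = c * B z x" using B_scale B_sym by metis
lemma B_uminus': "B z (\<lambda>j. - x j) = - B z x" using B_uminus B_sym by metis
lemma B_zero': "B z (\<lambda>j. 0) = 0" using B_zero B_sym by metis
lemma B_sum: "B (\<lambda>j. \<Sum>i\<in>S. v i j) z = (\<Sum>i\<in>S. B (v i) z)"
  by (induction S rule: infinite_finite_induct) (auto simp: B_zero B_add)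

lemma B_ge: "(\<Sum>j<n. (x j)\<^sup>2) \<le> B x x"
proof -
  have "(\<Sum>j<n. x j * x j) \<le> B x x"
    unfolding B_def
    using member_le_sum[OF W_id[of I] _ finI, of "\<lambda>w. \<Sum>j<n. snd w x j * snd w x j"]
    by (simp add: sum_nonneg)
  then show ?thesis by (simp add: power2_eq_square)
qed

lemma B_ge_coord: "j < n \<Longrightarrow> (x j)\<^sup>2 \<le> B x x"
  using B_ge[of x] member_le_sum[of j "{..<n}" "\<lambda>j. (x j)\<^sup>2"] by auto

lemma B_nonneg: "0 \<le> B x x"
  unfolding B_def by (intro sum_nonneg) auto

lemma B_pos: "j < n \<Longrightarrow> x j \<noteq> 0 \<Longrightarrow> 0 < B x x"
  using B_ge_coord[of j x] zero_less_power2[of "x j"] by linarith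

lemma ev_sum: "(\<And>j. j \<notin> S \<Longrightarrow> x j = 0) \<Longrightarrow> finite S \<Longrightarrow> x = (\<lambda>j. \<Sum>i\<in>S. x i * ev i j)"
  by (rule ext) (auto simp: ev_def if_distrib[of "\<lambda>t. _ * t"] cong: if_cong)

lemma B_expand: "(\<And>j. j \<notin> S \<Longrightarrow> x j = 0) \<Longrightarrow> finite S \<Longrightarrow> B x z = (\<Sum>i\<in>S. x i * B (ev i) z)"
  by (subst ev_sum[of S x]) (auto simp: B_sum B_scale)

lemma sa_ev: "i < l \<Longrightarrow> sa i (ev i) = (\<lambda>j. - ev i j)"
  by (simp add: sa_alt pr_al_ev al2)

lemma sX_al: "i < l \<Longrightarrow> sX i (al i) = (\<lambda>j. - al i j)"
  by (simp add: reflX_def al2)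

text \<open>The reflection \<open>sa i\<close> negates \<open>ev i\<close> and preserves the form,
  which forces this relation. It turns pairings with simple roots into inner products with simple
  coroots.\<close>

lemma B_ev: assumes i: "i < l" shows "2 * B x (ev i) = B (ev i) (ev i) * pr (al i) x"
proof -
  have "B x (ev i) = B (sa i x) (sa i (ev i))"
    using B_W[OF W_gen[of i I]] i by simp
  also have "\<dots> = - B (sa i x) (ev i)" using i by (simp add: sa_ev B_uminus')
  also have "B (sa i x) (ev i) = B x (ev i) - pr (al i) x * B (ev i) (ev i)"
    by (simp add: sa_alt B_diff B_scale)
  finally show ?thesis by (simp add: mult.commute)
qed

lemma B_ev_pos: "i < l \<Longrightarrow> 0 < B (ev i) (ev i)"
  using B_pos[of i "ev i"] l_le_n by (simp add: ev_def)

lemma B_ev_le: "i < l \<Longrightarrow> j < l \<Longrightarrow> i \<noteq> j \<Longrightarrow> B (ev j) (ev i) \<le> 0"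
  using B_ev[of i "ev j"] al_le[of i j] B_ev_pos[of i] pr_al_ev[of i j]
  by (smt (verit) mult_nonneg_nonpos of_int_le_0_iff)

end

section \<open>Roots and dominance\<close>

context weyl
begin

text \<open>A root together with its coroot, both moved by the same \<open>w\<close>. The coroot has
  integral coordinates in the basis of simple coroots, which makes it the easier of the two to
  compute with.\<close>

definition rootpair :: "nat set \<Rightarrow> (nat \<Rightarrow> int) \<Rightarrow> (nat \<Rightarrow> real) \<Rightarrow> bool" where
  "rootpair J \<beta> b \<longleftrightarrow> (\<exists>w i. w \<in> W J \<and> i \<in> J \<and> i < l \<and> \<beta> = fst w (al i) \<and> b = snd w (ev i))"

lemma rootpair_root: "rootpair J \<beta> b \<Longrightarrow> \<beta> \<in> rootsJ n l al J"
  by (auto simp: rootpair_def rootsJ_def)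

lemma root_rootpair: "\<beta> \<in> rootsJ n l al J \<Longrightarrow> \<exists>b. rootpair J \<beta> b"
  by (auto simp: rootpair_def rootsJ_def)

lemma rootpair_simple: "i \<in> J \<Longrightarrow> i < l \<Longrightarrow> rootpair J (al i) (ev i)"
  unfolding rootpair_def using W_id[of J] by force

lemma rootpair_W: "rootpair J \<beta> b \<Longrightarrow> u \<in> W J \<Longrightarrow> rootpair J (fst u \<beta>) (snd u b)"
proof -
  assume "rootpair J \<beta> b" and u: "u \<in> W J"
  then obtain w i where w: "w \<in> W J" "i \<in> J" "i < l" "\<beta> = fst w (al i)" "b = snd w (ev i)"
    unfolding rootpair_def by blast
  show ?thesis unfolding rootpair_def using W_comp[OF u w(1)] w
    by (intro exI[of _ "(fst u \<circ> fst w, snd u \<circ> snd w)"] exI[of _ i]) simp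
qed

lemma rootpair_mono: "J \<subseteq> K \<Longrightarrow> rootpair J \<beta> b \<Longrightarrow> rootpair K \<beta> b"
  unfolding rootpair_def using subsetD[OF W_mono[of J K]] subsetD[of J K] by metis

lemma rootpair_uminus: assumes "rootpair J \<beta> b" shows "rootpair J (\<lambda>j. - \<beta> j) (\<lambda>j. - b j)"
proof -
  obtain w i where w: "w \<in> W J" "i \<in> J" "i < l" "\<beta> = fst w (al i)" "b = snd w (ev i)"
    using assms unfolding rootpair_def by blast
  have "(fst w \<circ> sX i, snd w \<circ> sa i) \<in> W J"
    using W_comp[OF w(1) W_gen[of i J]] w by simp
  then show ?thesis unfolding rootpair_def
    using w by (intro exI[of _ "(fst w \<circ> sX i, snd w \<circ> sa i)"] exI[of _ i])
      (simp add: sX_al sa_ev WX_uminus[OF w(1)] Wa_uminus[OF w(1)])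
qed

lemma rootpair_pair: assumes "rootpair J \<beta> b" shows "pr \<beta> b = 2"
proof -
  obtain w i where w: "w \<in> W J" "i \<in> J" "i < l" "\<beta> = fst w (al i)" "b = snd w (ev i)"
    using assms unfolding rootpair_def by blast
  then show ?thesis by (simp add: W_pair pr_al_ev al2)
qed

lemma rootpair_B: assumes "rootpair J \<beta> b" shows "2 * B x b = B b b * pr \<beta> x"
proof -
  obtain w i where w: "w \<in> W J" "i \<in> J" "i < l" "\<beta> = fst w (al i)" "b = snd w (ev i)"
    using assms unfolding rootpair_def by blast
  obtain v where v: "v \<in> W J" "snd w \<circ> snd v = id"
    using W_inv[OF w(1)] by metis
  have x: "x = snd w (snd v x)" using v by (simp add: pointfree_idE)
  show ?thesis
    by (subst (1 2) x) (simp add: w B_W[OF w(1)] W_pair[OF w(1)] B_ev)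
qed

lemma rootpair_support: assumes "rootpair J \<beta> b" "j \<notin> J" shows "b j = 0"
proof -
  obtain w i where w: "w \<in> W J" "i \<in> J" "i < l" "\<beta> = fst w (al i)" "b = snd w (ev i)"
    using assms unfolding rootpair_def by blast
  then show ?thesis using Wa_support[OF w(1) assms(2), of "ev i"] assms by (auto simp: ev_def)
qed

lemma rootpair_char: "rootpair J \<beta> b \<Longrightarrow> \<beta> \<in> charlat n"
  unfolding rootpair_def using WX_char al_char by blast

lemma rootpair_restrict: "rootpair J \<beta> b \<Longrightarrow> rootpair (J \<inter> I) \<beta> b"
  unfolding rootpair_def using W_restrict by blast

lemma rootpair_support_l: "rootpair J \<beta> b \<Longrightarrow> \<not> j < l \<Longrightarrow> b j = 0"
  using rootpair_support[OF rootpair_restrict] by blast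

lemma rootpair_Bpos: assumes "rootpair J \<beta> b" shows "0 < B b b"
proof (rule ccontr)
  assume "\<not> 0 < B b b"
  then have "\<And>j. j < n \<Longrightarrow> b j = 0" using B_pos by blast
  then have "pr \<beta> b = 0" by (simp add: pair_def)
  then show False using rootpair_pair[OF assms] by simp
qed

lemma ev_rv: "ev i = rv (unitvec i)"
  by (auto simp: ev_def unitvec_def)

lemma rootpair_int: assumes "rootpair J \<beta> b" shows "\<exists>k. b = rv k"
proof -
  obtain w i where w: "w \<in> W J" "i \<in> J" "i < l" "\<beta> = fst w (al i)" "b = snd w (ev i)"
    using assms unfolding rootpair_def by blast
  then show ?thesis using Wa_int[OF w(1)] by (simp add: ev_rv)
qed

lemma W_root_comb:
  assumes "w \<in> W J" "i < l"
  shows "\<exists>c. fst w (al i) = (\<lambda>j. \<Sum>m<l. c m * al m j)"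
  using assms(1)
proof (induction rule: Wgrp.induct)
  case Wid
  have "al i = (\<lambda>j. \<Sum>m<l. (if m = i then 1 else 0) * al m j)"
    using assms(2) by (simp add: if_distrib[of "\<lambda>t. t * _"] cong: if_cong)
  then show ?case by auto
next
  case (Wstep w k)
  then obtain c where c: "fst w (al i) = (\<lambda>j. \<Sum>m<l. c m * al m j)" by blast
  have "sX k (\<lambda>j. \<Sum>m<l. c m * al m j) = (\<lambda>j. \<Sum>m<l. (c m - (if m = k then (\<Sum>m<l. c m * al m k) else 0)) * al m j)"
    using Wstep(3) by (simp add: reflX_def left_diff_distrib sum_subtractf if_distrib[of "\<lambda>t. t * _"] cong: if_cong)
  then show ?case using c
    by (intro exI[of _ "\<lambda>m. (c m - (if m = k then (\<Sum>m<l. c m * al m k) else 0))"]) simp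
qed

text \<open>The coefficient of a root at a simple root is the coordinate of its coroot, rescaled by
  squared lengths; both are integers.\<close>

lemma rootpair_comb:
  assumes rp: "rootpair J \<beta> b"
  obtains c where "\<beta> = (\<lambda>j. \<Sum>m<l. c m * al m j)"
    "\<And>m. m < l \<Longrightarrow> of_int (c m) * B b b = b m * B (ev m) (ev m)"
proof -
  obtain w i where w: "w \<in> W J" "i \<in> J" "i < l" "\<beta> = fst w (al i)" "b = snd w (ev i)"
    using rp unfolding rootpair_def by blast
  obtain c where c: "\<beta> = (\<lambda>j. \<Sum>m<l. c m * al m j)"
    using W_root_comb[OF w(1,3)] w by auto
  \<comment> \<open>The functional \<open>2 * B b _\<close> is \<open>B b b\<close> times the root.
    Expanding \<open>b\<close> in simple coroots writes it a second time as a combination of simple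
    roots, and independence compares coefficients.\<close>
  have "of_int (c m) * B b b - b m * B (ev m) (ev m) = 0" if m: "m < l" for m
  proof (rule al_indep[OF _ m])
    fix j assume j: "j < n"
    have "2 * B b (ev j) = B b b * pr \<beta> (ev j)"
      using rootpair_B[OF rp, of "ev j"] by (simp add: B_sym)
    also have "pr \<beta> (ev j) = (\<Sum>m<l. of_int (c m) * of_int (al m j))"
      using j by (simp add: c pair_ev)
    finally have 1: "2 * B b (ev j) = (\<Sum>m<l. B b b * of_int (c m) * of_int (al m j))"
      by (simp add: sum_distrib_left mult.assoc)
    have "2 * B b (ev j) = (\<Sum>m<l. 2 * (b m * B (ev m) (ev j)))"
      using B_expand[of "{..<l}" b "ev j"] rootpair_support_l[OF rp] by (simp add: sum_distrib_left)
    also have "\<dots> = (\<Sum>m<l. b m * B (ev m) (ev m) * of_int (al m j))"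
    proof (intro sum.cong refl)
      fix m assume "m \<in> {..<l}"
      then have "2 * B (ev j) (ev m) = B (ev m) (ev m) * of_int (al m j)"
        using B_ev[of m "ev j"] j by (simp add: pair_ev)
      then show "2 * (b m * B (ev m) (ev j)) = b m * B (ev m) (ev m) * of_int (al m j)"
        by (simp add: B_sym[of "ev m" "ev j"])
    qed
    finally show "(\<Sum>m<l. (of_int (c m) * B b b - b m * B (ev m) (ev m)) * of_int (al m j)) = 0"
      unfolding left_diff_distrib sum_subtractf using 1 by (simp add: mult_ac)
  qed
  then show ?thesis using that c by force
qed

section \<open>Positive and negative coroots\<close>

definition nonneg :: "(nat \<Rightarrow> real) \<Rightarrow> bool" where "nonneg b \<longleftrightarrow> (\<forall>j. 0 \<le> b j)"

lemma nonneg_ev [simp]: "nonneg (ev i)" by (simp add: nonneg_def ev_def)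

text \<open>Reducedness: for a coroot concentrated at \<open>i\<close>, the coordinate and the root
  coefficient are integers with product 1.\<close>

lemma rootpair_multiple:
  assumes rp: "rootpair J \<beta> b" and i: "i < l" and b: "\<And>j. j \<noteq> i \<Longrightarrow> b j = 0"
  shows "b i = 1 \<or> b i = -1"
proof -
  obtain c where c: "\<And>m. m < l \<Longrightarrow> of_int (c m) * B b b = b m * B (ev m) (ev m)"
    using rootpair_comb[OF rp] by metis
  obtain k where k: "b = rv k" using rootpair_int[OF rp] by blast
  have b': "b = (\<lambda>j. b i * ev i j)" using b by (auto simp: ev_def fun_eq_iff)
  have B: "B b b = b i * (b i * B (ev i) (ev i))"
    by (subst (1 2) b') (simp add: B_scale B_scale')
  then have nz: "b i \<noteq> 0" using rootpair_Bpos[OF rp] by auto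
  have "of_int (c i) * b i = 1"
    using c[OF i] B B_ev_pos[OF i] nz by (simp add: field_simps)
  then have "c i * k i = 1" unfolding k by (metis of_int_1 of_int_eq_iff of_int_mult)
  then have "k i = 1 \<or> k i = -1" by (metis mult.commute zmult_eq_1_iff)
  then show ?thesis by (auto simp: k)
qed

text \<open>If \<open>s\<^sub>i b\<close> had the coordinate \<open>-k < 0\<close> at \<open>i\<close> and a positive one elsewhere, then
  \<open>|s\<^sub>i b|\<^sup>2 > k\<^sup>2 |e\<^sub>i|\<^sup>2\<close> by obtuseness, so the root coefficient at \<open>i\<close> would have absolute value
  strictly between \<open>0\<close> and \<open>1/k\<close>.\<close>

lemma refl_nonneg:
  assumes rp: "rootpair J \<beta> b" and b: "nonneg b" and i: "i \<in> J" "i < l" and ne: "b \<noteq> ev i"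
  shows "nonneg (sa i b)"
proof (rule ccontr)
  assume "\<not> nonneg (sa i b)"
  define b' where "b' = sa i b"
  have b'j: "b' j = b j" if "j \<noteq> i" for j using that by (simp add: b'_def refla_def)
  have neg: "b' i < 0" using \<open>\<not> nonneg (sa i b)\<close> b b'j unfolding nonneg_def b'_def
    by (metis not_le)
  have rp': "rootpair J (sX i \<beta>) b'"
    using rootpair_W[OF rp W_gen[OF i]] by (simp add: b'_def)
  \<comment> \<open>\<open>p\<close> is the part of \<open>b\<close> away from \<open>i\<close>,
    which the reflection leaves alone. It is nonzero because \<open>b\<close> would otherwise be
    \<open>ev i\<close>.\<close>
  define p where "p = (\<lambda>j. if j = i then 0 else b j)"
  have "\<exists>j. p j \<noteq> 0"
  proof (rule ccontr)
    assume "\<nexists>j. p j \<noteq> 0"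
    then have z: "\<And>j. j \<noteq> i \<Longrightarrow> b j = 0" by (metis p_def)
    have "b i = 1 \<or> b i = -1" using rootpair_multiple[OF rp i(2) z] .
    then have "b i = 1" using b by (auto simp: nonneg_def dest: spec[of _ i])
    then have "b = ev i" using z by (auto simp: ev_def)
    then show False using ne by simp
  qed
  then obtain j where j: "p j \<noteq> 0" by blast
  have pl: "p m = 0" if "m \<notin> {..<l}" for m using rootpair_support_l[OF rp] that by (auto simp: p_def)
  have Bp: "0 < B p p"
    using B_pos[of j p] j pl l_le_n by (metis lessThan_iff less_le_trans)
  obtain k where k: "b' = rv k" using rootpair_int[OF rp'] by blast
  obtain c where c: "\<And>m. m < l \<Longrightarrow> of_int (c m) * B b' b' = b' m * B (ev m) (ev m)"
    using rootpair_comb[OF rp'] by metis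
  have b'p: "b' = (\<lambda>j. p j + b' i * ev i j)"
    using b'j by (auto simp: p_def ev_def fun_eq_iff)
  have "B p (ev i) = (\<Sum>m<l. p m * B (ev m) (ev i))"
    by (rule B_expand) (use pl in auto)
  also have "\<dots> \<le> 0"
    using b B_ev_le[OF i(2)] by (intro sum_nonpos) (auto simp: p_def nonneg_def mult_nonneg_nonpos)
  finally have Bpe: "B p (ev i) \<le> 0" .
  have "B b' b' = B p p + 2 * b' i * B p (ev i) + (b' i)\<^sup>2 * B (ev i) (ev i)"
    by (subst (1 2) b'p)
       (simp add: B_add B_add' B_scale B_scale' B_sym[of "ev i" p] power2_eq_square algebra_simps)
  moreover have "0 \<le> 2 * b' i * B p (ev i)" using neg Bpe by (simp add: mult_nonpos_nonpos)
  ultimately have big: "(b' i)\<^sup>2 * B (ev i) (ev i) < B b' b'" using Bp by linarith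
  define E where "E = B (ev i) (ev i)"
  have E: "0 < E" using B_ev_pos[OF i(2)] by (simp add: E_def)
  have ci: "of_int (c i) * B b' b' = of_int (k i) * E" using c[OF i(2)] by (simp add: E_def k)
  have ki: "k i < 0" using neg by (simp add: k)
  have BB: "0 < B b' b'" using rootpair_Bpos[OF rp'] .
  have "of_int (c i) * B b' b' < 0" using ci ki E by (simp add: mult_neg_pos)
  then have "c i \<le> -1" using BB
    by (smt (verit) mult_nonneg_nonneg of_int_0_le_iff)
  then have "real_of_int (c i) \<le> -1" by linarith
  then have "of_int (c i) * B b' b' \<le> - B b' b'" using BB
    using mult_right_mono[of "of_int (c i)" "-1" "B b' b'"] by simp
  then have "B b' b' \<le> - of_int (k i) * E" using ci by simp
  also have "\<dots> \<le> (of_int (k i))\<^sup>2 * E"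
  proof -
    have "- k i * 1 \<le> (- k i) * (- k i)" using ki by (intro mult_left_mono) auto
    then have "- k i \<le> (k i)\<^sup>2" by (simp add: power2_eq_square)
    then have "- real_of_int (k i) \<le> (of_int (k i))\<^sup>2"
      by (metis of_int_le_iff of_int_minus of_int_power)
    then show ?thesis using E by (intro mult_right_mono) auto
  qed
  finally show False using big by (simp add: E_def k)
qed

text \<open>Each new letter \<open>k\<close> preserves the sign of a coroot unless that coroot is
  \<open>ev k\<close> or its negative, and these two are exchanged.\<close>

lemma rootpair_sign: assumes "rootpair J \<beta> b" shows "nonneg b \<or> nonneg (\<lambda>j. - b j)"
proof -
  obtain w i where w: "w \<in> W J" "i \<in> J" "i < l" "\<beta> = fst w (al i)" "b = snd w (ev i)"
    using assms unfolding rootpair_def by blast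
  have "nonneg (snd w (ev i)) \<or> nonneg (\<lambda>j. - snd w (ev i) j)"
    using w(1)
  proof (induction rule: Wgrp.induct)
    case (Wstep w k)
    let ?b = "snd w (ev i)"
    have rp: "rootpair J (fst w (al i)) ?b"
      using rootpair_W[OF rootpair_simple[OF w(2,3)] Wstep(1)] .
    have neg: "sa k (\<lambda>j. - ?b j) = (\<lambda>j. - sa k ?b j)"
      using Wa_uminus[OF W_gen[OF Wstep(2,3)], of ?b] by simp
    consider "?b = ev k" | "(\<lambda>j. - ?b j) = ev k" | "?b \<noteq> ev k" "(\<lambda>j. - ?b j) \<noteq> ev k" by blast
    then show ?case
    proof cases
      case 1
      then show ?thesis using Wstep(3) by (simp add: sa_ev)
    next
      case 2
      then have "(\<lambda>j. - sa k ?b j) = (\<lambda>j. - ev k j)" using neg Wstep(3) by (simp add: sa_ev)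
      then show ?thesis by (simp add: fun_eq_iff nonneg_def ev_def)
    next
      case 3
      then show ?thesis using Wstep(4)
          refl_nonneg[OF rp _ Wstep(2,3)] refl_nonneg[OF rootpair_uminus[OF rp] _ Wstep(2,3)] neg
        by auto
    qed
  qed simp
  then show ?thesis using w by simp
qed

lemma rootpair_not_both: "rootpair J \<beta> b \<Longrightarrow> nonneg b \<Longrightarrow> \<not> nonneg (\<lambda>j. - b j)"
proof
  assume a: "rootpair J \<beta> b" "nonneg b" "nonneg (\<lambda>j. - b j)"
  then have "b = (\<lambda>j. 0)" by (auto simp: nonneg_def fun_eq_iff) (meson antisym)
  then show False using rootpair_Bpos[OF a(1)] by (simp add: B_zero)
qed

text \<open>Root coefficients are positive multiples of coroot coordinates, so their signs and
  supports agree.\<close>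

lemma rootpair_nonneg_comb:
  assumes rp: "rootpair J \<beta> b" and nn: "nonneg b"
  obtains c :: "nat \<Rightarrow> nat" where "\<beta> = (\<lambda>j. \<Sum>m<l. int (c m) * al m j)"
    "\<And>m. m < l \<Longrightarrow> c m = 0 \<longleftrightarrow> b m = 0" "\<And>m. m \<notin> J \<Longrightarrow> c m = 0" "\<exists>m<l. m \<in> J \<and> c m > 0"
proof -
  obtain c where c: "\<beta> = (\<lambda>j. \<Sum>m<l. c m * al m j)"
    "\<And>m. m < l \<Longrightarrow> of_int (c m) * B b b = b m * B (ev m) (ev m)"
    using rootpair_comb[OF rp] by metis
  have pos: "0 < B b b" using rootpair_Bpos[OF rp] .
  have c0: "c m \<ge> 0" "c m = 0 \<longleftrightarrow> b m = 0" if "m < l" for m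
  proof -
    have "0 \<le> b m * B (ev m) (ev m)" using nn B_ev_pos[OF that] by (auto simp: nonneg_def)
    then have "0 \<le> of_int (c m) * B b b" using c(2)[OF that] by simp
    then show "c m \<ge> 0" using pos by (simp add: zero_le_mult_iff)
    show "c m = 0 \<longleftrightarrow> b m = 0" using c(2)[OF that] pos B_ev_pos[OF that] by (auto)
  qed
  define d where "d m = (if m < l then nat (c m) else 0)" for m
  have d0: "d m = 0 \<longleftrightarrow> b m = 0" if "m < l" for m using c0[OF that] that by (auto simp: d_def)
  show ?thesis
  proof (rule that[of d])
    show "\<beta> = (\<lambda>j. \<Sum>m<l. int (d m) * al m j)" using c0 c(1) by (simp add: d_def)
    show "d m = 0 \<longleftrightarrow> b m = 0" if "m < l" for m using d0[OF that] .
    show "d m = 0" if "m \<notin> J" for m using rootpair_support[OF rp that] d0 by (auto simp: d_def)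
    show "\<exists>m<l. m \<in> J \<and> d m > 0"
    proof (rule ccontr)
      assume "\<not> ?thesis"
      then have "b m = 0" if "m < l" for m
        using d0[OF that] rootpair_support[OF rp, of m] that by (cases "m \<in> J") auto
      then have "b = (\<lambda>j. 0)" using rootpair_support_l[OF rp] by blast
      then show False using pos by (simp add: B_zero)
    qed
  qed
qed

text \<open>Were the coroot negative, both the root and its negative would be nonnegative
  combinations of simple roots; their sum vanishes, contradicting independence.\<close>

lemma rootpair_posroots: "rootpair J \<beta> b \<Longrightarrow> \<beta> \<in> posroots l al \<longleftrightarrow> nonneg b"
proof
  assume rp: "rootpair J \<beta> b" and "nonneg b"
  then show "\<beta> \<in> posroots l al" using rootpair_nonneg_comb[OF rp] unfolding posroots_def by blast
next
  assume rp: "rootpair J \<beta> b" and "\<beta> \<in> posroots l al"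
  then obtain c where c: "\<beta> = (\<lambda>j. \<Sum>m<l. int (c m) * al m j)" by (auto simp: posroots_def)
  show "nonneg b"
  proof (rule ccontr)
    assume "\<not> nonneg b"
    then have "nonneg (\<lambda>j. - b j)" using rootpair_sign[OF rp] by blast
    then obtain d where d: "(\<lambda>j. - \<beta> j) = (\<lambda>j. \<Sum>m<l. int (d m) * al m j)" "\<exists>m<l. m \<in> J \<and> d m > 0"
      using rootpair_nonneg_comb[OF rootpair_uminus[OF rp]] by metis
    then obtain m where m: "m < l" "d m > 0" by blast
    have "real (c m + d m) = 0"
    proof (rule al_indep[OF _ m(1)])
      fix j
      have "(\<Sum>m<l. int (c m) * al m j) + (\<Sum>m<l. int (d m) * al m j) = 0"
        using c d(1) by (metis add.right_inverse)
      then have "(\<Sum>m<l. int (c m + d m) * al m j) = 0"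
        by (simp add: sum.distrib algebra_simps)
      then have "real_of_int (\<Sum>m<l. int (c m + d m) * al m j) = 0" by simp
      then show "(\<Sum>m<l. real (c m + d m) * of_int (al m j)) = 0" by simp
    qed
    then show False using m by simp
  qed
qed

lemma finite_coroots: "finite {b. \<exists>\<beta>. rootpair J \<beta> b}"
proof -
  have "{b. \<exists>\<beta>. rootpair J \<beta> b} \<subseteq> (\<Union>i<l. (\<lambda>w. snd w (ev i)) ` W J)"
    unfolding rootpair_def by blast
  then show ?thesis by (rule finite_subset) (simp add: finW)
qed

lemma finite_roots: "finite (rootsJ n l al J)"
proof -
  have "rootsJ n l al J \<subseteq> (\<Union>i<l. (\<lambda>w. fst w (al i)) ` W J)"
    unfolding rootsJ_def by blast
  then show ?thesis by (rule finite_subset) (simp add: finW)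
qed

text \<open>The invariant form recovers a root from its coroot, so an identity between coroots
  passes to roots and hence to reflections.\<close>

lemma rootpair_unique: assumes "rootpair J \<beta> b" "rootpair J \<gamma> b" shows "\<beta> = \<gamma>"
proof
  fix j
  show "\<beta> j = \<gamma> j"
  proof (cases "j < n")
    case True
    have "B b b * pr \<beta> (ev j) = B b b * pr \<gamma> (ev j)"
      using rootpair_B assms by metis
    then show ?thesis using rootpair_Bpos[OF assms(1)] True by (simp add: pair_ev)
  next
    case False
    then show ?thesis using rootpair_char[OF assms(1)] rootpair_char[OF assms(2)] by (simp add: charlat_def)
  qed
qed

section \<open>Words, exchange and dominant vectors\<close>

fun word :: "nat list \<Rightarrow> ((nat \<Rightarrow> int) \<Rightarrow> nat \<Rightarrow> int) \<times> ((nat \<Rightarrow> real) \<Rightarrow> nat \<Rightarrow> real)" where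
  "word [] = (id, id)"
| "word (i # is) = (sX i \<circ> fst (word is), sa i \<circ> snd (word is))"

lemma word_W: "set is \<subseteq> J \<inter> I \<Longrightarrow> word is \<in> W J"
  by (induction "is") (auto intro: Wgrp.intros)

lemma W_word: "w \<in> W J \<Longrightarrow> \<exists>is. set is \<subseteq> J \<inter> I \<and> w = word is"
proof (induction rule: Wgrp.induct)
  case Wid
  then show ?case by (intro exI[of _ "[]"]) simp
next
  case (Wstep w i)
  then obtain "is" where "set is \<subseteq> J \<inter> I" "w = word is" by blast
  then show ?case using Wstep by (intro exI[of _ "i # is"]) simp
qed

lemma word_append: "word (xs @ ys) = (fst (word xs) \<circ> fst (word ys), snd (word xs) \<circ> snd (word ys))"
  by (induction xs) (auto simp: comp_assoc)

text \<open>The familiar rule that conjugating a reflection gives the reflection in the image, for a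
  simple coroot sent to a simple coroot.\<close>

lemma W_conj_refl:
  assumes u: "u \<in> W J" and ij: "i \<in> J" "i < l" "j \<in> J" "j < l" and eq: "snd u (ev i) = ev j"
  shows "fst u \<circ> sX i = sX j \<circ> fst u" "snd u \<circ> sa i = sa j \<circ> snd u"
proof -
  have al: "fst u (al i) = al j"
    using rootpair_unique[OF _ rootpair_simple[of j J]] rootpair_W[OF rootpair_simple[of i J] u] ij eq by simp
  show "fst u \<circ> sX i = sX j \<circ> fst u"
  proof
    fix x
    have "real_of_int (fst u x j) = pr (fst u x) (snd u (ev i))"
      using ij l_le_n by (simp add: eq pair_ev)
    then have "fst u x j = x i" using ij l_le_n by (simp add: W_pair[OF u] pair_ev)
    then show "(fst u \<circ> sX i) x = (sX j \<circ> fst u) x"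
      by (simp add: reflX_def[of _ i x] WX_diff[OF u] WX_scale[OF u] al)
         (simp add: reflX_def)
  qed
  show "snd u \<circ> sa i = sa j \<circ> snd u"
  proof
    fix x
    have "pr (al j) (snd u x) = pr (al i) x" by (simp flip: al add: W_pair[OF u])
    then show "(snd u \<circ> sa i) x = (sa j \<circ> snd u) x"
      by (simp add: sa_alt Wa_diff[OF u] Wa_scale[OF u] eq)
  qed
qed

text \<open>When the suffixes of a word first send \<open>e\<^sub>i\<close> to a negative coroot, the image just before is \<open>e\<^sub>k\<close>
  for the next letter \<open>k\<close>, which can then be cancelled against \<open>i\<close>.\<close>
lemma word_exchange:
  assumes "set is \<subseteq> J \<inter> I" "i \<in> J" "i < l" "\<not> nonneg (snd (word is) (ev i))"
  shows "\<exists>js. set js \<subseteq> J \<inter> I \<and> length js < length is \<and> word (is @ [i]) = word js"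
  using assms
proof (induction "is")
  case (Cons k ks)
  show ?case
  proof (cases "nonneg (snd (word ks) (ev i))")
    case False
    then obtain js where "set js \<subseteq> J \<inter> I" "length js < length ks" "word (ks @ [i]) = word js"
      using Cons by auto
    then show ?thesis using Cons(2) by (intro exI[of _ "k # js"]) auto
  next
    case True
    let ?u = "word ks"
    have u: "?u \<in> W J" using Cons(2) word_W by auto
    have k: "k \<in> J" "k < l" using Cons(2) by auto
    have "rootpair J (fst ?u (al i)) (snd ?u (ev i))"
      using rootpair_W[OF rootpair_simple u] Cons by blast
    then have eq: "snd ?u (ev i) = ev k"
      using refl_nonneg[OF _ True k] Cons(5) by auto
    have "word ((k # ks) @ [i]) = (sX k \<circ> (fst ?u \<circ> sX i), sa k \<circ> (snd ?u \<circ> sa i))"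
      by (simp add: word_append comp_assoc)
    also have "\<dots> = (sX k \<circ> sX k \<circ> fst ?u, sa k \<circ> sa k \<circ> snd ?u)"
      using W_conj_refl[OF u Cons(3,4) k eq] by (simp add: comp_assoc)
    also have "\<dots> = word ks"
      using k by (auto simp: prod_eq_iff sX_invol sa_invol intro!: ext)
    finally show ?thesis using Cons(2) by (intro exI[of _ ks]) auto
  qed
qed simp

text \<open>Stands in for a length function: when the last letter of a word is not an ascent, the
  exchange property yields a shorter word for the same element, so induction on word length meets
  ascents only.\<close>

lemma W_ascent_induct [consumes 1, case_names id step]:
  assumes w: "w \<in> W J" and base: "P (id, id)"
    and step: "\<And>w i. w \<in> W J \<Longrightarrow> i \<in> J \<Longrightarrow> i < l \<Longrightarrow> nonneg (snd w (ev i)) \<Longrightarrow> P w \<Longrightarrow>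
       P (fst w \<circ> sX i, snd w \<circ> sa i)"
  shows "P w"
proof -
  have "set is \<subseteq> J \<inter> I \<Longrightarrow> P (word is)" for "is"
  proof (induction "length is" arbitrary: "is" rule: less_induct)
    case less
    show ?case
    proof (cases "is" rule: rev_cases)
      case Nil
      then show ?thesis using base by simp
    next
      case (snoc ks i)
      have ks: "set ks \<subseteq> J \<inter> I" "i \<in> J" "i < l" using less(2) snoc by auto
      show ?thesis
      proof (cases "nonneg (snd (word ks) (ev i))")
        case True
        then have "P (fst (word ks) \<circ> sX i, snd (word ks) \<circ> sa i)"
          using step[of "word ks" i] ks word_W[OF ks(1)] less(1)[of ks] snoc by simp
        then show ?thesis using snoc by (simp add: word_append)
      next
        case False
        then obtain js where "set js \<subseteq> J \<inter> I" "length js < length ks" "word is = word js"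
          using word_exchange[OF ks] snoc by auto
        then show ?thesis using less(1)[of js] snoc by simp
      qed
    qed
  qed
  then show ?thesis using W_word[OF w] by blast
qed

text \<open>On an ascent, \<open>fst w (al i)\<close> is a nonnegative combination of simple roots
  of J. It pairs nonnegatively with the dominant image \<open>snd w (sa i x)\<close>, and this
  pairing equals minus that of \<open>al i\<close> with \<open>x\<close>. Hence \<open>sa i\<close>
  fixes \<open>x\<close> and can be peeled off.\<close>

lemma dominant_stabilizer:
  assumes w: "w \<in> W J" and x: "\<And>i. i \<in> J \<Longrightarrow> i < l \<Longrightarrow> 0 \<le> pr (al i) x"
    and wx: "\<And>i. i \<in> J \<Longrightarrow> i < l \<Longrightarrow> 0 \<le> pr (al i) (snd w x)"
  shows "snd w x = x \<and> w \<in> W {i \<in> J. i < l \<and> pr (al i) x = 0}"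
  using w wx
proof (induction rule: W_ascent_induct)
  case id
  then show ?case using W_id by simp
next
  case (step w i)
  let ?K = "{i \<in> J. i < l \<and> pr (al i) x = 0}"
  have rp: "rootpair J (fst w (al i)) (snd w (ev i))"
    using rootpair_W[OF rootpair_simple] step(1-3) by blast
  obtain c :: "nat \<Rightarrow> nat" where c: "fst w (al i) = (\<lambda>j. \<Sum>m<l. int (c m) * al m j)" "\<And>m. m \<notin> J \<Longrightarrow> c m = 0"
    using rootpair_nonneg_comb[OF rp step(4)] by metis
  have "0 \<le> pr (fst w (al i)) (snd w (sa i x))"
    unfolding c pair_sum_left
  proof (intro sum_nonneg)
    fix m assume "m \<in> {..<l}"
    then show "0 \<le> real_of_int (int (c m)) * pr (al m) (snd w (sa i x))"
      using step(6)[of m] c(2)[of m] by (cases "m \<in> J") auto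
  qed
  then have "0 \<le> - pr (al i) x" using step(1-3) by (simp add: W_pair sa_pr al2)
  then have z: "pr (al i) x = 0" using x[OF step(2,3)] by simp
  then have sx: "sa i x = x" by (simp add: sa_alt)
  then have "snd w x = x \<and> w \<in> W ?K" using step(5,6) by simp
  moreover have "(sX i, sa i) \<in> W ?K" using W_gen[of i ?K] step(2,3) z by blast
  ultimately show ?case using W_comp[of w ?K "(sX i, sa i)"] sx by simp
qed

lemma strictly_dominant_free:
  assumes w: "w \<in> W J" and x: "\<And>i. i \<in> J \<Longrightarrow> i < l \<Longrightarrow> 0 < pr (al i) x"
    and wx: "\<And>i. i \<in> J \<Longrightarrow> i < l \<Longrightarrow> 0 < pr (al i) (snd w x)"
  shows "w = (id, id)"
proof -
  have "w \<in> W {i \<in> J. i < l \<and> pr (al i) x = 0}"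
    using dominant_stabilizer[OF w] x wx by (meson less_imp_le)
  moreover have "{i \<in> J. i < l \<and> pr (al i) x = 0} = {}" using x by force
  ultimately have "w \<in> W {}" by simp
  then show ?thesis by (cases rule: Wgrp.cases) auto
qed

text \<open>Telescoping along ascents: each one adds \<open>a i\<close>, which is nonnegative, times
  the positive root \<open>fst w (al i)\<close>.\<close>

lemma dominant_weight_diff:
  assumes w: "w \<in> W I" and a: "\<And>i. i < l \<Longrightarrow> 0 \<le> a i"
  shows "\<exists>c::nat \<Rightarrow> nat. (\<lambda>j. a j - fst w a j) = (\<lambda>j. \<Sum>m<l. int (c m) * al m j)"
  using w
proof (induction rule: W_ascent_induct)
  case id
  then show ?case by (intro exI[of _ "\<lambda>_. 0"]) simp
next
  case (step w i)
  have rp: "rootpair I (fst w (al i)) (snd w (ev i))"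
    using rootpair_W[OF rootpair_simple] step(1-3) by blast
  obtain d :: "nat \<Rightarrow> nat" where d: "fst w (al i) = (\<lambda>j. \<Sum>m<l. int (d m) * al m j)"
    using rootpair_nonneg_comb[OF rp step(4)] by metis
  obtain c :: "nat \<Rightarrow> nat" where c: "\<And>j. a j - fst w a j = (\<Sum>m<l. int (c m) * al m j)"
    using step(5) by (meson fun_cong)
  have "a j - fst w (sX i a) j = (\<Sum>m<l. int (c m + nat (a i) * d m) * al m j)" for j
  proof -
    have "fst w (sX i a) j = fst w a j - a i * fst w (al i) j"
      using step(1) by (simp add: reflX_def WX_diff WX_scale)
    then have "a j - fst w (sX i a) j = (\<Sum>m<l. int (c m) * al m j) + a i * (\<Sum>m<l. int (d m) * al m j)"
      using c[of j] by (simp add: d)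
    also have "\<dots> = (\<Sum>m<l. int (c m + nat (a i) * d m) * al m j)"
      using a[OF step(3)] by (simp add: sum_distrib_left sum.distrib algebra_simps)
    finally show ?thesis .
  qed
  then show ?case by (intro exI[of _ "\<lambda>m. c m + nat (a i) * d m"]) auto
qed

text \<open>Take the group element that maximizes the sum of the J-coordinates; a reflection
  \<open>sa i\<close> lowers this sum by exactly the pairing with \<open>al i\<close>.\<close>

lemma dominant_exists:
  assumes J: "J \<subseteq> I"
  shows "\<exists>w\<in>W J. \<forall>i\<in>J. 0 \<le> pr (al i) (snd w x)"
proof -
  have fJ: "finite J" using J finite_subset by blast
  define f where "f w = (\<Sum>j\<in>J. snd w x j)" for w :: "((nat \<Rightarrow> int) \<Rightarrow> nat \<Rightarrow> int) \<times> ((nat \<Rightarrow> real) \<Rightarrow> nat \<Rightarrow> real)"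
  obtain w where w: "w \<in> W J" "\<And>u. u \<in> W J \<Longrightarrow> f u \<le> f w"
    using Max_in[of "f ` W J"] Max_ge[of "f ` W J"] finW[of J] W_nonempty[of J] by fastforce
  have "0 \<le> pr (al i) (snd w x)" if i: "i \<in> J" for i
  proof -
    have "(sX i \<circ> fst w, sa i \<circ> snd w) \<in> W J" using Wgrp.Wstep[OF w(1) i] J i by auto
    then have "f (sX i \<circ> fst w, sa i \<circ> snd w) \<le> f w" by (rule w(2))
    moreover have "f (sX i \<circ> fst w, sa i \<circ> snd w) = f w - pr (al i) (snd w x)"
      using i fJ by (simp add: f_def refla_def sum_subtractf)
    ultimately show ?thesis by simp
  qed
  then show ?thesis using w by blast
qed

text \<open>The simple coroots are pairwise obtuse, so the positive and negative parts of \<open>x\<close> have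
  nonpositive inner product.\<close>
lemma dominant_nonneg:
  assumes J: "J \<subseteq> I" and x: "\<And>j. j \<notin> J \<Longrightarrow> x j = 0" and dom: "\<And>i. i \<in> J \<Longrightarrow> 0 \<le> pr (al i) x"
  shows "nonneg x"
proof (rule ccontr)
  assume "\<not> nonneg x"
  then obtain j where j: "x j < 0" by (auto simp: nonneg_def not_le)
  define p q where "p = (\<lambda>j. max 0 (x j))" and "q = (\<lambda>j. max 0 (- x j))"
  have fJ: "finite J" using J finite_subset by blast
  have xpq: "x = (\<lambda>j. p j - q j)" by (auto simp: p_def q_def)
  have p: "p m = 0" "q m = 0" if "m \<notin> J" for m using x[OF that] by (auto simp: p_def q_def)
  have Bq: "B q z = (\<Sum>i\<in>J. q i * B (ev i) z)" and Bp: "B p z = (\<Sum>i\<in>J. p i * B (ev i) z)" for z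
    by (rule B_expand; use p fJ in auto)+
  have "0 \<le> B (ev i) x" if "i \<in> J" for i
  proof -
    have "2 * B x (ev i) = B (ev i) (ev i) * pr (al i) x" using B_ev that J by auto
    then show ?thesis using dom[OF that] B_ev_pos[of i] that J B_sym[of x "ev i"]
      by (smt (verit) lessThan_iff mult_nonneg_nonneg subsetD)
  qed
  then have "0 \<le> B q x" unfolding Bq by (intro sum_nonneg mult_nonneg_nonneg) (auto simp: q_def)
  moreover have "B q p \<le> 0"
  proof -
    have "B q p = (\<Sum>i\<in>J. \<Sum>k\<in>J. q i * (p k * B (ev k) (ev i)))"
      unfolding Bq B_sym[of "ev _" p] Bp by (simp add: sum_distrib_left)
    also have "\<dots> \<le> 0"
    proof (intro sum_nonpos)
      fix i k assume ik: "i \<in> J" "k \<in> J"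
      show "q i * (p k * B (ev k) (ev i)) \<le> 0"
      proof (cases "i = k")
        case True
        then show ?thesis by (auto simp: p_def q_def max_def)
      next
        case False
        then have "B (ev k) (ev i) \<le> 0" using B_ev_le ik J by auto
        then show ?thesis by (auto simp: p_def q_def intro!: mult_nonneg_nonpos)
      qed
    qed
    finally show ?thesis .
  qed
  moreover have "B q x = B q p - B q q" by (subst xpq) (rule B_diff')
  moreover have "0 < B q q"
  proof (rule B_pos[of j])
    have "j \<in> J" using x j by force
    then show "j < n" using J l_le_n by auto
    show "q j \<noteq> 0" using j by (simp add: q_def)
  qed
  ultimately show False by simp
qed

end

section \<open>Alcoves\<close>

context weyl
begin

lemma W_pair_left: "u \<in> W J \<Longrightarrow> fst u \<circ> fst v = id \<Longrightarrow> pr \<beta> (snd u x) = pr (fst v \<beta>) x"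
  using W_pair[of u J "fst v \<beta>" x] by (simp add: pointfree_idE)

lemma rootpair_pr_sum: "\<beta> = (\<lambda>j. \<Sum>m<l. int (c m) * al m j) \<Longrightarrow> pr \<beta> x = (\<Sum>m<l. real (c m) * pr (al m) x)"
  by (simp add: pair_sum_left)

lemma rootpair_pos_pr:
  assumes "rootpair J \<beta> b" "nonneg b" and x: "\<And>i. i \<in> J \<Longrightarrow> i < l \<Longrightarrow> 0 < pr (al i) x"
  shows "0 < pr \<beta> x"
proof -
  obtain c :: "nat \<Rightarrow> nat" where c: "\<beta> = (\<lambda>j. \<Sum>m<l. int (c m) * al m j)"
    "\<And>m. m < l \<Longrightarrow> c m = 0 \<longleftrightarrow> b m = 0"
    "\<And>m. m \<notin> J \<Longrightarrow> c m = 0" "\<exists>m<l. m \<in> J \<and> c m > 0"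
    by (rule rootpair_nonneg_comb[OF assms(1,2)]) (rule that; assumption)
  obtain m where m: "m < l" "m \<in> J" "c m > 0" using c(4) by blast
  show ?thesis unfolding rootpair_pr_sum[OF c(1)]
  proof (rule sum_pos2[of _ m])
    show "0 \<le> real (c i) * pr (al i) x" if "i \<in> {..<l}" for i
      using x[of i] c(3)[of i] that by (cases "i \<in> J") auto
  qed (use m x[of m] in auto)
qed

lemma alcove_iff: "x \<in> alcove n l al J \<longleftrightarrow> (\<forall>\<beta> b. rootpair J \<beta> b \<longrightarrow> nonneg b \<longrightarrow> 0 < pr \<beta> x \<and> pr \<beta> x < 1)"
  unfolding alcove_def using rootpair_posroots rootpair_root root_rootpair by blast

lemma alcove_abs: assumes "x \<in> alcove n l al J" "rootpair J \<beta> b" shows "\<bar>pr \<beta> x\<bar> < 1"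
  using rootpair_sign[OF assms(2)] assms rootpair_uminus[OF assms(2)]
  unfolding alcove_iff by (fastforce simp: pair_uminus_left)

lemma alcove_not_Ints: assumes x: "x \<in> alcove n l al J" and rp: "rootpair J \<beta> b" shows "pr \<beta> x \<notin> \<int>"
proof
  assume "pr \<beta> x \<in> \<int>"
  then have "pr \<beta> x = 0" using alcove_abs[OF x rp] Ints_nonzero_abs_less1 by blast
  moreover have "pr \<beta> x \<noteq> 0" using rootpair_sign[OF rp] x rp rootpair_uminus[OF rp]
    unfolding alcove_iff by (fastforce simp: pair_uminus_left)
  ultimately show False by simp
qed

section \<open>Simple transitivity of the affine Weyl group on alcoves\<close>

lemma B_minus_coroot:
  assumes "rootpair J \<beta> b"
  shows "B (\<lambda>j. y j - b j) (\<lambda>j. y j - b j) = B y y + B b b * (1 - pr \<beta> y)"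
proof -
  have "B (\<lambda>j. y j - b j) (\<lambda>j. y j - b j) = B y y - 2 * B y b + B b b"
    by (simp add: B_diff B_diff' B_sym[of b y])
  then show ?thesis using rootpair_B[OF assms, of y] by (simp add: algebra_simps)
qed

lemma rootpair_lat: "rootpair J \<beta> b \<Longrightarrow> \<exists>k\<in>corootlatJ J. b = rv k"
proof -
  assume rp: "rootpair J \<beta> b"
  obtain k where k: "b = rv k" using rootpair_int[OF rp] by blast
  then have "k \<in> corootlatJ J" using rootpair_support[OF rp] by (simp add: corootlatJ_def)
  then show ?thesis using k by blast
qed

text \<open>A shortest vector \<open>z + k\<close> cannot be shortened by subtracting a coroot.\<close>
lemma lattice_near:
  assumes J: "J \<subseteq> I"
  shows "\<exists>k\<in>corootlatJ J. \<forall>\<beta> b. rootpair J \<beta> b \<longrightarrow> pr \<beta> (\<lambda>j. z j + of_int (k j)) \<le> 1"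
proof -
  define f where "f k = B (\<lambda>j. z j + of_int (k j)) (\<lambda>j. z j + of_int (k j))" for k :: "nat \<Rightarrow> int"
  define S where "S = {k \<in> corootlatJ J. f k \<le> B z z}"
  have "finite S"
  proof -
    \<comment> \<open>\<open>R\<close> bounds every coordinate of a candidate:
      \<open>z x + k x\<close> is at most \<open>B z z + 1\<close> in absolute value because the
      form dominates squared coordinates, and the sum of ceilings absorbs
      \<open>z x\<close>.\<close>
    define R where "R = \<lceil>B z z + 1\<rceil> + (\<Sum>j<n. \<lceil>\<bar>z j\<bar>\<rceil>)"
    have "S \<subseteq> {k. \<forall>x. (x \<in> J \<longrightarrow> k x \<in> {-R..R}) \<and> (x \<notin> J \<longrightarrow> k x = 0)}"
    proof clarify
      fix k x assume k: "k \<in> S"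
      show "(x \<in> J \<longrightarrow> k x \<in> {-R..R}) \<and> (x \<notin> J \<longrightarrow> k x = 0)"
      proof (intro conjI impI)
        assume "x \<notin> J" then show "k x = 0" using k by (simp add: S_def corootlatJ_def)
      next
        assume "x \<in> J"
        then have x: "x < n" using J l_le_n by auto
        have "(z x + of_int (k x))\<^sup>2 \<le> B z z"
          using B_ge_coord[OF x, of "\<lambda>j. z j + of_int (k j)"] k by (simp add: S_def f_def)
        also have "\<dots> \<le> (B z z + 1)\<^sup>2" using B_nonneg[of z] by (simp add: power2_eq_square algebra_simps)
        finally have "\<bar>z x + of_int (k x)\<bar> \<le> B z z + 1"
          using B_nonneg[of z] by (simp add: abs_le_square_iff[symmetric])
        then have 1: "\<bar>of_int (k x)\<bar> \<le> B z z + 1 + \<bar>z x\<bar>" by linarith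
        have "\<lceil>\<bar>z x\<bar>\<rceil> \<le> (\<Sum>j<n. \<lceil>\<bar>z j\<bar>\<rceil>)"
        proof (rule member_le_sum)
          show "0 \<le> \<lceil>\<bar>z i\<bar>\<rceil>" for i by (rule order_trans[OF _ ceiling_mono[OF abs_ge_zero]]) simp
        qed (use x in auto)
        then have "\<bar>z x\<bar> \<le> of_int (\<Sum>j<n. \<lceil>\<bar>z j\<bar>\<rceil>)" by linarith
        moreover have "B z z + 1 \<le> of_int \<lceil>B z z + 1\<rceil>" by linarith
        ultimately have "\<bar>of_int (k x)\<bar> \<le> real_of_int R" using 1 unfolding R_def by linarith
        then show "k x \<in> {-R..R}" by auto
      qed
    qed
    moreover have "finite J" using J finite_subset by blast
    ultimately show ?thesis using finite_set_of_finite_funs[of J "{-R..R}" 0] finite_subset by blast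
  qed
  moreover have "(\<lambda>_. 0) \<in> S" by (simp add: S_def f_def corootlatJ_def)
  ultimately obtain k where k: "k \<in> S" "\<And>k'. k' \<in> S \<Longrightarrow> f k \<le> f k'"
    using Min_in[of "f ` S"] Min_le[of "f ` S"] by fastforce
  have "pr \<beta> (\<lambda>j. z j + of_int (k j)) \<le> 1" if rp: "rootpair J \<beta> b" for \<beta> b
  proof -
    obtain m where m: "m \<in> corootlatJ J" "b = rv m" using rootpair_lat[OF rp] by blast
    define k' where "k' j = k j - m j" for j
    have "k' \<in> corootlatJ J" using k(1) m(1) by (simp add: S_def corootlatJ_def k'_def)
    then have "f k \<le> f k'" using k by (cases "k' \<in> S") (force simp: S_def)+
    moreover have "f k' = f k + B b b * (1 - pr \<beta> (\<lambda>j. z j + of_int (k j)))"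
      using B_minus_coroot[OF rp, of "\<lambda>j. z j + of_int (k j)"] by (simp add: f_def k'_def m algebra_simps)
    ultimately have "0 \<le> B b b * (1 - pr \<beta> (\<lambda>j. z j + of_int (k j)))" by linarith
    then show ?thesis using rootpair_Bpos[OF rp] by (simp add: zero_le_mult_iff)
  qed
  then show ?thesis using k(1) by (auto simp: S_def)
qed

text \<open>After a translation all roots of J take values at most 1, and strictly less since
  integers are excluded. A further element of \<open>W J\<close> makes the vector dominant without
  changing this set of bounds, and non-integrality makes it strictly dominant.\<close>

lemma alcove_reach:
  assumes J: "J \<subseteq> I" and z: "\<And>\<beta> b. rootpair J \<beta> b \<Longrightarrow> pr \<beta> z \<notin> \<int>"
  shows "\<exists>u\<in>W J. \<exists>k\<in>corootlatJ J. (\<lambda>j. snd u z j + of_int (k j)) \<in> alcove n l al J"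
proof -
  obtain k where k: "k \<in> corootlatJ J" "\<And>\<beta> b. rootpair J \<beta> b \<Longrightarrow> pr \<beta> (\<lambda>j. z j + of_int (k j)) \<le> 1"
    using lattice_near[OF J, of z] by blast
  define y where "y = (\<lambda>j. z j + of_int (k j))"
  have yI: "pr \<beta> y \<notin> \<int>" if "rootpair J \<beta> b" for \<beta> b
  proof
    assume "pr \<beta> y \<in> \<int>"
    moreover have "pr \<beta> y = pr \<beta> z + pr \<beta> (rv k)" by (simp add: y_def pair_add)
    ultimately have "pr \<beta> z \<in> \<int>" using pair_Ints[of n \<beta> k]
      by (metis Ints_diff add_diff_cancel_right')
    then show False using z[OF that] by simp
  qed
  have y1: "pr \<beta> y < 1" if "rootpair J \<beta> b" for \<beta> b
    using k(2)[OF that] yI[OF that] Ints_1 unfolding y_def by (metis less_eq_real_def)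
  obtain u where u: "u \<in> W J" "\<And>i. i \<in> J \<Longrightarrow> 0 \<le> pr (al i) (snd u y)"
    using dominant_exists[OF J, of y] by blast
  obtain v where v: "v \<in> W J" "fst u \<circ> fst v = id" using W_inv[OF u(1)] by metis
  have uy: "pr \<beta> (snd u y) \<notin> \<int>" "pr \<beta> (snd u y) < 1" if "rootpair J \<beta> b" for \<beta> b
    unfolding W_pair_left[OF u(1) v(2)] using yI y1 rootpair_W[OF that v(1)] by blast+
  have "snd u y \<in> alcove n l al J"
    unfolding alcove_iff
  proof (intro allI impI conjI)
    fix \<beta> b assume rp: "rootpair J \<beta> b" "nonneg b"
    show "0 < pr \<beta> (snd u y)"
    proof (rule rootpair_pos_pr[OF rp])
      fix i assume i: "i \<in> J" "i < l"
      show "0 < pr (al i) (snd u y)"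
        using u(2)[OF i(1)] uy(1)[OF rootpair_simple[OF i]] Ints_0 by (metis less_eq_real_def)
    qed
    show "pr \<beta> (snd u y) < 1" using uy(2)[OF rp(1)] .
  qed
  moreover obtain k' where "snd u (rv k) = rv k'" "\<forall>j. j \<notin> J \<longrightarrow> k' j = 0"
    using Wa_int_support[OF u(1), of k] k(1) by (auto simp: corootlatJ_def)
  ultimately show ?thesis using u(1) unfolding y_def Wa_add[OF u(1)]
    by (intro bexI[of _ u] bexI[of _ k']) (auto simp: corootlatJ_def)
qed

text \<open>The map shifts each root value by an integer, which one test point determines: 0 if the
  pulled-back root is positive, 1 if it is negative. The same integer then serves every alcove
  point. The shift \<open>m\<close> is only required to be integral on roots of J, so that real
  vectors such as a lift minus its average are allowed.\<close>

lemma alcove_translate: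
  assumes w: "w \<in> W J" and m: "\<And>\<beta> b. rootpair J \<beta> b \<Longrightarrow> pr \<beta> m \<in> \<int>"
    and x: "x \<in> alcove n l al J" "(\<lambda>j. snd w x j + m j) \<in> alcove n l al J" and y: "y \<in> alcove n l al J"
  shows "(\<lambda>j. snd w y j + m j) \<in> alcove n l al J"
  unfolding alcove_iff
proof (intro allI impI)
  fix \<beta> b assume rp: "rootpair J \<beta> b" "nonneg b"
  obtain v where v: "v \<in> W J" "fst w \<circ> fst v = id" using W_inv[OF w] by metis
  have rp': "rootpair J (fst v \<beta>) (snd v b)" using rootpair_W[OF rp(1) v(1)] .
  obtain N where N: "pr \<beta> m = of_int N" using m[OF rp(1)] Ints_cases by metis
  have e: "pr \<beta> (\<lambda>j. snd w t j + m j) = pr (fst v \<beta>) t + of_int N" for t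
    by (simp add: pair_add W_pair_left[OF w v(2)] N)
  have xx: "0 < pr (fst v \<beta>) x + of_int N" "pr (fst v \<beta>) x + of_int N < 1"
    using x(2) rp unfolding alcove_iff e[symmetric] by blast+
  show "0 < pr \<beta> (\<lambda>j. snd w y j + m j) \<and> pr \<beta> (\<lambda>j. snd w y j + m j) < 1"
  proof (cases "nonneg (snd v b)")
    case True
    then have "0 < pr (fst v \<beta>) x" "pr (fst v \<beta>) x < 1" "0 < pr (fst v \<beta>) y" "pr (fst v \<beta>) y < 1"
      using rp' x y unfolding alcove_iff by blast+
    moreover have "N = 0" using calculation xx by linarith
    ultimately show ?thesis by (simp add: e)
  next
    case False
    then have "nonneg (\<lambda>j. - snd v b j)" using rootpair_sign[OF rp'] by blast
    then have "0 < - pr (fst v \<beta>) x" "- pr (fst v \<beta>) x < 1" "0 < - pr (fst v \<beta>) y" "- pr (fst v \<beta>) y < 1"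
      using rootpair_uminus[OF rp'] x y unfolding alcove_iff pair_uminus_left[symmetric] by blast+
    moreover have "N = 1" using calculation xx by linarith
    ultimately show ?thesis by (simp add: e)
  qed
qed

lemma alcove_image:
  assumes w: "w \<in> W J" and m: "\<And>\<beta> b. rootpair J \<beta> b \<Longrightarrow> pr \<beta> m \<in> \<int>"
    and x: "x \<in> alcove n l al J" "(\<lambda>j. snd w x j + m j) \<in> alcove n l al J"
  shows "(\<lambda>x. (\<lambda>j. snd w x j + m j)) ` alcove n l al J = alcove n l al J"
proof
  show "(\<lambda>x. (\<lambda>j. snd w x j + m j)) ` alcove n l al J \<subseteq> alcove n l al J"
    using alcove_translate[of w J m x] w m x by blast
  obtain v where v: "v \<in> W J" "snd w \<circ> snd v = id" "snd v \<circ> snd w = id" "fst v \<circ> fst w = id" using W_inv[OF w] by metis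
  have vw: "snd v (snd w t) = t" "snd w (snd v t) = t" for t using v by (simp_all add: pointfree_idE)
  show "alcove n l al J \<subseteq> (\<lambda>x. (\<lambda>j. snd w x j + m j)) ` alcove n l al J"
  proof
    fix y assume y: "y \<in> alcove n l al J"
    have mv: "pr \<beta> (\<lambda>j. - snd v m j) \<in> \<int>" if "rootpair J \<beta> b" for \<beta> b
      using m[OF rootpair_W[OF that w]] pair_scale[of n \<beta> "-1" "snd v m"]
      by (simp add: W_pair_left[OF v(1,4)])
    have "(\<lambda>j. snd v (\<lambda>j. snd w x j + m j) j + - snd v m j) = x"
      by (simp add: Wa_add[OF v(1)] vw)
    then have "(\<lambda>j. snd v y j + - snd v m j) \<in> alcove n l al J"
      using alcove_translate[OF v(1) mv x(2) _ y] x(1) by simp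
    moreover have "y = (\<lambda>j. snd w (\<lambda>j. snd v y j + - snd v m j) j + m j)"
      using Wa_diff[OF w, of "snd v y" "snd v m"] by (simp add: vw)
    ultimately show "y \<in> (\<lambda>x. (\<lambda>j. snd w x j + m j)) ` alcove n l al J" by blast
  qed
qed

text \<open>Pick a simple coroot \<open>e\<^sub>i\<close> with positive coefficient in \<open>k\<close> and \<open>\<langle>\<alpha>\<^sub>i, k\<rangle> > 0\<close>. If the pairing
  is \<open>1\<close> then \<open>k - e\<^sub>i = s\<^sub>i k\<close>, and reflecting both arguments keeps the value; otherwise passing to
  \<open>k - e\<^sub>i\<close> decreases it.\<close>
lemma lattice_voronoi_dominant:
  assumes J: "J \<subseteq> I"
  shows "k \<in> corootlatJ J \<Longrightarrow> (\<And>j. 0 \<le> k j) \<Longrightarrow> (\<And>\<beta> b. rootpair J \<beta> b \<Longrightarrow> \<bar>pr \<beta> y\<bar> < 1) \<Longrightarrow>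
    k \<noteq> (\<lambda>_. 0) \<Longrightarrow> 0 < B (rv k) (rv k) - 2 * B y (rv k)"
proof (induction "nat (\<Sum>j\<in>J. k j)" arbitrary: k y rule: less_induct)
  case less
  have fJ: "finite J" using J finite_subset by blast
  have k0: "k j = 0" if "j \<notin> J" for j using less(2) that by (auto simp: corootlatJ_def)
  obtain j0 where j0: "k j0 \<noteq> 0" using less(5) by blast
  then have "j0 < n" using k0 J l_le_n by (metis lessThan_iff less_le_trans subsetD)
  then have Bk: "0 < B (rv k) (rv k)" using B_pos[of j0 "rv k"] j0 by simp
  have "B (rv k) (rv k) = (\<Sum>i\<in>J. of_int (k i) * B (ev i) (rv k))"
    using B_expand[of J "rv k" "rv k"] k0 fJ by simp
  then have "\<exists>i\<in>J. 0 < of_int (k i) * B (ev i) (rv k)"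
    using Bk sum_nonpos[of J "\<lambda>i. of_int (k i) * B (ev i) (rv k)"] by force
  then obtain i where i: "i \<in> J" "0 < of_int (k i) * B (ev i) (rv k)" by blast
  have il: "i < l" using i J by auto
  have ki: "0 < k i" "0 < B (ev i) (rv k)"
    using i(2) less(3)[of i] by (auto simp: zero_less_mult_iff)
  have "2 * B (rv k) (ev i) = B (ev i) (ev i) * pr (al i) (rv k)" using B_ev[OF il] .
  then have pk: "0 < pr (al i) (rv k)" using ki(2) B_ev_pos[OF il]
    by (metis B_sym mult_pos_pos zero_less_mult_pos zero_less_numeral)
  obtain N where N: "pr (al i) (rv k) = of_int N" using pair_Ints Ints_cases by metis
  have N1: "1 \<le> N" using pk N by simp
  define k' where "k' j = (if j = i then k j - 1 else k j)" for j
  have k': "k' \<in> corootlatJ J" "\<And>j. 0 \<le> k' j"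
    using less(2,3) i(1) ki(1) by (auto simp: k'_def corootlatJ_def)
  have rk': "rv k' = (\<lambda>j. rv k j - ev i j)" by (auto simp: k'_def ev_def)
  have "(\<Sum>j\<in>J. k' j) = (\<Sum>j\<in>J. k j) - 1"
    using sum.remove[OF fJ i(1), of k'] sum.remove[OF fJ i(1), of k] by (simp add: k'_def)
  moreover have "0 < (\<Sum>j\<in>J. k j)"
    using sum_pos2[of J i k] fJ i(1) ki(1) less(3) by blast
  ultimately have sz: "nat (\<Sum>j\<in>J. k' j) < nat (\<Sum>j\<in>J. k j)" by simp
  show ?case
  proof (cases "N = 1")
    case True
    have s: "rv k' = sa i (rv k)" using N True by (simp add: rk' sa_alt)
    have W: "(sX i, sa i) \<in> W J" using W_gen i(1) il by blast
    have y': "\<bar>pr \<beta> (sa i y)\<bar> < 1" if "rootpair J \<beta> b" for \<beta> b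
      using less(4)[OF rootpair_W[OF that W]] s_pair[OF il, of "sX i \<beta>" y] by (simp add: sX_invol[OF il])
    have "k' \<noteq> (\<lambda>_. 0)"
    proof
      assume "k' = (\<lambda>_. 0)"
      then have "sa i (rv k) = (\<lambda>_. 0)" using s by simp
      then have "sa i (sa i (rv k)) = (\<lambda>_. 0)" using Wa_zero[OF W] by simp
      then have "rv k = (\<lambda>_. 0)" by (simp add: sa_invol[OF il])
      then show False using j0 by (simp add: fun_eq_iff)
    qed
    then have "0 < B (rv k') (rv k') - 2 * B (sa i y) (rv k')"
      using less(1)[of k' "sa i y"] sz k' y' by blast
    then show ?thesis using B_W[OF W] by (simp add: s)
  next
    case False
    then have N2: "2 \<le> N" using N1 by simp
    \<comment> \<open>Only a weak inequality, since \<open>k'\<close> may be zero; strictness comes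
      from the added term, positive because \<open>N\<close> is at least 2 and the root value at
      \<open>y\<close> is below 1.\<close>
    have ge: "0 \<le> B (rv k') (rv k') - 2 * B y (rv k')"
    proof (cases "k' = (\<lambda>_. 0)")
      case True
      then have "rv k' = (\<lambda>_. 0)" by simp
      then show ?thesis by (simp add: B_zero B_zero')
    next
      case False
      then show ?thesis using less(1)[of k' y] sz k' less(4) by fastforce
    qed
    have "B (rv k') (rv k') = B (rv k) (rv k) + B (ev i) (ev i) * (1 - N)"
      using B_minus_coroot[OF rootpair_simple[OF i(1) il], of "rv k"] by (simp add: rk' N)
    moreover have "2 * B y (rv k') = 2 * B y (rv k) - B (ev i) (ev i) * pr (al i) y"
      using B_ev[OF il, of y] by (simp add: rk' B_diff')
    ultimately have "B (rv k) (rv k) - 2 * B y (rv k) =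
      (B (rv k') (rv k') - 2 * B y (rv k')) + B (ev i) (ev i) * (N - 1 - pr (al i) y)"
      by (simp add: algebra_simps)
    moreover have "0 < B (ev i) (ev i) * (N - 1 - pr (al i) y)"
      using B_ev_pos[OF il] less(4)[OF rootpair_simple[OF i(1) il]] N2 by (intro mult_pos_pos) auto
    ultimately show ?thesis using ge by linarith
  qed
qed

text \<open>The quantity is the squared distance from \<open>y\<close> to \<open>k\<close> minus the
  squared length of \<open>y\<close>. Rotating \<open>k\<close> to a dominant vector makes its
  coordinates nonnegative and keeps the bound on \<open>y\<close>, since roots are permuted.\<close>

lemma lattice_voronoi:
  assumes J: "J \<subseteq> I" and k: "k \<in> corootlatJ J" "k \<noteq> (\<lambda>_. 0)"
    and y: "\<And>\<beta> b. rootpair J \<beta> b \<Longrightarrow> \<bar>pr \<beta> y\<bar> < 1"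
  shows "0 < B (rv k) (rv k) - 2 * B y (rv k)"
proof -
  obtain u where u: "u \<in> W J" "\<And>i. i \<in> J \<Longrightarrow> 0 \<le> pr (al i) (snd u (rv k))"
    using dominant_exists[OF J, of "rv k"] by blast
  obtain v where v: "v \<in> W J" "snd v \<circ> snd u = id" "fst u \<circ> fst v = id" using W_inv[OF u(1)] by metis
  obtain k' where k': "snd u (rv k) = rv k'" "\<forall>j. j \<notin> J \<longrightarrow> k' j = 0"
    using Wa_int_support[OF u(1), of k] k(1) by (auto simp: corootlatJ_def)
  have "nonneg (rv k')" using dominant_nonneg[OF J, of "rv k'"] k' u(2) by simp
  moreover have "k' \<noteq> (\<lambda>_. 0)"
  proof
    assume "k' = (\<lambda>_. 0)"
    then have "snd v (snd u (rv k)) = (\<lambda>_. 0)" using Wa_zero[OF v(1)] by (simp add: k'(1))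
    then have "rv k = (\<lambda>_. 0)" using v(2) by (simp add: pointfree_idE)
    then show False using k(2) by (auto simp: fun_eq_iff)
  qed
  moreover have "\<bar>pr \<beta> (snd u y)\<bar> < 1" if "rootpair J \<beta> b" for \<beta> b
    using y[OF rootpair_W[OF that v(1)]] W_pair_left[OF u(1) v(3)] by simp
  ultimately have "0 < B (rv k') (rv k') - 2 * B (snd u y) (rv k')"
    using k'(2) by (intro lattice_voronoi_dominant[OF J]) (auto simp: nonneg_def corootlatJ_def)
  then show ?thesis by (simp add: k'(1)[symmetric] B_W[OF u(1)])
qed

text \<open>If \<open>k\<close> were nonzero, comparing distances from the image point would make it
  shorter than \<open>x\<close>, and the inverse map would make \<open>x\<close> shorter than the
  image. So \<open>k\<close> vanishes, and \<open>w\<close> relates two strictly dominant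
  vectors.\<close>

lemma alcove_free:
  assumes J: "J \<subseteq> I" and w: "w \<in> W J" and k: "k \<in> corootlatJ J"
    and x: "x \<in> alcove n l al J" "(\<lambda>j. snd w x j + of_int (k j)) \<in> alcove n l al J"
  shows "w = (id, id)"
proof -
  define y where "y = (\<lambda>j. snd w x j + of_int (k j))"
  obtain v where v: "v \<in> W J" "snd v \<circ> snd w = id" "fst v \<circ> fst w = id" using W_inv[OF w] by metis
  have vw: "snd v (snd w t) = t" for t using v by (simp_all add: pointfree_idE)
  have k0: "k = (\<lambda>_. 0)"
  proof (rule ccontr)
    assume k0: "k \<noteq> (\<lambda>_. 0)"
    have "0 < B (rv k) (rv k) - 2 * B y (rv k)"
      using lattice_voronoi[OF J k k0] alcove_abs x(2) unfolding y_def by blast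
    moreover have "B (\<lambda>j. y j - of_int (k j)) (\<lambda>j. y j - of_int (k j)) = B x x"
      by (simp add: y_def B_W[OF w])
    ultimately have 1: "B y y < B x x" by (simp add: B_diff B_diff' B_sym[of "rv k" y])
    obtain k' where k': "snd v (rv k) = rv k'" "\<forall>j. j \<notin> J \<longrightarrow> k' j = 0"
      using Wa_int_support[OF v(1), of k] k by (auto simp: corootlatJ_def)
    have m: "(\<lambda>j. - k' j) \<in> corootlatJ J" using k' by (simp add: corootlatJ_def)
    have "(\<lambda>j. - k' j) \<noteq> (\<lambda>_. 0)"
    proof
      assume "(\<lambda>j. - k' j) = (\<lambda>_. 0)"
      then have "k' = (\<lambda>_. 0)" by (simp add: fun_eq_iff)
      then have "snd w (snd v (rv k)) = (\<lambda>_. 0)" using Wa_zero[OF w] by (simp add: k'(1))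
      moreover have "snd w (snd v (rv k)) = rv k"
        using W_bij(2)[OF w] vw by (metis bij_inv_eq_iff)
      ultimately show False using k0 by (auto simp: fun_eq_iff)
    qed
    then have "0 < B (rv (\<lambda>j. - k' j)) (rv (\<lambda>j. - k' j)) - 2 * B x (rv (\<lambda>j. - k' j))"
      using lattice_voronoi[OF J m] alcove_abs x(1) by blast
    then have "0 < B (rv k') (rv k') + 2 * B x (rv k')" by (simp add: B_uminus B_uminus')
    moreover have "B y y = B (snd v y) (snd v y)" by (simp add: B_W[OF v(1)])
    moreover have "snd v y = (\<lambda>j. x j + of_int (k' j))"
      by (simp add: y_def Wa_add[OF v(1)] vw k'(1))
    ultimately have "B x x < B y y" by (simp add: B_add B_add' B_sym[of "rv k'" x])
    then show False using 1 by simp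
  qed
  show ?thesis
  proof (rule strictly_dominant_free[OF w])
    fix i assume i: "i \<in> J" "i < l"
    show "0 < pr (al i) x" "0 < pr (al i) (snd w x)"
      using x rootpair_simple[OF i] nonneg_ev unfolding k0 alcove_iff by auto
  qed
qed

section \<open>Averaging over the Weyl group of M, and the map psi\<close>

lemma pM_lin: "pM n l al J (\<lambda>j. c * x j + d * y j) = (\<lambda>j. c * pM n l al J x j + d * pM n l al J y j)"
proof
  fix j
  have "(\<Sum>w\<in>W J. snd w (\<lambda>j. c * x j + d * y j) j) = c * (\<Sum>w\<in>W J. snd w x j) + d * (\<Sum>w\<in>W J. snd w y j)"
    by (simp add: Wa_lin sum.distrib sum_distrib_left)
  then show "pM n l al J (\<lambda>j. c * x j + d * y j) j = c * pM n l al J x j + d * pM n l al J y j"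
    by (simp add: pM_def add_divide_distrib)
qed

lemma pM_add: "pM n l al J (\<lambda>j. x j + y j) = (\<lambda>j. pM n l al J x j + pM n l al J y j)"
  using pM_lin[of J 1 x 1 y] by simp

lemma pM_diff: "pM n l al J (\<lambda>j. x j - y j) = (\<lambda>j. pM n l al J x j - pM n l al J y j)"
  using pM_lin[of J 1 x "-1" y] by simp

lemma pM_scale: "pM n l al J (\<lambda>j. c * x j) = (\<lambda>j. c * pM n l al J x j)"
  using pM_lin[of J c x 0 x] by simp

lemma pM_sum: "pM n l al J (\<lambda>j. \<Sum>i\<in>S. v i j) = (\<lambda>j. \<Sum>i\<in>S. pM n l al J (v i) j)"
proof (induction S rule: infinite_finite_induct)
  case (insert x F)
  then show ?case by (simp add: pM_add)
qed (use pM_scale[of J 0 "\<lambda>_. 0"] in auto)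

lemma pM_W: "u \<in> W J \<Longrightarrow> pM n l al J (snd u x) = pM n l al J x"
  unfolding pM_def using W_sum_right[of u J "\<lambda>f g. g x _"] by (auto simp: fun_eq_iff)

lemma W_pM: assumes u: "u \<in> W J" shows "snd u (pM n l al J x) = pM n l al J x"
proof -
  have "pM n l al J x = (\<lambda>j. (1 / real (card (W J))) * (\<Sum>w\<in>W J. snd w x j))"
    by (simp add: pM_def)
  then have "snd u (pM n l al J x) = (\<lambda>j. (1 / real (card (W J))) * snd u (\<lambda>j. \<Sum>w\<in>W J. snd w x j) j)"
    by (simp only: Wa_scale[OF u])
  also have "snd u (\<lambda>j. \<Sum>w\<in>W J. snd w x j) = (\<lambda>j. \<Sum>w\<in>W J. snd w x j)"
    using W_sum_left[OF u, of "\<lambda>f g. g x _"] by (auto simp: Wa_sum[OF u] fun_eq_iff)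
  finally show ?thesis by (simp add: pM_def)
qed

lemma pM_support: "j \<notin> J \<Longrightarrow> pM n l al J x j = x j"
  using finW[of J] W_nonempty[of J] by (simp add: pM_def Wa_support)

lemma pM_pr: assumes "i \<in> J" "i < l" shows "pr (al i) (pM n l al J x) = 0"
proof -
  have "sa i (pM n l al J x) i = pM n l al J x i"
    using W_pM[OF W_gen[OF assms]] by simp
  then show ?thesis by (simp add: refla_def)
qed

text \<open>Averaging is invariant under \<open>sa i\<close>, which negates \<open>ev i\<close>;
  hence the span of the simple coroots of J is killed.\<close>

lemma pM_J_zero:
  assumes J: "J \<subseteq> I" and x: "\<And>j. j \<notin> J \<Longrightarrow> x j = 0"
  shows "pM n l al J x = (\<lambda>j. 0)"
proof -
  have fJ: "finite J" using J finite_subset by blast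
  have z: "pM n l al J (ev i) = (\<lambda>j. 0)" if i: "i \<in> J" for i
  proof -
    have il: "i < l" using i J by auto
    have "pM n l al J (sa i (ev i)) = pM n l al J (ev i)"
      using pM_W[OF W_gen[OF i il]] by simp
    then have "(\<lambda>j. - pM n l al J (ev i) j) = pM n l al J (ev i)"
      using pM_scale[of J "-1" "ev i"] by (simp add: sa_ev[OF il])
    then show ?thesis by (auto simp: fun_eq_iff)
  qed
  have "pM n l al J (\<lambda>j. \<Sum>i\<in>J. x i * ev i j) = (\<lambda>j. 0)"
    unfolding pM_sum pM_scale using z by simp
  then show ?thesis using ev_sum[of J x] x fJ by simp
qed

lemma pM_rootpair: assumes "rootpair J \<beta> b" shows "pr \<beta> (pM n l al J x) = 0"
proof -
  obtain w i where w: "w \<in> W J" "i \<in> J" "i < l" "\<beta> = fst w (al i)"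
    using assms unfolding rootpair_def by blast
  have "pr \<beta> (snd w (pM n l al J x)) = pr (al i) (pM n l al J x)" by (simp add: w W_pair[OF w(1)])
  then show ?thesis using W_pM[OF w(1), of x] pM_pr[OF w(2,3)] by simp
qed

text \<open>A single point kept inside the alcove certifies the value of psi. For uniqueness,
  averaging does not alter coordinates outside J, so two lifts with the same average differ by the
  coroot lattice; \<open>w'\<close> times the inverse of \<open>w\<close>, with a translation in
  that lattice, then keeps a point in the alcove and is trivial by
  \<open>alcove_free\<close>.\<close>

lemma psiM_eq:
  assumes J: "J \<subseteq> I" and lam: "lam \<in> charlat n" and w: "w \<in> W J"
    and x: "x \<in> alcove n l al J" "(\<lambda>j. snd w x j + of_int (lam j)) \<in> alcove n l al J"
  shows "psiM n l al J (pM n l al J (rv lam)) = w"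
  unfolding psiM_def
proof (rule the_equality)
  have "(\<lambda>x. (\<lambda>j. snd w x j + of_int (lam j))) ` alcove n l al J = alcove n l al J"
    by (rule alcove_image[OF w _ x]) (rule pair_Ints)
  moreover have "(\<lambda>_. 0) \<in> corootlatJ J" by (simp add: corootlatJ_def)
  ultimately show "w \<in> W J \<and> (\<exists>lam'\<in>charlat n. pM n l al J (rv lam') = pM n l al J (rv lam) \<and>
     (\<exists>k\<in>corootlatJ J. (\<lambda>x j. snd w x j + real_of_int (lam' j + k j)) ` alcove n l al J = alcove n l al J))"
    using w lam by (intro conjI bexI[of _ lam] bexI[of _ "\<lambda>_. 0"]) auto
next
  fix w'
  assume "w' \<in> W J \<and> (\<exists>lam'\<in>charlat n. pM n l al J (rv lam') = pM n l al J (rv lam) \<and>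
     (\<exists>k\<in>corootlatJ J. (\<lambda>x j. snd w' x j + real_of_int (lam' j + k j)) ` alcove n l al J = alcove n l al J))"
  then obtain lam' k where w': "w' \<in> W J" and lam': "pM n l al J (rv lam') = pM n l al J (rv lam)"
    and k: "k \<in> corootlatJ J"
    and im: "(\<lambda>x j. snd w' x j + real_of_int (lam' j + k j)) ` alcove n l al J = alcove n l al J"
    by blast
  define y where "y = (\<lambda>j. snd w x j + of_int (lam j))"
  obtain v where v: "v \<in> W J" "snd v \<circ> snd w = id" "fst v \<circ> fst w = id" "snd w \<circ> snd v = id" "fst w \<circ> fst v = id"
    using W_inv[OF w] by metis
  define u where "u = (fst w' \<circ> fst v, snd w' \<circ> snd v)"
  have u: "u \<in> W J" using W_comp[OF w' v(1)] by (simp add: u_def)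
  obtain m where m: "snd u (rv lam) = rv m" using Wa_int[OF u] by blast
  define k' where "k' j = lam' j + k j - m j" for j
  have "k' j = 0" if j: "j \<notin> J" for j
  proof -
    have "of_int (m j) = real_of_int (lam j)" using Wa_support[OF u j, of "rv lam"] m by simp
    moreover have "of_int (lam' j) = real_of_int (lam j)"
      using pM_support[OF j] fun_cong[OF lam', of j] by simp
    ultimately show ?thesis using k j by (simp add: k'_def corootlatJ_def)
  qed
  then have k': "k' \<in> corootlatJ J" by (simp add: corootlatJ_def)
  have "snd w' x = snd u (snd w x)" using v(2) by (simp add: u_def pointfree_idE)
  moreover have "snd u (snd w x) = (\<lambda>j. snd u y j - of_int (m j))"
    by (simp add: y_def Wa_add[OF u] m)
  ultimately have "(\<lambda>j. snd w' x j + real_of_int (lam' j + k j)) = (\<lambda>j. snd u y j + of_int (k' j))"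
    by (simp add: k'_def fun_eq_iff)
  then have "(\<lambda>j. snd u y j + of_int (k' j)) \<in> alcove n l al J"
    using im imageI[OF x(1), of "\<lambda>x j. snd w' x j + real_of_int (lam' j + k j)"] by simp
  then have "u = (id, id)" using alcove_free[OF J u k'] x(2) by (simp add: y_def)
  then have e: "fst w' \<circ> fst v = id" "snd w' \<circ> snd v = id" by (simp_all add: u_def)
  have "fst w' = fst w' \<circ> (fst v \<circ> fst w)" "snd w' = snd w' \<circ> (snd v \<circ> snd w)" using v by simp_all
  then show "w' = w" using e by (simp add: prod_eq_iff comp_assoc[symmetric])
qed

section \<open>The sum of the positive coroots and an explicit alcove point\<close>

definition poscoroots :: "(nat \<Rightarrow> real) set" where
  "poscoroots = {b. \<exists>\<beta>. rootpair I \<beta> b \<and> nonneg b}"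

definition rho2 :: "nat \<Rightarrow> real" where "rho2 = (\<lambda>j. \<Sum>b\<in>poscoroots. b j)"

lemma finite_poscoroots: "finite poscoroots"
  unfolding poscoroots_def by (rule finite_subset[OF _ finite_coroots[of I]]) blast

text \<open>The reflection \<open>sa i\<close> permutes the positive coroots other than
  \<open>ev i\<close> and negates \<open>ev i\<close>, so it moves \<open>rho2\<close> by
  \<open>-2\<close> times \<open>ev i\<close>.\<close>

lemma rho2_pr: assumes i: "i < l" shows "pr (al i) rho2 = 2"
proof -
  have iI: "i \<in> I" using i by simp
  have W: "(sX i, sa i) \<in> W I" using W_gen[OF iI i] .
  have ei: "ev i \<in> poscoroots" using rootpair_simple[OF iI i] by (auto simp: poscoroots_def)
  let ?S = "poscoroots - {ev i}"
  have maps: "sa i b \<in> ?S" if "b \<in> ?S" for b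
  proof -
    obtain \<beta> where rp: "rootpair I \<beta> b" and nn: "nonneg b" and ne: "b \<noteq> ev i"
      using \<open>b \<in> ?S\<close> by (auto simp: poscoroots_def)
    have "nonneg (sa i b)" using refl_nonneg[OF rp nn iI i ne] .
    moreover have "sa i b \<noteq> ev i"
    proof
      assume "sa i b = ev i"
      then have "b = (\<lambda>j. - ev i j)" using sa_invol[OF i, of b] sa_ev[OF i] by simp
      then have "nonneg (\<lambda>j. - b j)" by simp
      then show False using rootpair_not_both[OF rp nn] by simp
    qed
    ultimately show ?thesis using rootpair_W[OF rp W] by (auto simp: poscoroots_def)
  qed
  have bij: "bij_betw (sa i) ?S ?S"
    by (rule bij_betw_byWitness[where f' = "sa i"]) (use maps sa_invol[OF i] in auto)
  have r: "rho2 = (\<lambda>j. ev i j + (\<Sum>b\<in>?S. b j))"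
    unfolding rho2_def using sum.remove[OF finite_poscoroots ei] by blast
  have "sa i rho2 = (\<lambda>j. - ev i j + (\<Sum>b\<in>?S. sa i b j))"
    unfolding r using Wa_add[OF W, of "ev i" "\<lambda>j. \<Sum>b\<in>?S. b j"] Wa_sum[OF W, of "\<lambda>b. b" ?S] sa_ev[OF i] by simp
  also have "\<dots> = (\<lambda>j. - ev i j + (\<Sum>b\<in>?S. b j))"
    using sum.reindex_bij_betw[OF bij, of "\<lambda>b. b _"] by auto
  finally have "sa i rho2 i = rho2 i - 2" unfolding r by (simp add: ev_def)
  then show ?thesis by (simp add: refla_def)
qed

lemma rho2_int: "\<exists>k. rho2 = rv k \<and> (\<forall>j. \<not> j < l \<longrightarrow> k j = 0)"
proof -
  have "\<forall>b\<in>poscoroots. \<exists>k. b = rv k" unfolding poscoroots_def using rootpair_int by blast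
  then obtain f where f: "\<And>b. b \<in> poscoroots \<Longrightarrow> b = rv (f b)" by metis
  have "rho2 = rv (\<lambda>j. \<Sum>b\<in>poscoroots. f b j)"
    unfolding rho2_def of_int_sum using fun_cong[OF f] by (intro ext sum.cong refl)
  then obtain k where k: "rho2 = rv k" by (rule that[of "\<lambda>j. \<Sum>b\<in>poscoroots. f b j"])
  have 0: "rho2 j = 0" if "\<not> j < l" for j
    unfolding rho2_def poscoroots_def by (intro sum.neutral) (use rootpair_support_l that in blast)
  have "k j = 0" if "\<not> j < l" for j using 0[OF that] by (simp add: k)
  then show ?thesis using k by blast
qed

lemma alcove_nonempty: assumes J: "J \<subseteq> I" shows "alcove n l al J \<noteq> {}"
proof -
  \<comment> \<open>Scaling by \<open>1 / M\<close> pushes all root values below 1; the extra 1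
    makes the bound strict and \<open>M\<close> positive.\<close>
  define M where "M = (\<Sum>\<beta>\<in>rootsJ n l al J. \<bar>pr \<beta> rho2\<bar>) + 1"
  have M: "0 < M" unfolding M_def by (intro add_nonneg_pos sum_nonneg) auto
  have "(\<lambda>j. (1 / M) * rho2 j) \<in> alcove n l al J"
    unfolding alcove_iff pair_scale
  proof (intro allI impI)
    fix \<beta> b assume rp: "rootpair J \<beta> b" "nonneg b"
    have "0 < pr \<beta> rho2" using rootpair_pos_pr[OF rp] rho2_pr by simp
    moreover have "pr \<beta> rho2 < M"
      using member_le_sum[OF rootpair_root[OF rp(1)], of "\<lambda>\<beta>. \<bar>pr \<beta> rho2\<bar>"] finite_roots[of J]
      by (simp add: M_def)
    ultimately show "0 < 1 / M * pr \<beta> rho2 \<and> 1 / M * pr \<beta> rho2 < 1" using M by simp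
  qed
  then show ?thesis by blast
qed

text \<open>Translate an alcove point by the lift and bring it back by the affine Weyl group; the
  composite has linear part \<open>u\<close> and a translation with the same average, because
  averaging ignores both \<open>u\<close> and the coroot lattice.\<close>

lemma psiM_exists:
  assumes J: "J \<subseteq> I" and lam: "lam \<in> charlat n"
  obtains w mu x where "w \<in> W J" "mu \<in> charlat n" "pM n l al J (rv mu) = pM n l al J (rv lam)"
    "x \<in> alcove n l al J" "(\<lambda>j. snd w x j + of_int (mu j)) \<in> alcove n l al J"
proof -
  obtain x where x: "x \<in> alcove n l al J" using alcove_nonempty[OF J] by blast
  define z where "z = (\<lambda>j. x j + of_int (lam j))"
  have zI: "pr \<beta> z \<notin> \<int>" if rp: "rootpair J \<beta> b" for \<beta> b
  proof
    assume "pr \<beta> z \<in> \<int>"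
    moreover have "pr \<beta> z = pr \<beta> x + pr \<beta> (rv lam)" by (simp add: z_def pair_add)
    ultimately have "pr \<beta> x \<in> \<int>" using pair_Ints[of n \<beta> lam]
      by (metis Ints_diff add_diff_cancel_right')
    then show False using alcove_not_Ints[OF x rp] by simp
  qed
  obtain u k where u: "u \<in> W J" "k \<in> corootlatJ J" "(\<lambda>j. snd u z j + of_int (k j)) \<in> alcove n l al J"
    using alcove_reach[of J z] J zI by blast
  obtain m where m: "snd u (rv lam) = rv m" using Wa_int[OF u(1)] by blast
  define mu where "mu j = m j + k j" for j
  show ?thesis
  proof (rule that[OF u(1) _ _ x])
    show "mu \<in> charlat n"
      unfolding charlat_def
    proof (intro CollectI allI impI)
      fix j assume j: "n \<le> j"
      then have "j \<notin> J" using J l_le_n by force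
      then have "real_of_int (m j) = real_of_int (lam j)" "k j = 0"
        using Wa_support[OF u(1), of j "rv lam"] m u(2) by (auto simp: corootlatJ_def)
      then show "mu j = 0" using lam j by (simp add: mu_def charlat_def)
    qed
    have "pM n l al J (rv mu) = (\<lambda>j. pM n l al J (rv m) j + pM n l al J (rv k) j)"
      by (simp add: mu_def pM_add)
    also have "\<dots> = pM n l al J (rv lam)"
      using pM_W[OF u(1), of "rv lam"] pM_J_zero[OF J, of "rv k"] u(2) by (simp add: m corootlatJ_def)
    finally show "pM n l al J (rv mu) = pM n l al J (rv lam)" .
    have "(\<lambda>j. snd u z j + of_int (k j)) = (\<lambda>j. snd u x j + of_int (mu j))"
      by (simp add: z_def Wa_add[OF u(1)] m mu_def add.assoc)
    then show "(\<lambda>j. snd u x j + of_int (mu j)) \<in> alcove n l al J" using u(3) by simp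
  qed
qed

text \<open>The equation for \<open>z\<close> is transported to the alcove point \<open>y\<close>.
  There the conjugate \<open>g'\<close> together with the integral translation \<open>mu\<close>
  sends \<open>y\<close> to \<open>y + nu\<close>, where \<open>mu\<close> is again a lift of
  \<open>nu\<close>.\<close>

lemma psiM_conj:
  assumes J: "J \<subseteq> I" and lam: "lam \<in> charlat n" and nu: "nu = pM n l al J (rv lam)" and g: "g \<in> W J"
    and z: "\<And>\<beta> b. rootpair J \<beta> b \<Longrightarrow> pr \<beta> z \<notin> \<int>"
    and fix': "z = (\<lambda>j. snd g z j + of_int (lam j) - nu j)"
  obtains u where "u \<in> W J" "fst (psiM n l al J nu) \<circ> fst u = fst u \<circ> fst g"
    "snd (psiM n l al J nu) \<circ> snd u = snd u \<circ> snd g"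
proof -
  obtain u k where u: "u \<in> W J" "k \<in> corootlatJ J" "(\<lambda>j. snd u z j + of_int (k j)) \<in> alcove n l al J"
    using alcove_reach[of J z] J z by blast
  obtain v where v: "v \<in> W J" "snd v \<circ> snd u = id" "fst v \<circ> fst u = id"
    using W_inv[OF u(1)] by metis
  define g' where "g' = (fst u \<circ> fst g \<circ> fst v, snd u \<circ> snd g \<circ> snd v)"
  have g': "g' \<in> W J" using W_comp[OF W_comp[OF u(1) g] v(1)] by (simp add: g'_def)
  have gu: "fst g' \<circ> fst u = fst u \<circ> fst g" "snd g' \<circ> snd u = snd u \<circ> snd g"
    using v by (simp_all add: g'_def comp_assoc)
  define y where "y = (\<lambda>j. snd u z j + of_int (k j))"
  obtain m where m: "snd u (rv lam) = rv m" using Wa_int[OF u(1)] by blast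
  obtain k' where k': "snd g' (rv k) = rv k'" "\<forall>j. j \<notin> J \<longrightarrow> k' j = 0"
    using Wa_int_support[OF g', of k] u(2) by (auto simp: corootlatJ_def)
  define mu where "mu j = m j + k j - k' j" for j
  have mu: "mu \<in> charlat n"
    unfolding charlat_def
  proof (intro CollectI allI impI)
    fix j assume j: "n \<le> j"
    then have "j \<notin> J" using J l_le_n by force
    then have "real_of_int (m j) = real_of_int (lam j)" "k j = 0" "k' j = 0"
      using Wa_support[OF u(1), of j "rv lam"] m u(2) k' by (auto simp: corootlatJ_def)
    then show "mu j = 0" using lam j by (simp add: mu_def charlat_def)
  qed
  have "pM n l al J (rv mu) = (\<lambda>j. pM n l al J (rv m) j + pM n l al J (rv k) j - pM n l al J (rv k') j)"
    by (simp add: mu_def pM_add pM_diff)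
  also have "\<dots> = nu"
    using pM_W[OF u(1), of "rv lam"] pM_J_zero[OF J, of "rv k"] pM_J_zero[OF J, of "rv k'"] u(2) k'
    by (simp add: m corootlatJ_def nu)
  finally have pmu: "pM n l al J (rv mu) = nu" .
  have "snd u z = snd u (\<lambda>j. snd g z j + of_int (lam j) - nu j)" using fix' by simp
  also have "\<dots> = (\<lambda>j. snd u (snd g z) j + of_int (m j) - nu j)"
    using W_pM[OF u(1), of "rv lam"] by (simp add: Wa_diff[OF u(1)] Wa_add[OF u(1)] m nu)
  also have "snd u (snd g z) = snd g' (snd u z)" using gu(2) by (metis comp_apply)
  also have "snd g' (snd u z) = (\<lambda>j. snd g' y j - of_int (k' j))"
    by (simp add: y_def Wa_add[OF g'] k'(1))
  finally have e: "snd u z = (\<lambda>j. snd g' y j - of_int (k' j) + of_int (m j) - nu j)" .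
  have "(\<lambda>j. snd g' y j + of_int (mu j)) = (\<lambda>j. y j + nu j)"
  proof
    fix j
    have "y j = snd u z j + of_int (k j)" by (simp only: y_def)
    moreover have "snd u z j = snd g' y j - of_int (k' j) + of_int (m j) - nu j" using e by (rule fun_cong)
    moreover have "real_of_int (mu j) = of_int (m j) + of_int (k j) - of_int (k' j)" by (simp add: mu_def)
    ultimately show "snd g' y j + of_int (mu j) = y j + nu j" by linarith
  qed
  \<comment> \<open>Roots of J vanish on \<open>nu\<close>, so the alcove is stable under
    translation by it.\<close>
  moreover have "(\<lambda>j. y j + nu j) \<in> alcove n l al J"
    using u(3) unfolding alcove_iff pair_add y_def[symmetric] nu by (simp add: pM_rootpair)
  ultimately have "psiM n l al J nu = g'"
    using psiM_eq[OF J mu g', of y] u(3) pmu by (simp add: y_def)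
  then show ?thesis using that[OF u(1)] gu by simp
qed

lemma W_finite_order: assumes w: "w \<in> W J" shows "\<exists>N>0. (snd w ^^ N) = id"
proof -
  have mem: "(fst w ^^ r, snd w ^^ r) \<in> W J" for r
  proof (induction r)
    case (Suc r)
    then show ?case using W_comp[OF w Suc] by (simp only: funpow.simps fst_conv snd_conv)
  qed (simp only: funpow.simps W_id)
  have "\<not> inj (\<lambda>r. (fst w ^^ r, snd w ^^ r))"
    using finite_imageD[of "\<lambda>r. (fst w ^^ r, snd w ^^ r)" UNIV]
      finite_subset[OF image_subsetI[of UNIV "\<lambda>r. (fst w ^^ r, snd w ^^ r)" "W J", OF mem] finW] infinite_UNIV_nat
    by blast
  then obtain a b where ab: "a \<noteq> b" "snd w ^^ a = snd w ^^ b" unfolding inj_def by auto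
  have *: "\<exists>N>0. (snd w ^^ N) = id" if "a < b" "snd w ^^ a = snd w ^^ b" for a b
  proof -
    have "snd w ^^ b = (snd w ^^ a) \<circ> (snd w ^^ (b - a))" using that by (metis funpow_add le_add_diff_inverse less_imp_le)
    moreover have "inj (snd w ^^ a)" using W_bij(2)[OF w] by (simp add: bij_is_inj inj_fn)
    ultimately have "snd w ^^ (b - a) = id" using that(2) by (metis comp_id fun.inj_map inj_eq)
    then show ?thesis using that(1) by (intro exI[of _ "b - a"]) simp
  qed
  show ?thesis using *[of a b] *[of b a] ab by (metis nat_neq_iff)
qed

text \<open>A power of the affine map is a translation by some \<open>c\<close>. Since root values
  on the alcove are bounded, \<open>c\<close> pairs to zero with the simple roots of J; being
  supported on J, it vanishes. The barycentre of the finite orbit is then fixed, and the alcove is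
  convex.\<close>

lemma alcove_fixed_point:
  assumes J: "J \<subseteq> I" and w: "w \<in> W J" and m: "\<And>\<beta> b. rootpair J \<beta> b \<Longrightarrow> pr \<beta> m \<in> \<int>"
    and mJ: "\<And>j. j \<notin> J \<Longrightarrow> m j = 0"
    and x: "x \<in> alcove n l al J" "(\<lambda>j. snd w x j + m j) \<in> alcove n l al J"
  shows "\<exists>z\<in>alcove n l al J. (\<lambda>j. snd w z j + m j) = z"
proof -
  define T where "T y = (\<lambda>j. snd w y j + m j)" for y
  have TA: "T y \<in> alcove n l al J" if "y \<in> alcove n l al J" for y
    unfolding T_def using alcove_translate[OF w m x that] .
  have TrA: "(T ^^ r) x \<in> alcove n l al J" for r
    by (induction r) (auto simp: x TA)
  obtain N where N: "N > 0" "snd w ^^ N = id" using W_finite_order[OF w] by blast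
  have Tr: "(T ^^ r) y = (\<lambda>j. (snd w ^^ r) y j + (T ^^ r) (\<lambda>_. 0) j)" for r y
  proof (induction r)
    case (Suc r)
    have "(T ^^ Suc r) y = T (\<lambda>j. (snd w ^^ r) y j + (T ^^ r) (\<lambda>_. 0) j)" using Suc by simp
    also have "\<dots> = (\<lambda>j. snd w ((snd w ^^ r) y) j + T ((T ^^ r) (\<lambda>_. 0)) j)"
      by (simp add: T_def Wa_add[OF w] add.assoc)
    finally show ?case by simp
  qed simp
  define c where "c = (T ^^ N) (\<lambda>_. 0)"
  have TN: "(T ^^ N) y = (\<lambda>j. y j + c j)" for y using Tr[of N y] N(2) by (simp add: c_def)
  have TNr: "(T ^^ (r * N)) y = (\<lambda>j. y j + real r * c j)" for r y
  proof (induction r)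
    case (Suc r)
    have "(T ^^ (Suc r * N)) y = (T ^^ N) ((T ^^ (r * N)) y)" by (simp add: funpow_add)
    then show ?case using Suc by (simp add: TN algebra_simps)
  qed simp
  have "(T ^^ r) (\<lambda>_. 0) j = 0" if "j \<notin> J" for r j
    using that by (induction r) (auto simp: T_def Wa_support[OF w] mJ)
  then have cJ: "c j = 0" if "j \<notin> J" for j using that by (simp add: c_def)
  have c0: "pr (al i) c = 0" if i: "i \<in> J" for i
  proof (rule ccontr)
    assume ne: "pr (al i) c \<noteq> 0"
    have il: "i < l" using i J by auto
    \<comment> \<open>Two root values in the open interval from -1 to 1 differ by less than 2, which
      \<open>r\<close> translations would exceed.\<close>
    obtain r :: nat where r: "2 / \<bar>pr (al i) c\<bar> < real r" using reals_Archimedean2 by blast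
    have "\<bar>pr (al i) (\<lambda>j. x j + real r * c j)\<bar> < 1" "\<bar>pr (al i) x\<bar> < 1"
      using alcove_abs[OF TrA[of "r * N"] rootpair_simple[OF i il]] alcove_abs[OF x(1) rootpair_simple[OF i il]]
      by (simp_all add: TNr)
    then have "\<bar>real r * pr (al i) c\<bar> < 2" by (simp add: pair_add pair_scale)
    moreover have "2 < real r * \<bar>pr (al i) c\<bar>" using r ne by (simp add: field_simps)
    ultimately show False by (simp add: abs_mult)
  qed
  have "c = (\<lambda>_. 0)"
  proof
    fix j
    have fJ: "finite J" using J finite_subset by blast
    have "B c c = (\<Sum>i\<in>J. c i * B (ev i) c)" using B_expand[of J c c] cJ fJ by simp
    also have "\<dots> = 0"
    proof (intro sum.neutral ballI)
      fix i assume i: "i \<in> J"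
      have "2 * B c (ev i) = B (ev i) (ev i) * pr (al i) c" using B_ev i J by auto
      then show "c i * B (ev i) c = 0" using c0[OF i] by (simp add: B_sym)
    qed
    finally have "B c c = 0" .
    then show "c j = 0" using B_pos[of j c] cJ[of j] J l_le_n
      by (metis lessThan_iff less_irrefl less_le_trans subsetD)
  qed
  then have TNx: "(T ^^ N) x = x" by (simp add: TN)
  define z where "z = (\<lambda>j. (1 / real N) * (\<Sum>r<N. (T ^^ r) x j))"
  have "snd w z = (\<lambda>j. (1 / real N) * (\<Sum>r<N. snd w ((T ^^ r) x) j))"
    unfolding z_def Wa_scale[OF w] Wa_sum[OF w] ..
  also have "\<dots> = (\<lambda>j. (1 / real N) * (\<Sum>r<N. (T ^^ Suc r) x j - m j))"
    by (simp add: T_def)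
  also have "\<dots> = (\<lambda>j. (1 / real N) * (\<Sum>r<N. (T ^^ Suc r) x j) - m j)"
    using N(1) by (simp add: sum_subtractf field_simps)
  also have "(\<lambda>j. \<Sum>r<N. (T ^^ Suc r) x j) = (\<lambda>j. \<Sum>r<N. (T ^^ r) x j)"
  proof
    fix j
    have "(\<Sum>r<Suc N. (T ^^ r) x j) = x j + (\<Sum>r<N. (T ^^ Suc r) x j)"
      by (subst sum.lessThan_Suc_shift) simp
    then show "(\<Sum>r<N. (T ^^ Suc r) x j) = (\<Sum>r<N. (T ^^ r) x j)" using TNx by simp
  qed
  then have "(\<lambda>j. (1 / real N) * (\<Sum>r<N. (T ^^ Suc r) x j) - m j) = (\<lambda>j. z j - m j)"
    unfolding z_def by (metis (no_types))
  finally have fixz: "(\<lambda>j. snd w z j + m j) = z" by simp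
  have "z \<in> alcove n l al J"
    unfolding alcove_iff
  proof (intro allI impI)
    fix \<beta> b assume rp: "rootpair J \<beta> b" "nonneg b"
    have e: "pr \<beta> z = (1 / real N) * (\<Sum>r<N. pr \<beta> ((T ^^ r) x))"
      unfolding z_def by (simp only: pair_scale pair_sum)
    have bd: "0 < pr \<beta> ((T ^^ r) x)" "pr \<beta> ((T ^^ r) x) < 1" for r
      using TrA[of r] rp unfolding alcove_iff by blast+
    have "0 < (\<Sum>r<N. pr \<beta> ((T ^^ r) x))" by (intro sum_pos) (use bd N in auto)
    moreover have "(\<Sum>r<N. pr \<beta> ((T ^^ r) x)) < (\<Sum>r<N. 1)" by (intro sum_strict_mono) (use bd N in auto)
    ultimately show "0 < pr \<beta> z \<and> pr \<beta> z < 1" unfolding e using N(1) by simp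
  qed
  then show ?thesis using fixz by blast
qed

text \<open>Descent on the coordinate sum. As the root pairs to 2 with its coroot, some
  \<open>j\<close> in J has both coordinates positive, and the reflection at \<open>j\<close> lowers
  the sum until a simple coroot is reached.\<close>

lemma root_in_levi:
  assumes J: "J \<subseteq> I"
  shows "rootpair I \<beta> b \<Longrightarrow> nonneg b \<Longrightarrow> (\<And>j. j \<notin> J \<Longrightarrow> b j = 0) \<Longrightarrow> rootpair J \<beta> b"
proof (induction "nat (\<lfloor>\<Sum>j\<in>J. b j\<rfloor>)" arbitrary: \<beta> b rule: less_induct)
  case less
  have fJ: "finite J" using J finite_subset by blast
  obtain k where k: "b = rv k" using rootpair_int[OF less(2)] by blast
  have "2 = (\<Sum>j<n. of_int (\<beta> j) * b j)" using rootpair_pair[OF less(2)] by (simp add: pair_def)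
  then have "\<not> (\<Sum>j<n. of_int (\<beta> j) * b j) \<le> 0" by linarith
  then obtain j where j: "j < n" "0 < of_int (\<beta> j) * b j"
    using sum_nonpos[of "{..<n}" "\<lambda>j. of_int (\<beta> j) * b j"] by force
  have bj: "0 < b j" "0 < \<beta> j" using j(2) less(3) by (auto simp: nonneg_def zero_less_mult_iff dest: spec[of _ j])
  have jJ: "j \<in> J" using less(4)[of j] bj by fastforce
  have jl: "j < l" using jJ J by auto
  \<comment> \<open>Both sides equal \<open>2 * B b (ev j)\<close>; this converts positivity of the
    root at \<open>ev j\<close> into positivity of \<open>al j\<close> at \<open>b\<close>.\<close>
  have "B b b * pr \<beta> (ev j) = B (ev j) (ev j) * pr (al j) b"
    using rootpair_B[OF less(2), of "ev j"] B_ev[OF jl, of b] by (simp add: B_sym)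
  moreover have "0 < B b b * pr \<beta> (ev j)" using rootpair_Bpos[OF less(2)] bj j by (simp add: pair_ev)
  ultimately have pb: "0 < pr (al j) b" using B_ev_pos[OF jl] by (metis zero_less_mult_pos)
  show ?case
  proof (cases "b = ev j")
    case True
    then have "\<beta> = al j" using rootpair_unique[OF less(2), of "al j"] rootpair_simple[of j I] jl by simp
    then show ?thesis using True rootpair_simple[OF jJ jl] by simp
  next
    case False
    have jI: "j \<in> I" using jl by simp
    have nn: "nonneg (sa j b)" using refl_nonneg[OF less(2,3) jI jl False] .
    have rp: "rootpair I (sX j \<beta>) (sa j b)" using rootpair_W[OF less(2) W_gen[OF jI jl]] by simp
    obtain k' where k': "sa j b = rv k'" using rootpair_int[OF rp] by blast
    have sup: "sa j b i = 0" if "i \<notin> J" for i using less(4)[OF that] that jJ by (auto simp: refla_def)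
    have "(\<Sum>i\<in>J. sa j b i) = (\<Sum>i\<in>J. b i) - pr (al j) b"
      using fJ jJ by (simp add: refla_def sum_subtractf)
    then have "(\<Sum>i\<in>J. sa j b i) < (\<Sum>i\<in>J. b i)" using pb by simp
    then have "(\<Sum>i\<in>J. rv k' i) < (\<Sum>i\<in>J. rv k i)" unfolding k' unfolding k .
    then have lt: "(\<Sum>i\<in>J. k' i) < (\<Sum>i\<in>J. k i)" by (simp flip: of_int_sum)
    have "\<lfloor>\<Sum>i\<in>J. rv q i\<rfloor> = (\<Sum>i\<in>J. q i)" for q
      by (simp flip: of_int_sum)
    then have fl: "\<lfloor>\<Sum>i\<in>J. sa j b i\<rfloor> = (\<Sum>i\<in>J. k' i)" "\<lfloor>\<Sum>i\<in>J. b i\<rfloor> = (\<Sum>i\<in>J. k i)"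
      unfolding k' unfolding k by blast+
    have "0 \<le> (\<Sum>i\<in>J. k' i)"
      by (intro sum_nonneg) (use nn k' in \<open>auto simp: nonneg_def\<close>)
    then have "nat \<lfloor>\<Sum>i\<in>J. sa j b i\<rfloor> < nat \<lfloor>\<Sum>i\<in>J. b i\<rfloor>" using lt unfolding fl by simp
    then have "rootpair J (sX j \<beta>) (sa j b)" using less(1) rp nn sup by blast
    then have "rootpair J (sX j (sX j \<beta>)) (sa j (sa j b))" using rootpair_W[OF _ W_gen[OF jJ jl]] by simp
    then show ?thesis by (simp add: sX_invol[OF jl] sa_invol[OF jl])
  qed
qed

text \<open>For a positive root the pairing with \<open>nu\<close> is a sum of nonnegative terms, so
  its vanishing removes every simple root outside J.\<close>

lemma roots_orthogonal:
  assumes J: "J \<subseteq> I" and nu: "\<And>i. i \<in> J \<Longrightarrow> pr (al i) nu = 0" "\<And>i. i < l \<Longrightarrow> i \<notin> J \<Longrightarrow> 0 < pr (al i) nu"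
    and rp: "rootpair I \<beta> b" and z: "pr \<beta> nu = 0"
  shows "\<beta> \<in> rootsJ n l al J"
proof -
  have *: "rootpair J \<beta> b" if rp: "rootpair I \<beta> b" and z: "pr \<beta> nu = 0" and nn: "nonneg b" for \<beta> b
  proof (rule root_in_levi[OF J rp nn])
    fix j assume j: "j \<notin> J"
    obtain c :: "nat \<Rightarrow> nat" where c: "\<beta> = (\<lambda>j. \<Sum>m<l. int (c m) * al m j)"
      "\<And>m. m < l \<Longrightarrow> c m = 0 \<longleftrightarrow> b m = 0"
      using rootpair_nonneg_comb[OF rp nn] by metis
    have "(\<Sum>m<l. real (c m) * pr (al m) nu) = 0" using z unfolding rootpair_pr_sum[OF c(1)] .
    moreover have "0 \<le> real (c m) * pr (al m) nu" if "m \<in> {..<l}" for m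
      using nu(1)[of m] nu(2)[of m] that by (cases "m \<in> J") auto
    ultimately have "\<forall>m\<in>{..<l}. real (c m) * pr (al m) nu = 0"
      using sum_nonneg_eq_0_iff[of "{..<l}" "\<lambda>m. real (c m) * pr (al m) nu"] by simp
    then have "j < l \<Longrightarrow> c j = 0" using nu(2)[of j] j by force
    then show "b j = 0" using c(2)[of j] rootpair_support_l[OF rp, of j] by (cases "j < l") auto
  qed
  show ?thesis
  proof (cases "nonneg b")
    case True
    then show ?thesis using *[OF rp z] rootpair_root by blast
  next
    case False
    then have nn: "nonneg (\<lambda>j. - b j)" using rootpair_sign[OF rp] by blast
    have "pr (\<lambda>j. - \<beta> j) nu = 0" using z by (simp add: pair_uminus_left)
    then have "rootpair J (\<lambda>j. - \<beta> j) (\<lambda>j. - b j)" using *[OF rootpair_uminus[OF rp] _ nn] by blast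
    then have "rootpair J (\<lambda>j. - (- \<beta> j)) (\<lambda>j. - (- b j))" by (rule rootpair_uminus)
    then show ?thesis using rootpair_root by simp
  qed
qed

end

section \<open>Orbit sums\<close>

text \<open>Artin's argument: translate the relation by a \<open>y\<close> separating two characters
  and subtract \<open>f y\<close> times the original, which eliminates \<open>f\<close>. The
  operation \<open>p\<close> needs no algebraic laws for this.\<close>

lemma characters_independent:
  fixes S :: "('a \<Rightarrow> 'b::field) set"
  assumes "finite S" and mult: "\<And>\<phi> x y. \<phi> \<in> S \<Longrightarrow> \<phi> (p x y) = \<phi> x * \<phi> y"
    and nz: "\<And>\<phi>. \<phi> \<in> S \<Longrightarrow> \<exists>x. \<phi> x \<noteq> 0"
    and sum0: "\<And>x. (\<Sum>\<phi>\<in>S. c \<phi> * \<phi> x) = 0"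
  shows "\<forall>\<phi>\<in>S. c \<phi> = 0"
  using assms
proof (induction S arbitrary: c rule: finite_induct)
  case (insert f S)
  have "c \<phi> = 0" if \<phi>: "\<phi> \<in> S" for \<phi>
  proof -
    obtain y where y: "f y \<noteq> \<phi> y" using \<phi> insert(2) by (metis ext)
    have "(\<Sum>\<phi>\<in>S. c \<phi> * (\<phi> y - f y) * \<phi> x) = 0" for x
    proof -
      have 1: "c f * f (p y x) + (\<Sum>\<phi>\<in>S. c \<phi> * \<phi> (p y x)) = 0"
        and 2: "c f * f x + (\<Sum>\<phi>\<in>S. c \<phi> * \<phi> x) = 0"
        using insert(6) insert(1,2) by simp_all
      have "(\<Sum>\<phi>\<in>S. c \<phi> * (\<phi> y - f y) * \<phi> x) = (\<Sum>\<phi>\<in>S. c \<phi> * \<phi> (p y x)) - f y * (\<Sum>\<phi>\<in>S. c \<phi> * \<phi> x)"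
        unfolding sum_distrib_left sum_subtractf[symmetric]
      proof (rule sum.cong[OF refl])
        fix \<phi> assume "\<phi> \<in> S"
        then have "\<phi> (p y x) = \<phi> y * \<phi> x" using insert(4) by blast
        then show "c \<phi> * (\<phi> y - f y) * \<phi> x = c \<phi> * \<phi> (p y x) - f y * (c \<phi> * \<phi> x)"
          by (simp add: algebra_simps)
      qed
      also have "\<dots> = - (c f * f (p y x)) + f y * (c f * f x)"
        using 1 2 by (simp add: eq_neg_iff_add_eq_0[symmetric] add_eq_0_iff)
      finally show ?thesis using insert(4)[of f y x] by simp
    qed
    then have "\<forall>\<phi>\<in>S. c \<phi> * (\<phi> y - f y) = 0"
      using insert(3)[of "\<lambda>\<phi>. c \<phi> * (\<phi> y - f y)"] insert(4,5) by blast
    then show ?thesis using \<phi> y by auto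
  qed
  moreover have "c f = 0"
  proof -
    obtain x where "f x \<noteq> 0" using insert(5) by blast
    moreover have "c f * f x = 0" using insert(6)[of x] insert(1,2) \<open>\<And>\<phi>. \<phi> \<in> S \<Longrightarrow> c \<phi> = 0\<close> by simp
    ultimately show ?thesis by simp
  qed
  ultimately show ?case by blast
qed simp

text \<open>The character with values \<open>u j\<close> on the basis. For nonzero
  \<open>u j\<close> it is multiplicative on all integer vectors, so that orbit arguments can
  proceed without tracking membership in \<open>charlat\<close>.\<close>

definition mono_char :: "nat \<Rightarrow> (nat \<Rightarrow> 'a::field) \<Rightarrow> (nat \<Rightarrow> int) \<Rightarrow> 'a" where
  "mono_char n u lam = (\<Prod>j<n. u j powi lam j)"

lemma mono_char_add: "(\<And>j. j < n \<Longrightarrow> u j \<noteq> 0) \<Longrightarrow>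
    mono_char n u (\<lambda>j. a j + b j) = mono_char n u a * mono_char n u b"
  by (simp add: mono_char_def power_int_add prod.distrib)

lemma mono_char_zero: "mono_char n u (\<lambda>_. 0) = 1"
  by (simp add: mono_char_def)

lemma mono_char_nonzero: "(\<And>j. j < n \<Longrightarrow> u j \<noteq> 0) \<Longrightarrow> mono_char n u a \<noteq> 0"
  by (simp add: mono_char_def power_int_eq_0_iff)

lemma mono_char_unitvec: "j < n \<Longrightarrow> mono_char n u (unitvec j) = u j"
proof -
  assume "j < n"
  have "mono_char n u (unitvec j) = (\<Prod>i<n. if i = j then u i else 1)"
    unfolding mono_char_def unitvec_def by (intro prod.cong) auto
  then show ?thesis using \<open>j < n\<close> by simp
qed

lemma charlat_induct [consumes 1, case_names zero add sub]:
  assumes lam: "lam \<in> charlat n" and zero: "P (\<lambda>_. 0)"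
    and add: "\<And>a j. a \<in> charlat n \<Longrightarrow> j < n \<Longrightarrow> P a \<Longrightarrow> P (\<lambda>i. a i + unitvec j i)"
    and sub: "\<And>a j. a \<in> charlat n \<Longrightarrow> j < n \<Longrightarrow> P a \<Longrightarrow> P (\<lambda>i. a i - unitvec j i)"
  shows "P lam"
  using lam
proof (induction "nat (\<Sum>j<n. \<bar>lam j\<bar>)" arbitrary: lam rule: less_induct)
  case less
  show ?case
  proof (cases "lam = (\<lambda>_. 0)")
    case False
    then obtain j where j: "lam j \<noteq> 0" by blast
    then have jn: "j < n" using less(2) by (auto simp: charlat_def not_le[symmetric])
    define e where "e = sgn (lam j)"
    define a where "a = (\<lambda>i. lam i - e * unitvec j i)"
    have a: "a \<in> charlat n" using less(2) jn by (auto simp: charlat_def a_def unitvec_def)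
    have "(\<Sum>i<n. \<bar>a i\<bar>) = \<bar>a j\<bar> + (\<Sum>i\<in>{..<n} - {j}. \<bar>a i\<bar>)"
      "(\<Sum>i<n. \<bar>lam i\<bar>) = \<bar>lam j\<bar> + (\<Sum>i\<in>{..<n} - {j}. \<bar>lam i\<bar>)"
      using jn by (simp_all add: sum.remove[of _ j])
    moreover have "(\<Sum>i\<in>{..<n} - {j}. \<bar>a i\<bar>) = (\<Sum>i\<in>{..<n} - {j}. \<bar>lam i\<bar>)"
      by (intro sum.cong) (auto simp: a_def unitvec_def)
    moreover have "\<bar>a j\<bar> < \<bar>lam j\<bar>" using j by (auto simp: a_def unitvec_def e_def sgn_if)
    ultimately have "nat (\<Sum>i<n. \<bar>a i\<bar>) < nat (\<Sum>i<n. \<bar>lam i\<bar>)"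
      using sum_nonneg[of "{..<n}" "\<lambda>i. \<bar>a i\<bar>"] by linarith
    then have Pa: "P a" using less(1) a by blast
    have "e = 1 \<or> e = -1" using j by (simp add: e_def sgn_if)
    then consider "e = 1" | "e = -1" by blast
    then show ?thesis
    proof cases
      case 1
      then have "lam = (\<lambda>i. a i + unitvec j i)" by (auto simp: a_def)
      then show ?thesis using add[OF a jn Pa] by simp
    next
      case 2
      then have "lam = (\<lambda>i. a i - unitvec j i)" by (auto simp: a_def)
      then show ?thesis using sub[OF a jn Pa] by simp
    qed
  qed (use zero in simp)
qed

lemma unitvec_char: "j < n \<Longrightarrow> unitvec j \<in> charlat n"
  by (auto simp: charlat_def unitvec_def)

lemma charlat_char_eq:
  fixes f :: "(nat \<Rightarrow> int) \<Rightarrow> 'a::field"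
  assumes hom: "\<And>a b. a \<in> charlat n \<Longrightarrow> b \<in> charlat n \<Longrightarrow> f (\<lambda>j. a j + b j) = f a * f b"
    and one: "f (\<lambda>_. 0) = 1" and lam: "lam \<in> charlat n"
  shows "f lam = mono_char n (\<lambda>j. f (unitvec j)) lam" "f lam \<noteq> 0"
proof -
  have inv: "f a * f (\<lambda>j. - a j) = 1" if "a \<in> charlat n" for a
    using hom[of a "\<lambda>j. - a j"] one that by (simp add: charlat_def)
  have nz: "f a \<noteq> 0" if "a \<in> charlat n" for a using inv[OF that] by auto
  show "f lam \<noteq> 0" using nz[OF lam] .
  let ?u = "\<lambda>j. f (unitvec j)"
  have u: "?u j \<noteq> 0" if "j < n" for j using nz unitvec_char that by blast
  show "f lam = mono_char n ?u lam"
    using lam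
  proof (induction rule: charlat_induct)
    case zero
    then show ?case by (simp add: one mono_char_zero)
  next
    case (add a j)
    then show ?case using hom[OF _ unitvec_char] mono_char_add[of n ?u] u by (simp add: mono_char_unitvec)
  next
    case (sub a j)
    have c: "(\<lambda>i. a i - unitvec j i) \<in> charlat n" using sub by (auto simp: charlat_def unitvec_def)
    have "f a = f (\<lambda>i. a i - unitvec j i) * f (unitvec j)"
      using hom[OF c unitvec_char[OF sub(2)]] by simp
    moreover have "mono_char n ?u a = mono_char n ?u (\<lambda>i. a i - unitvec j i) * ?u j"
      using mono_char_add[of n ?u "\<lambda>i. a i - unitvec j i" "unitvec j"] u sub(2) by (simp add: mono_char_unitvec)
    ultimately show ?case using sub(3) u[OF sub(2)] by simp
  qed
qed

context weyl
begin

text \<open>Summing over the group instead of the orbit only introduces the order of a stabilizer,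
  harmless in characteristic 0, and makes reindexing by group elements immediate.\<close>

definition orbsum :: "((nat \<Rightarrow> int) \<Rightarrow> 'a::field) \<Rightarrow> (nat \<Rightarrow> int) \<Rightarrow> 'a" where
  "orbsum F lam = (\<Sum>w\<in>W I. F (fst w lam))"

lemma orbsum_W: "u \<in> W I \<Longrightarrow> orbsum F (fst u lam) = orbsum F lam"
  unfolding orbsum_def using W_sum_right[of u I "\<lambda>f g. F (f lam)"] by simp

text \<open>All fibres of the orbit map are cosets of the stabilizer.\<close>
lemma orbsum_orbit:
  "orbsum F (unitvec i) = of_nat (card {w \<in> W I. fst w (unitvec i) = unitvec i}) * (\<Sum>mu\<in>orbit n l al i. F mu)"
proof -
  let ?x = "unitvec i" and ?f = "\<lambda>w. fst w (unitvec i)"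
  let ?S = "{w \<in> W I. fst w ?x = ?x}"
  have orb: "orbit n l al i = ?f ` W I" unfolding orbit_def by blast
  have fib: "card {w \<in> W I. ?f w = mu} = card ?S" if "mu \<in> orbit n l al i" for mu
  proof -
    have "mu \<in> ?f ` W I" using \<open>mu \<in> orbit n l al i\<close> orb by blast
    then obtain u where u: "u \<in> W I" "mu = fst u ?x" by blast
    obtain v where v: "v \<in> W I" "fst v \<circ> fst u = id" "fst u \<circ> fst v = id" "snd v \<circ> snd u = id" "snd u \<circ> snd v = id"
      using W_inv[OF u(1)] by blast
    have vu: "fst v (fst u t) = t" for t using v by (simp add: pointfree_idE)
    have "bij_betw (\<lambda>w. (fst u \<circ> fst w, snd u \<circ> snd w)) ?S {w \<in> W I. ?f w = mu}"
      by (rule bij_betw_byWitness[where f' = "\<lambda>w. (fst v \<circ> fst w, snd v \<circ> snd w)"])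
         (use u v vu in \<open>auto simp: comp_assoc[symmetric] intro: W_comp[OF u(1)] W_comp[OF v(1)]\<close>)
    then show ?thesis by (simp add: bij_betw_same_card)
  qed
  have "orbsum F ?x = (\<Sum>mu\<in>?f ` W I. \<Sum>w\<in>{w \<in> W I. ?f w = mu}. F (?f w))"
    unfolding orbsum_def by (rule sum.image_gen[OF finW])
  also have "\<dots> = (\<Sum>mu\<in>orbit n l al i. of_nat (card ?S) * F mu)"
    unfolding orb[symmetric] by (intro sum.cong refl) (simp add: fib)
  finally show ?thesis by (simp add: sum_distrib_left)
qed

text \<open>A Weyl-invariant height, equal to the pairing with \<open>rho2\<close> at the dominant
  member of the orbit; it drives the induction on dominant weights.\<close>

definition ht :: "(nat \<Rightarrow> int) \<Rightarrow> real" where "ht lam = Max ((\<lambda>w. pr (fst w lam) rho2) ` W I)"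

lemma ht_ge: "w \<in> W I \<Longrightarrow> pr (fst w lam) rho2 \<le> ht lam"
  unfolding ht_def by (rule Max_ge) (use finW in auto)

lemma ht_W: assumes u: "u \<in> W I" shows "ht (fst u lam) = ht lam"
proof -
  have "(\<lambda>w. pr (fst w (fst u lam)) rho2) ` W I = (\<lambda>w. pr (fst w lam) rho2) ` (\<lambda>w. (fst w \<circ> fst u, snd w \<circ> snd u)) ` W I"
    by (simp add: image_image)
  then show ?thesis using bij_betw_imp_surj_on[OF W_right_bij[OF u]] by (simp add: ht_def)
qed

lemma comb_rho2: "pr (\<lambda>j. \<Sum>m<l. int (c m) * al m j) rho2 = 2 * (\<Sum>m<l. real (c m))"
  by (simp add: pair_sum_left rho2_pr sum_distrib_left mult.commute)

lemma dominant_rho2: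
  assumes w: "w \<in> W I" and a: "\<And>i. i < l \<Longrightarrow> 0 \<le> a i"
  shows "pr (fst w a) rho2 \<le> pr a rho2" "pr (fst w a) rho2 = pr a rho2 \<Longrightarrow> fst w a = a"
proof -
  obtain c :: "nat \<Rightarrow> nat" where c: "(\<lambda>j. a j - fst w a j) = (\<lambda>j. \<Sum>m<l. int (c m) * al m j)"
    using dominant_weight_diff[of w a] w a by blast
  have e: "pr a rho2 - pr (fst w a) rho2 = 2 * (\<Sum>m<l. real (c m))"
    using comb_rho2[of c] by (simp flip: c add: pair_diff_left)
  then show "pr (fst w a) rho2 \<le> pr a rho2" using sum_nonneg[of "{..<l}" "\<lambda>m. real (c m)"] by simp
  assume "pr (fst w a) rho2 = pr a rho2"
  then have "(\<Sum>m<l. c m) = 0" using e by (simp flip: of_nat_sum)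
  then have "(\<lambda>j. a j - fst w a j) = (\<lambda>j. 0)" unfolding c by simp
  then show "fst w a = a" by (auto simp: fun_eq_iff)
qed

lemma ht_dominant: assumes a: "\<And>i. i < l \<Longrightarrow> 0 \<le> a i" shows "ht a = pr a rho2"
  unfolding ht_def
proof (rule Max_eqI)
  show "pr a rho2 \<in> (\<lambda>w. pr (fst w a) rho2) ` W I" by (rule image_eqI[OF _ W_id]) simp
qed (use finW dominant_rho2(1)[OF _ a] in auto)

lemma ht_attained: "\<exists>w\<in>W I. pr (fst w a) rho2 = ht a"
proof -
  have "ht a \<in> (\<lambda>w. pr (fst w a) rho2) ` W I"
    unfolding ht_def by (rule Max_in) (use finW W_nonempty in auto)
  then show ?thesis by force
qed

lemma ht_int: "ht a \<in> \<int>"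
proof -
  obtain k where k: "rho2 = rv k" using rho2_int by blast
  obtain w where "w \<in> W I" "ht a = pr (fst w a) rho2" using ht_attained[of a] by force
  then show ?thesis using pair_Ints[of n "fst w a" k] by (simp add: k)
qed

lemma dominant_weight_exists: "\<exists>w\<in>W I. \<forall>i<l. 0 \<le> fst w a i"
proof -
  obtain w where w: "w \<in> W I" "pr (fst w a) rho2 = ht a" using ht_attained by blast
  have "0 \<le> fst w a i" if i: "i < l" for i
  proof -
    have "(sX i \<circ> fst w, sa i \<circ> snd w) \<in> W I" using Wgrp.Wstep[OF w(1)] i by simp
    from ht_ge[OF this, of a] have "pr (sX i (fst w a)) rho2 \<le> ht a" by simp
    then show ?thesis using w(2) by (simp add: sX_pr[OF i] rho2_pr[OF i])
  qed
  then show ?thesis using w by blast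
qed

text \<open>Moving \<open>w\<close> across the pairing turns the sum into a pairing with the group
  sum of \<open>rho2\<close>, which vanishes since \<open>rho2\<close> lies in the span of the
  simple coroots.\<close>

lemma sum_rho2: "(\<Sum>w\<in>W I. pr (fst w a) rho2) = 0"
proof -
  have "(\<Sum>w\<in>W I. pr (fst w a) rho2) = (\<Sum>w\<in>W I. pr a (snd w rho2))"
  proof -
    have bij: "bij_betw (\<lambda>w. (inv (fst w), inv (snd w))) (W I) (W I)"
    proof (rule bij_betw_byWitness[where f' = "\<lambda>w. (inv (fst w), inv (snd w))"])
      show "\<forall>w\<in>W I. (inv (fst (inv (fst w), inv (snd w))), inv (snd (inv (fst w), inv (snd w)))) = w"
        by (simp add: inv_inv_eq W_bij)
      have "(inv (fst w), inv (snd w)) \<in> W I" if "w \<in> W I" for w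
      proof -
        obtain v where "v \<in> W I" "fst w \<circ> fst v = id" "fst v \<circ> fst w = id" "snd w \<circ> snd v = id" "snd v \<circ> snd w = id"
          using W_inv[OF \<open>w \<in> W I\<close>] by metis
        then show ?thesis using inv_unique_comp[of "fst w" "fst v"] inv_unique_comp[of "snd w" "snd v"] by simp
      qed
      then show "(\<lambda>w. (inv (fst w), inv (snd w))) ` W I \<subseteq> W I" "(\<lambda>w. (inv (fst w), inv (snd w))) ` W I \<subseteq> W I"
        by auto
    qed (simp add: inv_inv_eq W_bij)
    have "pr (inv (fst w) a) rho2 = pr a (snd w rho2)" if "w \<in> W I" for w
      using W_pair[OF that, of "inv (fst w) a" rho2] W_bij(1)[OF that] by (simp add: bij_is_surj surj_f_inv_f)
    then have "(\<Sum>w\<in>W I. pr a (snd w rho2)) = (\<Sum>w\<in>W I. pr (inv (fst w) a) rho2)" by simp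
    also have "\<dots> = (\<Sum>w\<in>W I. pr (fst w a) rho2)"
      using sum.reindex_bij_betw[OF bij, of "\<lambda>w. pr (fst w a) rho2"] by simp
    finally show ?thesis by simp
  qed
  also have "\<dots> = pr a (\<lambda>j. \<Sum>w\<in>W I. snd w rho2 j)" by (simp add: pair_sum)
  also have "(\<lambda>j. \<Sum>w\<in>W I. snd w rho2 j) = (\<lambda>j. 0)"
  proof -
    obtain k where k: "rho2 = rv k" "\<forall>j. \<not> j < l \<longrightarrow> k j = 0" using rho2_int by blast
    have "pM n l al I rho2 = (\<lambda>j. 0)" by (rule pM_J_zero) (use k in auto)
    then show ?thesis using finI W_nonempty[of I] by (auto simp: pM_def fun_eq_iff)
  qed
  finally show ?thesis by simp
qed

lemma ht_nonneg: "0 \<le> ht a"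
proof (rule ccontr)
  assume "\<not> 0 \<le> ht a"
  then have "(\<Sum>w\<in>W I. pr (fst w a) rho2) < (\<Sum>w\<in>W I. 0)"
    using ht_ge[of _ a] by (intro sum_strict_mono) (use finI W_nonempty in \<open>force+\<close>)
  then show False by (simp add: sum_rho2)
qed

text \<open>If the value were 0, all orbit values would be at most 0 with total 0, yet the
  reflection at \<open>i\<close> produces the value -2.\<close>

lemma ht_fundamental_pos: assumes i: "i < l" shows "0 < pr (unitvec i) rho2"
proof -
  have dom: "0 \<le> unitvec i j" for j by (simp add: unitvec_def)
  have "0 \<le> pr (unitvec i) rho2" using ht_nonneg[of "unitvec i"] ht_dominant[of "unitvec i"] dom by simp
  moreover have "pr (unitvec i) rho2 \<noteq> 0"
  proof
    assume z: "pr (unitvec i) rho2 = 0"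
    then have le: "pr (fst w (unitvec i)) rho2 \<le> 0" if "w \<in> W I" for w
      using ht_ge[OF that, of "unitvec i"] ht_dominant[of "unitvec i"] dom by simp
    have "(\<Sum>w\<in>W I. pr (fst w (unitvec i)) rho2) < (\<Sum>w\<in>W I. 0)"
    proof (rule sum_strict_mono_ex1[OF finI])
      show "\<forall>w\<in>W I. pr (fst w (unitvec i)) rho2 \<le> 0" using le by blast
      show "\<exists>w\<in>W I. pr (fst w (unitvec i)) rho2 < 0"
        by (rule bexI[of _ "(sX i, sa i)"])
           (use W_gen i in \<open>auto simp: sX_pr z rho2_pr\<close>, simp add: unitvec_def)
    qed
    then show False by (simp add: sum_rho2)
  qed
  ultimately show ?thesis by simp
qed

lemma WX_central: "w \<in> W I \<Longrightarrow> (\<And>i. i < l \<Longrightarrow> a i = 0) \<Longrightarrow> fst w a = a"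
  by (induction rule: Wgrp.induct) (auto simp: reflX_def)

text \<open>Triangularity: in \<open>S(lam - omega\<^sub>i) S(omega\<^sub>i)\<close> every term is either \<open>S(lam)\<close> or of smaller height.\<close>
lemma orbsum_determined:
  fixes F G :: "(nat \<Rightarrow> int) \<Rightarrow> 'a::field_char_0"
  assumes F: "\<And>a b. F (\<lambda>j. a j + b j) = F a * F b" and G: "\<And>a b. G (\<lambda>j. a j + b j) = G a * G b"
    and central: "\<And>a. (\<And>i. i < l \<Longrightarrow> a i = 0) \<Longrightarrow> F a = G a"
    and fund: "\<And>i. i < l \<Longrightarrow> orbsum F (unitvec i) = orbsum G (unitvec i)"
  shows "orbsum F lam = orbsum G lam"
proof (induction "nat \<lfloor>ht lam\<rfloor>" arbitrary: lam rule: less_induct)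
  case less
  obtain u where u: "u \<in> W I" "\<And>i. i < l \<Longrightarrow> 0 \<le> fst u lam i" using dominant_weight_exists by blast
  define a where "a = fst u lam"
  have a0: "0 \<le> a i" if "i < l" for i using u that by (simp add: a_def)
  have hta: "ht a = ht lam" using ht_W[OF u(1)] by (simp add: a_def)
  have "orbsum F a = orbsum G a"
  proof (cases "\<forall>i<l. a i = 0")
    case True
    then have "fst w a = a" if "w \<in> W I" for w using WX_central[OF that] by simp
    then show ?thesis using central[of a] True by (simp add: orbsum_def)
  next
    case False
    then obtain i where i: "i < l" "0 < a i" using a0 by force
    define a' where "a' = (\<lambda>j. a j - unitvec i j)"
    have a'0: "0 \<le> a' j" if "j < l" for j using a0[OF that] i by (auto simp: a'_def unitvec_def)
    have aa': "a = (\<lambda>j. a' j + unitvec i j)" by (simp add: a'_def)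
    have hta': "ht a = ht a' + pr (unitvec i) rho2"
      using ht_dominant[of a'] ht_dominant[of a] a0 a'0 by (simp add: aa' pair_add_left)
    \<comment> \<open>Heights are nonnegative integers, so a strict drop of the real height is a
      strict drop of the natural-number measure.\<close>
    have dec: "orbsum F mu = orbsum G mu" if "ht mu < ht a" for mu
    proof (rule less)
      obtain p q where "ht mu = of_int p" "ht a = of_int q" using ht_int Ints_cases by metis
      then show "nat \<lfloor>ht mu\<rfloor> < nat \<lfloor>ht lam\<rfloor>" using that ht_nonneg[of mu] hta by simp
    qed
    have prodS: "orbsum H a' * orbsum H (unitvec i) = (\<Sum>w\<in>W I. orbsum H (\<lambda>j. a' j + fst w (unitvec i) j))"
      if H: "\<And>a b. H (\<lambda>j. a j + b j) = H a * H b" for H :: "(nat \<Rightarrow> int) \<Rightarrow> 'a"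
    proof -
      have "(\<Sum>w\<in>W I. orbsum H (\<lambda>j. a' j + fst w (unitvec i) j))
        = (\<Sum>w\<in>W I. \<Sum>v\<in>W I. H (fst v a') * H (fst v (fst w (unitvec i))))"
        unfolding orbsum_def by (intro sum.cong refl) (simp add: WX_add H)
      also have "\<dots> = (\<Sum>v\<in>W I. \<Sum>w\<in>W I. H (fst v a') * H (fst v (fst w (unitvec i))))"
        by (rule sum.swap)
      also have "\<dots> = (\<Sum>v\<in>W I. H (fst v a') * orbsum H (unitvec i))"
      proof (intro sum.cong refl)
        fix v assume v: "v \<in> W I"
        show "(\<Sum>w\<in>W I. H (fst v a') * H (fst v (fst w (unitvec i)))) = H (fst v a') * orbsum H (unitvec i)"
          using W_sum_left[OF v, of "\<lambda>f g. H (f (unitvec i))"] by (simp add: orbsum_def sum_distrib_left[symmetric])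
      qed
      finally show ?thesis by (simp add: orbsum_def sum_distrib_right)
    qed
    \<comment> \<open>The terms whose height does not drop. For them the two bounds for
      \<open>a'\<close> and the fundamental weight are attained at once, which puts the term in the
      orbit of \<open>a\<close>.\<close>
    define top where "top = {w \<in> W I. ht (\<lambda>j. a' j + fst w (unitvec i) j) \<ge> ht a}"
    have eqtop: "orbsum H (\<lambda>j. a' j + fst w (unitvec i) j) = orbsum H a" if "w \<in> top" for w and H :: "(nat \<Rightarrow> int) \<Rightarrow> 'a"
    proof -
      let ?mu = "\<lambda>j. a' j + fst w (unitvec i) j"
      have w: "w \<in> W I" and h: "ht ?mu \<ge> ht a" using that by (auto simp: top_def)
      obtain v where v: "v \<in> W I" "pr (fst v ?mu) rho2 = ht ?mu" using ht_attained by blast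
      have vw: "(fst v \<circ> fst w, snd v \<circ> snd w) \<in> W I" using W_comp[OF v(1) w] .
      have e: "fst v ?mu = (\<lambda>j. fst v a' j + fst v (fst w (unitvec i)) j)" using WX_add[OF v(1)] .
      have d: "\<And>j. j < l \<Longrightarrow> 0 \<le> unitvec i j" by (simp add: unitvec_def)
      have "pr (fst v a') rho2 \<le> pr a' rho2" using dominant_rho2(1)[OF v(1) a'0] .
      moreover have "pr (fst v (fst w (unitvec i))) rho2 \<le> pr (unitvec i) rho2"
        using dominant_rho2(1)[OF vw d] by simp
      moreover have "pr (fst v a') rho2 + pr (fst v (fst w (unitvec i))) rho2 \<ge> pr a' rho2 + pr (unitvec i) rho2"
        using h v(2) ht_dominant[of a] a0 unfolding e pair_add_left by (simp add: aa' pair_add_left)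
      ultimately have "pr (fst v a') rho2 = pr a' rho2" "pr (fst v (fst w (unitvec i))) rho2 = pr (unitvec i) rho2"
        by linarith+
      then have "fst v a' = a'" "fst v (fst w (unitvec i)) = unitvec i"
        using dominant_rho2(2)[OF v(1) a'0] dominant_rho2(2)[OF vw d] by simp_all
      then have "fst v ?mu = a" by (simp add: e aa')
      then show ?thesis using orbsum_W[OF v(1), of H ?mu] by simp
    qed
    have ht: "top \<subseteq> W I" "finite top" using finI by (auto simp: top_def)
    have split: "orbsum H a' * orbsum H (unitvec i) = of_nat (card top) * orbsum H a
        + (\<Sum>w\<in>W I - top. orbsum H (\<lambda>j. a' j + fst w (unitvec i) j))"
      if H: "\<And>a b. H (\<lambda>j. a j + b j) = H a * H b" for H :: "(nat \<Rightarrow> int) \<Rightarrow> 'a"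
      unfolding prodS[OF H] using sum.subset_diff[OF ht(1) finI, of "\<lambda>w. orbsum H (\<lambda>j. a' j + fst w (unitvec i) j)"] eqtop
      by (simp add: add.commute)
    have "orbsum F a' = orbsum G a'"
      by (rule dec) (simp add: hta' ht_fundamental_pos[OF i(1)])
    moreover have "(\<Sum>w\<in>W I - top. orbsum F (\<lambda>j. a' j + fst w (unitvec i) j)) = (\<Sum>w\<in>W I - top. orbsum G (\<lambda>j. a' j + fst w (unitvec i) j))"
      by (intro sum.cong refl dec) (auto simp: top_def)
    ultimately have "of_nat (card top) * orbsum F a = of_nat (card top) * orbsum G a"
      using split[of F] split[of G] F G fund[OF i(1)] by auto
    \<comment> \<open>The identity contributes \<open>a\<close> itself, so the multiplicity can be
      cancelled.\<close>
    moreover have "(id, id) \<in> top" using W_id[of I] by (simp add: top_def aa')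
    then have "card top \<noteq> 0" using ht(2) by auto
    ultimately show ?thesis by simp
  qed
  then show ?case by (simp add: a_def orbsum_W[OF u(1)])
qed

text \<open>If \<open>F\<close> were not a translate of \<open>G\<close>, the two families of
  translates would be disjoint, and equal orbit sums would be a linear relation between distinct
  characters in which \<open>F\<close> has a positive multiplicity.\<close>

lemma orbit_separation:
  fixes F G :: "(nat \<Rightarrow> int) \<Rightarrow> 'a::field_char_0"
  assumes F: "\<And>a b. F (\<lambda>j. a j + b j) = F a * F b" and G: "\<And>a b. G (\<lambda>j. a j + b j) = G a * G b"
    and nz: "F (\<lambda>_. 0) \<noteq> 0" "G (\<lambda>_. 0) \<noteq> 0"
    and eq: "\<And>lam. orbsum F lam = orbsum G lam"
  shows "\<exists>v\<in>W I. F = G \<circ> fst v"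
proof (rule ccontr)
  assume contr: "\<not> ?thesis"
  let ?SF = "(\<lambda>w. F \<circ> fst w) ` W I" and ?SG = "(\<lambda>w. G \<circ> fst w) ` W I"
  have disj: "?SF \<inter> ?SG = {}"
  proof (rule ccontr)
    assume "?SF \<inter> ?SG \<noteq> {}"
    then obtain w v where w: "w \<in> W I" "v \<in> W I" "F \<circ> fst w = G \<circ> fst v" by auto
    obtain w' where w': "w' \<in> W I" "fst w \<circ> fst w' = id" using W_inv[OF w(1)] by metis
    have "F = (F \<circ> fst w) \<circ> fst w'" using w'(2) by (simp add: comp_assoc)
    also have "\<dots> = G \<circ> fst (fst v \<circ> fst w', snd v \<circ> snd w')" using w(3) by (simp add: comp_assoc)
    finally show False using contr W_comp[OF w(2) w'(1)] by blast
  qed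
  define cF where "cF \<phi> = (of_nat (card {w \<in> W I. F \<circ> fst w = \<phi>}) :: 'a)" for \<phi> :: "(nat \<Rightarrow> int) \<Rightarrow> 'a"
  define cG where "cG \<phi> = (of_nat (card {w \<in> W I. G \<circ> fst w = \<phi>}) :: 'a)" for \<phi> :: "(nat \<Rightarrow> int) \<Rightarrow> 'a"
  have sumF: "orbsum F x = (\<Sum>\<phi>\<in>(\<lambda>w. F \<circ> fst w) ` W I. of_nat (card {w \<in> W I. F \<circ> fst w = \<phi>}) * \<phi> x)" for F :: "(nat \<Rightarrow> int) \<Rightarrow> 'a" and x
  proof -
    have "orbsum F x = (\<Sum>\<phi>\<in>(\<lambda>w. F \<circ> fst w) ` W I. \<Sum>w\<in>{w \<in> W I. F \<circ> fst w = \<phi>}. (F \<circ> fst w) x)"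
      unfolding orbsum_def using sum.image_gen[OF finI, of "\<lambda>w. (F \<circ> fst w) x" "\<lambda>w. F \<circ> fst w"] by simp
    also have "\<dots> = (\<Sum>\<phi>\<in>(\<lambda>w. F \<circ> fst w) ` W I. of_nat (card {w \<in> W I. F \<circ> fst w = \<phi>}) * \<phi> x)"
    proof (intro sum.cong refl)
      fix \<phi>
      have "(\<Sum>w\<in>{w \<in> W I. F \<circ> fst w = \<phi>}. (F \<circ> fst w) x) = (\<Sum>w\<in>{w \<in> W I. F \<circ> fst w = \<phi>}. \<phi> x)"
      proof (rule sum.cong[OF refl])
        fix w assume "w \<in> {w \<in> W I. F \<circ> fst w = \<phi>}"
        then have "F \<circ> fst w = \<phi>" by blast
        then show "(F \<circ> fst w) x = \<phi> x" by (rule fun_cong)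
      qed
      then show "(\<Sum>w\<in>{w \<in> W I. F \<circ> fst w = \<phi>}. (F \<circ> fst w) x) = of_nat (card {w \<in> W I. F \<circ> fst w = \<phi>}) * \<phi> x"
        by simp
    qed
    finally show ?thesis .
  qed
  define c where "c \<phi> = (if \<phi> \<in> ?SF then cF \<phi> else - cG \<phi>)" for \<phi>
  have "\<forall>\<phi>\<in>?SF \<union> ?SG. c \<phi> = 0"
  proof (rule characters_independent[where p = "\<lambda>a b. (\<lambda>j. a j + b j)"])
    show "finite (?SF \<union> ?SG)" using finI by simp
    show "\<phi> (\<lambda>j. x j + y j) = \<phi> x * \<phi> y" if "\<phi> \<in> ?SF \<union> ?SG" for \<phi> x y
    proof -
      obtain w where w: "w \<in> W I" "\<phi> = F \<circ> fst w \<or> \<phi> = G \<circ> fst w"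
        using \<open>\<phi> \<in> ?SF \<union> ?SG\<close> by blast
      then show ?thesis using F G by (auto simp: WX_add[OF w(1)])
    qed
    show "\<exists>x. \<phi> x \<noteq> 0" if "\<phi> \<in> ?SF \<union> ?SG" for \<phi>
    proof -
      obtain w where w: "w \<in> W I" "\<phi> = F \<circ> fst w \<or> \<phi> = G \<circ> fst w"
        using \<open>\<phi> \<in> ?SF \<union> ?SG\<close> by blast
      then show ?thesis using nz by (intro exI[of _ "\<lambda>_. 0"]) (auto simp: WX_zero[OF w(1)])
    qed
    show "(\<Sum>\<phi>\<in>?SF \<union> ?SG. c \<phi> * \<phi> x) = 0" for x
    proof -
      have "(\<Sum>\<phi>\<in>?SF \<union> ?SG. c \<phi> * \<phi> x) = (\<Sum>\<phi>\<in>?SF. c \<phi> * \<phi> x) + (\<Sum>\<phi>\<in>?SG. c \<phi> * \<phi> x)"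
        using finI disj by (intro sum.union_disjoint) auto
      moreover have "(\<Sum>\<phi>\<in>?SF. c \<phi> * \<phi> x) = orbsum F x"
        unfolding sumF by (intro sum.cong refl) (auto simp: c_def cF_def)
      moreover have "(\<Sum>\<phi>\<in>?SG. c \<phi> * \<phi> x) = - orbsum G x"
        unfolding sumF sum_negf[symmetric]
      proof (intro sum.cong refl)
        fix \<phi> assume "\<phi> \<in> ?SG"
        then have "\<phi> \<notin> ?SF" using disj by blast
        then show "c \<phi> * \<phi> x = - (of_nat (card {w \<in> W I. G \<circ> fst w = \<phi>}) * \<phi> x)"
          by (simp add: c_def cG_def)
      qed
      ultimately show ?thesis using eq by simp
    qed
  qed
  moreover have F: "F \<in> ?SF" by (rule image_eqI[OF _ W_id]) simp
  ultimately have "c F = 0" by blast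
  then have "cF F = 0" using F unfolding c_def by argo
  then have "{w \<in> W I. F \<circ> fst w = F} = {}" using finI by (simp add: cF_def)
  then show False using W_id[of I] by auto
qed

end

section \<open>Puiseux series\<close>

notation fls_nth (infixl "$$" 75)

definition grid :: "nat \<Rightarrow> (rat \<Rightarrow> complex) \<Rightarrow> bool" where
  "grid d f \<longleftrightarrow> (\<exists>N. \<forall>q. f q \<noteq> 0 \<longrightarrow> N \<le> q \<and> (\<exists>k::int. q = of_int k / of_nat d))"

lemma puiseux_grid: "f \<in> puiseux \<longleftrightarrow> (\<exists>d>0. grid d f)"
  by (auto simp: puiseux_def grid_def)

lemma grid_mult: assumes "grid d f" "e > 0" shows "grid (d * e) f"
proof -
  obtain N where N: "\<And>q. f q \<noteq> 0 \<Longrightarrow> N \<le> q \<and> (\<exists>k::int. q = of_int k / of_nat d)"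
    using assms(1) unfolding grid_def by blast
  have "\<exists>k::int. q = of_int k / of_nat (d * e)" if q: "f q \<noteq> 0" for q
  proof -
    obtain k :: int where "q = of_int k / of_nat d" using N[OF q] by blast
    then have "q = of_int (k * int e) / of_nat (d * e)" using assms(2) by simp
    then show ?thesis by blast
  qed
  then show ?thesis unfolding grid_def using N by blast
qed

text \<open>Substitution of a \<open>d\<close>-th root of epsilon into a Laurent series. It is
  injective and respects the operations, so computations can be carried out in a genuine
  field.\<close>

definition pu :: "nat \<Rightarrow> complex fls \<Rightarrow> rat \<Rightarrow> complex" where
  "pu d F q = (if \<exists>k::int. q = of_int k / of_nat d then F $$ \<lfloor>q * of_nat d\<rfloor> else 0)"

lemma pu_nth: "d > 0 \<Longrightarrow> pu d F (of_int k / of_nat d) = F $$ k"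
  by (auto simp: pu_def)

lemma pu_off: "(\<And>k::int. q \<noteq> of_int k / of_nat d) \<Longrightarrow> pu d F q = 0"
  by (simp add: pu_def)

lemma pu_support: "pu d F q \<noteq> 0 \<Longrightarrow> \<exists>k::int. q = of_int k / of_nat d"
  unfolding pu_def by argo

lemma pu_inj: assumes "d > 0" "pu d F = pu d G" shows "F = G"
  using fun_cong[OF assms(2), of "of_int k / of_nat d" for k] by (simp add: pu_nth[OF assms(1)] fls_eq_iff)

lemma pu_eqI:
  assumes "d > 0" "\<And>k. f (of_int k / of_nat d) = F $$ k" "\<And>q. (\<And>k::int. q \<noteq> of_int k / of_nat d) \<Longrightarrow> f q = 0"
  shows "f = pu d F"
proof
  fix q show "f q = pu d F q"
    using assms(2) assms(3)[of q] pu_off[of q d F] pu_nth[OF assms(1), of F]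
    by (cases "\<exists>k::int. q = of_int k / of_nat d") auto
qed

lemma grid_pu: assumes "grid d f" "d > 0" shows "\<exists>F. f = pu d F"
proof -
  obtain N where N: "\<And>q. f q \<noteq> 0 \<Longrightarrow> N \<le> q \<and> (\<exists>k::int. q = of_int k / of_nat d)"
    using assms(1) unfolding grid_def by blast
  let ?F = "Abs_fls (\<lambda>k. f (of_int k / of_nat d))"
  have nth: "?F $$ k = f (of_int k / of_nat d)" for k
  proof (rule nth_Abs_fls_ex_lower_bound, intro exI allI impI)
    fix m assume m: "m < \<lfloor>N * of_nat d\<rfloor>"
    show "f (of_int m / of_nat d) = 0"
    proof (rule ccontr)
      assume "f (of_int m / of_nat d) \<noteq> 0"
      then have "N \<le> of_int m / of_nat d" using N by blast
      then have "N * of_nat d \<le> of_int m" using assms(2) by (simp add: field_simps)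
      then show False using m by linarith
    qed
  qed
  have "f = pu d ?F" by (rule pu_eqI[OF assms(2)]) (use nth N in auto)
  then show ?thesis by blast
qed

lemma pu_zero: "pu d 0 = p_zero" by (auto simp: pu_def p_zero_def)

lemma pu_one: "d > 0 \<Longrightarrow> pu d 1 = p_one"
proof (rule pu_eqI[symmetric])
  show "p_one q = 0" if "\<And>k::int. q \<noteq> of_int k / of_nat d" for q
    using that[of 0] by (simp add: p_one_def)
qed (auto simp: p_one_def)

lemma pu_sub: "p_sub (pu d F) (pu d G) = pu d (F - G)"
  by (auto simp: p_sub_def pu_def)

lemma pu_sum: "p_sum S (\<lambda>x. pu d (F x)) = pu d (\<Sum>x\<in>S. F x)"
  by (auto simp: p_sum_def pu_def fls_nth_sum)

lemma pu_mult: assumes d: "d > 0" shows "p_mult (pu d F) (pu d G) = pu d (F * G)"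
proof (rule pu_eqI[OF d])
  fix k :: int
  let ?c = "\<lambda>i::int. (of_int i / of_nat d :: rat)"
  have sub: "?c k - ?c i = ?c (k - i)" for i by (simp add: diff_divide_distrib)
  have inj: "inj_on ?c A" for A using d by (auto simp: inj_on_def)
  let ?T = "{i. F $$ i \<noteq> 0 \<and> G $$ (k - i) \<noteq> 0}"
  have set: "{r. pu d F r \<noteq> 0 \<and> pu d G (?c k - r) \<noteq> 0} = ?c ` ?T"
  proof (intro equalityI subsetI)
    fix r assume r: "r \<in> {r. pu d F r \<noteq> 0 \<and> pu d G (?c k - r) \<noteq> 0}"
    then obtain i where i: "r = ?c i" using pu_support by blast
    then show "r \<in> ?c ` ?T" using r unfolding i sub mem_Collect_eq pu_nth[OF d] by blast
  next
    fix r assume "r \<in> ?c ` ?T"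
    then show "r \<in> {r. pu d F r \<noteq> 0 \<and> pu d G (?c k - r) \<noteq> 0}"
      by (auto simp: sub pu_nth[OF d] simp del: of_int_diff)
  qed
  have "p_mult (pu d F) (pu d G) (?c k) = (\<Sum>i\<in>?T. F $$ i * G $$ (k - i))"
    unfolding p_mult_def set sum.reindex[OF inj] by (simp only: o_def sub pu_nth[OF d])
  also have "\<dots> = (\<Sum>i=fls_subdegree F..k - fls_subdegree G. F $$ i * G $$ (k - i))"
  proof (rule sum.mono_neutral_left)
    show "?T \<subseteq> {fls_subdegree F..k - fls_subdegree G}"
    proof
      fix i assume "i \<in> ?T"
      then have "fls_subdegree F \<le> i" "fls_subdegree G \<le> k - i" by (auto intro: fls_subdegree_leI)
      then show "i \<in> {fls_subdegree F..k - fls_subdegree G}" by simp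
    qed
  qed auto
  also have "\<dots> = (F * G) $$ k" by (simp only: fls_times_nth(2))
  finally show "p_mult (pu d F) (pu d G) (?c k) = (F * G) $$ k" .
next
  fix q :: rat assume q: "\<And>k::int. q \<noteq> of_int k / of_nat d"
  have "{r. pu d F r \<noteq> 0 \<and> pu d G (q - r) \<noteq> 0} = {}"
  proof (rule ccontr)
    assume "{r. pu d F r \<noteq> 0 \<and> pu d G (q - r) \<noteq> 0} \<noteq> {}"
    then obtain r where r: "pu d F r \<noteq> 0" "pu d G (q - r) \<noteq> 0" by blast
    obtain i j :: int where "r = of_int i / of_nat d" "q - r = of_int j / of_nat d"
      using pu_support[OF r(1)] pu_support[OF r(2)] by blast
    then have "q = of_int (i + j) / of_nat d" by (simp add: add_divide_distrib algebra_simps)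
    then show False using q by blast
  qed
  then show "p_mult (pu d F) (pu d G) q = 0" by (simp only: p_mult_def sum.empty)
qed

lemma p_val_eq:
  assumes "f m \<noteq> 0" "\<And>q. f q \<noteq> 0 \<Longrightarrow> m \<le> q"
  shows "p_val f = Some (- of_rat m)"
proof -
  have "(THE m. f m \<noteq> 0 \<and> (\<forall>q. f q \<noteq> 0 \<longrightarrow> m \<le> q)) = m"
    by (rule the_equality) (use assms in \<open>auto intro: antisym\<close>)
  moreover have "f \<noteq> p_zero" using assms(1) by (auto simp: p_zero_def)
  ultimately show ?thesis by (simp add: p_val_def)
qed

lemma p_val_pu: assumes d: "d > 0" and F: "F \<noteq> 0"
  shows "p_val (pu d F) = Some (- of_int (fls_subdegree F) / of_nat d)"
proof -
  have "p_val (pu d F) = Some (- of_rat (of_int (fls_subdegree F) / of_nat d))"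
  proof (rule p_val_eq)
    show "pu d F (of_int (fls_subdegree F) / of_nat d) \<noteq> 0" using F by (simp add: pu_nth[OF d])
    fix q assume q: "pu d F q \<noteq> 0"
    then obtain k :: int where k: "q = of_int k / of_nat d" using pu_support[OF q] by blast
    then have "fls_subdegree F \<le> k" using q by (auto simp: pu_nth[OF d] intro: fls_subdegree_leI)
    then show "of_int (fls_subdegree F) / of_nat d \<le> q" unfolding k by (simp add: divide_right_mono)
  qed
  then show ?thesis by (simp add: of_rat_divide)
qed

lemma common_grid:
  assumes "\<And>x. x \<in> S \<Longrightarrow> f x \<in> puiseux" "finite S"
  shows "\<exists>d>0. \<forall>x\<in>S. grid d (f x)"
  using assms(2,1)
proof (induction rule: finite_induct)
  case (insert x S)
  obtain d where d: "d > 0" "\<forall>y\<in>S. grid d (f y)" using insert by blast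
  obtain e where e: "e > 0" "grid e (f x)" using insert(4)[of x] by (auto simp: puiseux_grid)
  have "\<forall>y\<in>insert x S. grid (d * e) (f y)"
    using grid_mult[of d _ e] grid_mult[of e _ d] d e by (auto simp: mult.commute)
  then show ?case using d e by (intro exI[of _ "d * e"]) auto
qed (auto intro: exI[of _ 1])

text \<open>The factor \<open>e\<close> lets two torus points share one denominator.\<close>
lemma torus_pt_fls:
  assumes chi: "torus_pt n chi"
  obtains d where "d > 0" "\<And>e. e > 0 \<Longrightarrow> \<exists>u. (\<forall>j<n. u j \<noteq> 0) \<and> (\<forall>lam\<in>charlat n. chi lam = pu (d * e) (mono_char n u lam))"
proof -
  have pui: "\<And>a. a \<in> charlat n \<Longrightarrow> chi a \<in> puiseux" and zero: "chi (\<lambda>_. 0) = p_one"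
    and mult: "\<And>a b. a \<in> charlat n \<Longrightarrow> b \<in> charlat n \<Longrightarrow> chi (\<lambda>j. a j + b j) = p_mult (chi a) (chi b)"
    using chi unfolding torus_pt_def by blast+
  \<comment> \<open>Negatives of the basis vectors are included so that the induction over the
    lattice can also subtract: values there are inverses already given as Puiseux series.\<close>
  let ?S = "unitvec ` {..<n} \<union> (\<lambda>j i. - unitvec j i) ` {..<n}"
  have S: "a \<in> charlat n" if "a \<in> ?S" for a using that by (auto simp: charlat_def unitvec_def)
  obtain d where d: "d > 0" "\<forall>a\<in>?S. grid d (chi a)"
    using common_grid[of ?S chi] pui S by blast
  show ?thesis
  proof (rule that[OF d(1)])
    fix e :: nat assume e: "e > 0"
    define D where "D = d * e"
    have D: "D > 0" using d e by (simp add: D_def)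
    have gen: "\<exists>F. chi a = pu D F" if "a \<in> ?S" for a
      using grid_pu[OF _ D] grid_mult[OF _ e] d(2) that by (auto simp: D_def)
    have "\<exists>F. chi a = pu D F" if "a \<in> charlat n" for a
      using that
    proof (induction rule: charlat_induct)
      case zero
      then show ?case using \<open>chi (\<lambda>_. 0) = p_one\<close> pu_one[OF D] by metis
    next
      case (add a j)
      then obtain F G where "chi a = pu D F" "chi (unitvec j) = pu D G" using gen by blast
      then show ?case using mult[OF add(1) unitvec_char[OF add(2)]] pu_mult[OF D] by metis
    next
      case (sub a j)
      then obtain F G where "chi a = pu D F" "chi (\<lambda>i. - unitvec j i) = pu D G" using gen by blast
      moreover have "(\<lambda>i. - unitvec j i) \<in> charlat n" using S sub(2) by blast
      ultimately have "chi (\<lambda>i. a i + - unitvec j i) = pu D (F * G)"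
        using mult[OF sub(1)] pu_mult[OF D] by metis
      then show ?case by auto
    qed
    then obtain F where F: "\<And>a. a \<in> charlat n \<Longrightarrow> chi a = pu D (F a)" by metis
    have add: "F (\<lambda>j. a j + b j) = F a * F b" if ab: "a \<in> charlat n" "b \<in> charlat n" for a b
    proof (rule pu_inj[OF D])
      have "(\<lambda>j. a j + b j) \<in> charlat n" using ab by (auto simp: charlat_def)
      then show "pu D (F (\<lambda>j. a j + b j)) = pu D (F a * F b)"
        using mult[OF ab] F ab by (simp add: pu_mult[OF D])
    qed
    have F0: "F (\<lambda>_. 0) = 1"
    proof (rule pu_inj[OF D])
      have "(\<lambda>_. 0) \<in> charlat n" by (simp add: charlat_def)
      then show "pu D (F (\<lambda>_. 0)) = pu D 1" using F zero by (simp add: pu_one[OF D])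
    qed
    show "\<exists>u. (\<forall>j<n. u j \<noteq> 0) \<and> (\<forall>lam\<in>charlat n. chi lam = pu (d * e) (mono_char n u lam))"
    proof (intro exI conjI allI impI ballI)
      show "F (unitvec j) \<noteq> 0" if "j < n" for j
        using charlat_char_eq(2)[of n F "unitvec j"] add F0 unitvec_char[OF that] by blast
      show "chi a = pu (d * e) (mono_char n (\<lambda>j. F (unitvec j)) a)" if "a \<in> charlat n" for a
      proof -
        have "F a = mono_char n (\<lambda>j. F (unitvec j)) a"
          using charlat_char_eq(1)[of n F a] add F0 that by blast
        then show ?thesis using F[OF that] unfolding D_def by (rule subst)
      qed
    qed
  qed
qed

lemma fls_lead_mult:
  fixes F G :: "'a::field fls"
  assumes "F \<noteq> 0" "G \<noteq> 0"
  shows "(F * G) $$ fls_subdegree (F * G) = F $$ fls_subdegree F * G $$ fls_subdegree G"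
  using assms by (simp add: fls_times_nth(2))

text \<open>Cancellation of the leading term happens only when \<open>F\<close> starts with the
  constant 1; all other cases attain the lower bound.\<close>

lemma fls_subdegree_one_minus:
  fixes F :: "complex fls"
  assumes "F \<noteq> 0" "1 - F \<noteq> 0"
  shows "fls_subdegree (1 - F) \<ge> min 0 (fls_subdegree F)"
    and "fls_subdegree (1 - F) = min 0 (fls_subdegree F) \<longleftrightarrow> fls_subdegree F \<noteq> 0 \<or> F $$ 0 \<noteq> 1"
proof -
  show ge: "fls_subdegree (1 - F) \<ge> min 0 (fls_subdegree F)"
    by (rule fls_subdegree_geI[OF assms(2)]) simp
  consider "fls_subdegree F < 0" | "fls_subdegree F = 0" | "fls_subdegree F > 0" by linarith
  then show "fls_subdegree (1 - F) = min 0 (fls_subdegree F) \<longleftrightarrow> fls_subdegree F \<noteq> 0 \<or> F $$ 0 \<noteq> 1"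
  proof cases
    case 1
    then have "fls_subdegree (1 - F) \<le> fls_subdegree F" using assms by (intro fls_subdegree_leI) simp
    then show ?thesis using 1 ge by simp
  next
    case 2
    have "fls_subdegree (1 - F) = 0 \<longleftrightarrow> F $$ 0 \<noteq> 1"
    proof
      assume "fls_subdegree (1 - F) = 0"
      then have "(1 - F) $$ 0 \<noteq> 0" using nth_fls_subdegree_nonzero[OF assms(2)] by simp
      then show "F $$ 0 \<noteq> 1" by simp
    next
      assume "F $$ 0 \<noteq> 1"
      then have "fls_subdegree (1 - F) \<le> 0" by (intro fls_subdegree_leI) simp
      then show "fls_subdegree (1 - F) = 0" using ge 2 by simp
    qed
    then show ?thesis using 2 by simp
  next
    case 3
    then have "fls_subdegree (1 - F) \<le> 0" by (intro fls_subdegree_leI) simp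
    then show ?thesis using 3 ge by simp
  qed
qed

section \<open>The fibres of the quotient map and the valuation of Omega\<close>

context weyl
begin

text \<open>With a common denominator both points become characters with values in one field of
  Laurent series; equal coordinates give equal orbit sums, and orbit separation applies.\<close>

lemma cmap_separates:
  assumes chi: "torus_pt n chi" and chi': "torus_pt n chi'" and eq: "cmap n l al chi = cmap n l al chi'"
  shows "\<exists>v\<in>W I. \<forall>lam\<in>charlat n. chi lam = chi' (fst v lam)"
proof -
  obtain d where d: "d > 0" "\<And>e. e > 0 \<Longrightarrow> \<exists>u. (\<forall>j<n. u j \<noteq> 0) \<and> (\<forall>lam\<in>charlat n. chi lam = pu (d * e) (mono_char n u lam))"
    using torus_pt_fls[OF chi] by blast
  obtain d' where d': "d' > 0" "\<And>e. e > 0 \<Longrightarrow> \<exists>u. (\<forall>j<n. u j \<noteq> 0) \<and> (\<forall>lam\<in>charlat n. chi' lam = pu (d' * e) (mono_char n u lam))"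
    using torus_pt_fls[OF chi'] by blast
  define D where "D = d * d'"
  have D: "D > 0" using d d' by (simp add: D_def)
  obtain u where u: "\<And>j. j < n \<Longrightarrow> u j \<noteq> 0" "\<And>lam. lam \<in> charlat n \<Longrightarrow> chi lam = pu D (mono_char n u lam)"
    using d(2)[OF d'(1)] unfolding D_def by blast
  obtain u' where u': "\<And>j. j < n \<Longrightarrow> u' j \<noteq> 0" "\<And>lam. lam \<in> charlat n \<Longrightarrow> chi' lam = pu D (mono_char n u' lam)"
    using d'(2)[OF d(1)] unfolding D_def mult.commute[of d d'] by blast
  let ?F = "mono_char n u" and ?G = "mono_char n u'"
  have orb: "orbit n l al i \<subseteq> charlat n" if "i < n" for i
    unfolding orbit_def using WX_char unitvec_char[OF that] by blast
  have sumeq: "(\<Sum>mu\<in>orbit n l al i. ?F mu) = (\<Sum>mu\<in>orbit n l al i. ?G mu)" if i: "i < n" for i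
  proof (rule pu_inj[OF D])
    have "pu D (\<Sum>mu\<in>orbit n l al i. ?F mu) = p_sum (orbit n l al i) (\<lambda>x. pu D (?F x))" by (simp add: pu_sum)
    also have "\<dots> = p_sum (orbit n l al i) chi"
      unfolding p_sum_def using orb[OF i] u(2) by (intro ext sum.cong) auto
    also have "\<dots> = p_sum (orbit n l al i) chi'"
      using fun_cong[OF eq, of i] i by (simp add: cmap_def)
    also have "\<dots> = p_sum (orbit n l al i) (\<lambda>x. pu D (?G x))"
      unfolding p_sum_def using orb[OF i] u'(2) by (intro ext sum.cong) auto
    also have "\<dots> = pu D (\<Sum>mu\<in>orbit n l al i. ?G mu)" by (simp add: pu_sum)
    finally show "pu D (\<Sum>mu\<in>orbit n l al i. ?F mu) = pu D (\<Sum>mu\<in>orbit n l al i. ?G mu)" .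
  qed
  \<comment> \<open>Basis characters beyond \<open>l\<close> are fixed by the Weyl group, so their
    orbit sums have one term and give the values directly.\<close>
  have central: "u j = u' j" if j: "l \<le> j" "j < n" for j
  proof -
    have c: "fst w (unitvec j) = unitvec j" if "w \<in> W I" for w
      using WX_central[OF that, of "unitvec j"] j by (simp add: unitvec_def)
    have "orbit n l al j = (\<lambda>w. fst w (unitvec j)) ` W I" unfolding orbit_def by blast
    also have "\<dots> = (\<lambda>w. unitvec j) ` W I" using c by (rule image_cong[OF refl])
    also have "\<dots> = {unitvec j}" using W_nonempty[of I] by blast
    finally have "orbit n l al j = {unitvec j}" .
    then show ?thesis using sumeq[OF j(2)] j by (simp add: mono_char_unitvec)
  qed
  have "\<exists>v\<in>W I. ?F = ?G \<circ> fst v"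
  proof (rule orbit_separation)
    show F: "?F (\<lambda>j. a j + b j) = ?F a * ?F b" for a b by (rule mono_char_add) (rule u(1))
    show G: "?G (\<lambda>j. a j + b j) = ?G a * ?G b" for a b by (rule mono_char_add) (rule u'(1))
    show "orbsum ?F lam = orbsum ?G lam" for lam
    proof (rule orbsum_determined[OF F G])
      fix a :: "nat \<Rightarrow> int" assume a: "\<And>i. i < l \<Longrightarrow> a i = 0"
      show "?F a = ?G a"
        unfolding mono_char_def
      proof (intro prod.cong refl)
        fix j assume "j \<in> {..<n}"
        then show "u j powi a j = u' j powi a j" using a[of j] central[of j] by (cases "j < l") auto
      qed
    next
      fix i assume "i < l"
      then show "orbsum ?F (unitvec i) = orbsum ?G (unitvec i)"
        using sumeq[of i] l_le_n by (simp add: orbsum_orbit)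
    qed
  qed (simp_all add: mono_char_zero)
  then obtain v where v: "v \<in> W I" "?F = ?G \<circ> fst v" by blast
  have "chi lam = chi' (fst v lam)" if "lam \<in> charlat n" for lam
    using u(2)[OF that] u'(2)[OF WX_char[OF v(1) that]] v(2) by simp
  then show ?thesis using v(1) by blast
qed

lemma roots_char: "a \<in> rootsJ n l al J \<Longrightarrow> a \<in> charlat n"
  using root_rootpair rootpair_char by blast

lemma roots_W: assumes v: "v \<in> W I" shows "bij_betw (fst v) (roots n l al) (roots n l al)"
proof -
  obtain v' where v': "v' \<in> W I" "fst v' \<circ> fst v = id" "fst v \<circ> fst v' = id" using W_inv[OF v] by metis
  have closed: "fst w a \<in> roots n l al" if "w \<in> W I" "a \<in> roots n l al" for w a
    using root_rootpair[OF that(2)] rootpair_W[OF _ that(1)] rootpair_root by blast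
  show ?thesis
    by (rule bij_betw_byWitness[where f' = "fst v'"])
       (use closed[OF v] closed[OF v'(1)] v' in \<open>auto simp: pointfree_idE\<close>)
qed

lemma Omega_pu:
  assumes D: "D > 0" and chi: "\<And>lam. lam \<in> charlat n \<Longrightarrow> chi lam = pu D (F lam)"
  shows "Omega n l al chi = pu D (\<Prod>a\<in>roots n l al. 1 - F a)"
proof -
  \<comment> \<open>\<open>p_mult\<close> is left-commutative on Puiseux series only, so the fold is first transported to a globally
    commuting operation.\<close>
  define rep where "rep p = (SOME P. pu D P = p)" for p
  have rep: "rep (pu D P) = P" for P
    unfolding rep_def by (rule some_equality) (use pu_inj[OF D] in auto)
  define g where "g a p = pu D ((1 - F a) * rep p)" for a p
  interpret g: comp_fun_commute g
    by standard (auto simp: g_def rep fun_eq_iff mult.left_commute)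
  have "Omega n l al chi = Finite_Set.fold g p_one (roots n l al)"
    unfolding Omega_def
  proof (rule fold_closed_eq[where B = "range (pu D)"])
    fix a b assume a: "a \<in> roots n l al" and "b \<in> range (pu D)"
    then obtain P where P: "b = pu D P" by blast
    show "p_mult (p_sub p_one (chi a)) b = g a b"
      unfolding P g_def rep chi[OF roots_char[OF a]] pu_one[OF D, symmetric] pu_sub pu_mult[OF D] ..
    show "g a b \<in> range (pu D)" by (simp add: g_def)
  next
    show "p_one \<in> range (pu D)" using pu_one[OF D] by (metis rangeI)
  qed
  also have "Finite_Set.fold g p_one S = pu D (\<Prod>a\<in>S. 1 - F a)" if "finite S" for S
    using that
  proof (induction rule: finite_induct)
    case (insert x S)
    have "Finite_Set.fold g p_one (insert x S) = g x (Finite_Set.fold g p_one S)"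
      using insert(1,2) by (rule g.fold_insert)
    also have "\<dots> = pu D ((1 - F x) * (\<Prod>a\<in>S. 1 - F a))"
      by (simp only: insert(3) g_def rep)
    finally show ?case by (simp only: prod.insert[OF insert(1,2)])
  qed (simp add: pu_one[OF D])
  from this[OF finite_roots] have "Finite_Set.fold g p_one (roots n l al) = pu D (\<Prod>a\<in>roots n l al. 1 - F a)" .
  finally show ?thesis .
qed

lemma Omega_W:
  assumes chi: "torus_pt n chi" and v: "v \<in> W I" and eq: "\<And>lam. lam \<in> charlat n \<Longrightarrow> chi' lam = chi (fst v lam)"
  shows "Omega n l al chi' = Omega n l al chi"
proof -
  obtain d where d: "d > 0" "\<And>e. e > 0 \<Longrightarrow> \<exists>u. (\<forall>j<n. u j \<noteq> 0) \<and> (\<forall>lam\<in>charlat n. chi lam = pu (d * e) (mono_char n u lam))"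
    using torus_pt_fls[OF chi] by blast
  obtain u where u: "\<And>lam. lam \<in> charlat n \<Longrightarrow> chi lam = pu d (mono_char n u lam)"
    using d(2)[of 1] by auto
  have 1: "chi' lam = pu d (mono_char n u (fst v lam))" if "lam \<in> charlat n" for lam
    using eq[OF that] u[OF WX_char[OF v that]] by simp
  have "(\<Prod>a\<in>roots n l al. 1 - mono_char n u (fst v a)) = (\<Prod>a\<in>roots n l al. 1 - mono_char n u a)"
    using prod.reindex_bij_betw[OF roots_W[OF v], of "\<lambda>a. 1 - mono_char n u a"] .
  then show ?thesis using Omega_pu[OF d(1) 1] Omega_pu[OF d(1) u] by simp
qed

text \<open>Every factor obeys a one-sided bound and the bounds add up to \<open>m_nu\<close>, so
  equality of the totals holds exactly when every factor attains its bound.\<close>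

lemma Omega_val:
  assumes D: "D > 0" and chi: "\<And>lam. lam \<in> charlat n \<Longrightarrow> chi lam = pu D (F lam)"
    and F: "\<And>lam. lam \<in> charlat n \<Longrightarrow> F lam \<noteq> 0"
    and val: "\<And>lam. lam \<in> charlat n \<Longrightarrow> p_val (chi lam) = Some (pr lam nu)"
  shows "p_val (Omega n l al chi) = Some (m_nu n l al nu) \<longleftrightarrow>
    (\<forall>a\<in>roots n l al. pr a nu = 0 \<longrightarrow> chi a 0 \<noteq> 1)"
proof -
  let ?R = "roots n l al"
  have nu: "pr a nu = - of_int (fls_subdegree (F a)) / real D" if "a \<in> ?R" for a
    using val[OF roots_char[OF that]] p_val_pu[OF D F[OF roots_char[OF that]]] chi[OF roots_char[OF that]] by simp
  then have nu0: "pr a nu = 0 \<longleftrightarrow> fls_subdegree (F a) = 0" if "a \<in> ?R" for a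
    using that D by simp
  have c0: "chi a 0 = F a $$ 0" if "a \<in> ?R" for a
    using pu_nth[OF D, of "F a" 0] chi[OF roots_char[OF that]] by simp
  have m: "m_nu n l al nu = - of_int (\<Sum>a\<in>?R. min 0 (fls_subdegree (F a))) / real D"
  proof -
    have "max 0 (pr a nu) = - of_int (min 0 (fls_subdegree (F a))) / real D" if "a \<in> ?R" for a
      unfolding nu[OF that] using D by (auto simp: max_def min_def divide_simps)
    then show ?thesis unfolding m_nu_def by (simp add: sum_negf sum_divide_distrib)
  qed
  show ?thesis
  proof (cases "\<exists>a\<in>?R. 1 - F a = 0")
    \<comment> \<open>Omega is zero here, with valuation \<open>None\<close>, and the root concerned
      violates the right-hand side as well.\<close>
    case True
    then obtain a where a: "a \<in> ?R" "F a = 1" by auto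
    then have "(\<Prod>a\<in>?R. 1 - F a) = 0" using finite_roots by (intro prod_zero) auto
    then have "p_val (Omega n l al chi) = None" using Omega_pu[OF D chi] by (simp add: pu_zero p_val_def)
    moreover have "pr a nu = 0" "chi a 0 = 1" using nu0 c0 a by simp_all
    ultimately show ?thesis using a by auto
  next
    case False
    then have nz: "1 - F a \<noteq> 0" if "a \<in> ?R" for a using that by blast
    have "(\<Prod>a\<in>?R. 1 - F a) \<noteq> 0" using nz finite_roots by simp
    then have "p_val (Omega n l al chi) = Some (- of_int (\<Sum>a\<in>?R. fls_subdegree (1 - F a)) / real D)"
      using Omega_pu[OF D chi] p_val_pu[OF D] fls_subdegree_prod[where I = ?R and F = "\<lambda>a. 1 - F a"] nz by simp
    then have "p_val (Omega n l al chi) = Some (m_nu n l al nu) \<longleftrightarrow>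
      (\<Sum>a\<in>?R. fls_subdegree (1 - F a)) = (\<Sum>a\<in>?R. min 0 (fls_subdegree (F a)))"
      unfolding m using D by (simp del: of_int_sum)
    also have "\<dots> \<longleftrightarrow> (\<forall>a\<in>?R. fls_subdegree (1 - F a) = min 0 (fls_subdegree (F a)))"
    proof
      assume s: "(\<Sum>a\<in>?R. fls_subdegree (1 - F a)) = (\<Sum>a\<in>?R. min 0 (fls_subdegree (F a)))"
      have "(\<Sum>a\<in>?R. fls_subdegree (1 - F a) - min 0 (fls_subdegree (F a))) = 0"
        using s by (simp add: sum_subtractf)
      moreover have "0 \<le> fls_subdegree (1 - F a) - min 0 (fls_subdegree (F a))" if "a \<in> ?R" for a
        using fls_subdegree_one_minus(1)[OF F[OF roots_char[OF that]] nz[OF that]] by simp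
      ultimately have "\<forall>a\<in>?R. fls_subdegree (1 - F a) - min 0 (fls_subdegree (F a)) = 0"
        using sum_nonneg_eq_0_iff[OF finite_roots[of I], of "\<lambda>a. fls_subdegree (1 - F a) - min 0 (fls_subdegree (F a))"] by blast
      then show "\<forall>a\<in>?R. fls_subdegree (1 - F a) = min 0 (fls_subdegree (F a))" by simp
    next
      assume "\<forall>a\<in>?R. fls_subdegree (1 - F a) = min 0 (fls_subdegree (F a))"
      then show "(\<Sum>a\<in>?R. fls_subdegree (1 - F a)) = (\<Sum>a\<in>?R. min 0 (fls_subdegree (F a)))"
        by (intro sum.cong) auto
    qed
    also have "\<dots> \<longleftrightarrow> (\<forall>a\<in>?R. fls_subdegree (F a) \<noteq> 0 \<or> F a $$ 0 \<noteq> 1)"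
      by (intro ball_cong refl fls_subdegree_one_minus(2) F nz roots_char)
    also have "\<dots> \<longleftrightarrow> (\<forall>a\<in>?R. pr a nu = 0 \<longrightarrow> chi a 0 \<noteq> 1)"
      using nu0 c0 by auto
    finally show ?thesis .
  qed
qed

end

section \<open>Points over the Puiseux field\<close>

definition p_mono :: "complex \<Rightarrow> rat \<Rightarrow> rat \<Rightarrow> complex" where
  "p_mono c e = (\<lambda>q. if q = e then c else 0)"

lemma p_mono_mult: assumes "c \<noteq> 0" "c' \<noteq> 0"
  shows "p_mult (p_mono c e) (p_mono c' e') = p_mono (c * c') (e + e')"
proof
  fix q
  have "{r. p_mono c e r \<noteq> 0 \<and> p_mono c' e' (q - r) \<noteq> 0} = (if q = e + e' then {e} else {})"
    using assms by (auto simp: p_mono_def)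
  then show "p_mult (p_mono c e) (p_mono c' e') q = p_mono (c * c') (e + e') q"
    unfolding p_mult_def by (simp add: p_mono_def)
qed

lemma p_mono_puiseux: "p_mono c e \<in> puiseux"
proof -
  obtain a b where ab: "e = Fract a b" "b > 0" by (cases e) auto
  then have "e = of_int a / of_nat (nat b)" by (simp add: Fract_of_int_quotient)
  then have "nat b > 0 \<and> (\<exists>N. \<forall>q. p_mono c e q \<noteq> 0 \<longrightarrow> N \<le> q \<and> (\<exists>k::int. q = of_int k / of_nat (nat b)))"
    using ab(2) by (intro conjI exI[of _ e]) (auto simp: p_mono_def split: if_splits)
  then show ?thesis unfolding puiseux_def by blast
qed

lemma p_mono_val: "c \<noteq> 0 \<Longrightarrow> p_val (p_mono c e) = Some (- of_rat e)"
  by (rule p_val_eq) (auto simp: p_mono_def split: if_splits)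

lemma p_val_sigma: "p_val (p_sigma f) = p_val f"
proof -
  have *: "p_sigma f q \<noteq> 0 \<longleftrightarrow> f q \<noteq> 0" for q by (simp add: p_sigma_def)
  then have "p_sigma f = p_zero \<longleftrightarrow> f = p_zero" unfolding p_zero_def fun_eq_iff by metis
  then show ?thesis unfolding p_val_def * by simp
qed

text \<open>A sufficiently small positive \<open>s\<close> keeps each sum strictly between
  neighbouring integers when \<open>B x\<close> is nonzero, and changes nothing when it is
  zero.\<close>

lemma avoid_integers:
  fixes A B :: "'a \<Rightarrow> real"
  assumes "finite R" "\<And>x. x \<in> R \<Longrightarrow> A x \<notin> \<int> \<or> B x \<noteq> 0"
  shows "\<exists>s. \<forall>x\<in>R. A x + s * B x \<notin> \<int>"
proof -
  have nint: "y \<notin> \<int>" if "of_int k < y" "y < of_int k + 1" for y :: real and k :: int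
    using that by (auto elim!: Ints_cases)
  have "\<exists>d>0. \<forall>s>0. s < d \<longrightarrow> A x + s * B x \<notin> \<int>" if x: "x \<in> R" for x
  proof -
    consider "B x = 0" "A x \<notin> \<int>" | "B x > 0" | "B x < 0" using assms(2)[OF x] by linarith
    then show ?thesis
    proof cases
      case 1
      then show ?thesis by (intro exI[of _ 1]) simp
    next
      case 2
      show ?thesis
      proof (intro exI[of _ "(of_int \<lfloor>A x\<rfloor> + 1 - A x) / B x"] conjI allI impI)
        show "0 < (of_int \<lfloor>A x\<rfloor> + 1 - A x) / B x" using 2 by (intro divide_pos_pos) linarith+
        fix s :: real assume s: "s > 0" "s < (of_int \<lfloor>A x\<rfloor> + 1 - A x) / B x"
        have "s * B x < of_int \<lfloor>A x\<rfloor> + 1 - A x" using s(2) 2 by (simp add: pos_less_divide_eq)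
        moreover have "0 < s * B x" using s 2 by simp
        ultimately show "A x + s * B x \<notin> \<int>" by (intro nint[of "\<lfloor>A x\<rfloor>"]) linarith+
      qed
    next
      case 3
      show ?thesis
      proof (intro exI[of _ "(A x - of_int \<lceil>A x\<rceil> + 1) / - B x"] conjI allI impI)
        show "0 < (A x - of_int \<lceil>A x\<rceil> + 1) / - B x" using 3 by (intro divide_pos_pos) linarith+
        fix s :: real assume s: "s > 0" "s < (A x - of_int \<lceil>A x\<rceil> + 1) / - B x"
        have "s * - B x < A x - of_int \<lceil>A x\<rceil> + 1" using s(2) 3 by (subst pos_less_divide_eq[symmetric]) auto
        moreover have "0 < s * - B x" using s 3 by (intro mult_pos_pos) auto
        ultimately show "A x + s * B x \<notin> \<int>" by (intro nint[of "\<lceil>A x\<rceil> - 1"]) (simp; linarith)+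
      qed
    qed
  qed
  then obtain d where d: "\<And>x. x \<in> R \<Longrightarrow> d x > 0 \<and> (\<forall>s>0. s < d x \<longrightarrow> A x + s * B x \<notin> \<int>)" by metis
  \<comment> \<open>Inserting 1 covers an empty \<open>R\<close>; halving the minimum below gives a
    value strictly under every threshold.\<close>
  define m where "m = Min (insert 1 (d ` R))"
  have m: "0 < m" "\<And>x. x \<in> R \<Longrightarrow> m \<le> d x" using assms(1) d by (auto simp: m_def)
  show ?thesis
  proof (intro exI[of _ "m / 2"] ballI)
    fix x assume x: "x \<in> R"
    have "0 < m / 2" "m / 2 < d x" using m(1) m(2)[OF x] by simp_all
    then show "A x + m / 2 * B x \<notin> \<int>" using d[OF x] by blast
  qed
qed

text \<open>Argument and log-modulus on the basis vectors define the two real vectors; together they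
  form the complex exponent of the character.\<close>

lemma char_polar:
  fixes t :: "(nat \<Rightarrow> int) \<Rightarrow> complex"
  assumes hom: "\<And>a b. a \<in> charlat n \<Longrightarrow> b \<in> charlat n \<Longrightarrow> t (\<lambda>j. a j + b j) = t a * t b"
    and one: "t (\<lambda>_. 0) = 1"
  obtains a b where "\<And>j. j \<ge> n \<Longrightarrow> a j = 0" "\<And>j. j \<ge> n \<Longrightarrow> b j = 0"
    "\<And>lam. lam \<in> charlat n \<Longrightarrow> t lam = of_real (exp (pair n lam b)) * cis (2 * pi * pair n lam a)"
proof -
  define a where "a j = (if j < n then Arg (t (unitvec j)) / (2 * pi) else 0)" for j
  define b where "b j = (if j < n then ln (cmod (t (unitvec j))) else 0)" for j
  define f where "f lam = complex_of_real (exp (pair n lam b)) * cis (2 * pi * pair n lam a)" for lam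
  have f_hom: "f (\<lambda>j. x j + y j) = f x * f y" for x y
    by (simp add: f_def pair_add_left exp_add distrib_left cis_mult[symmetric])
  have f1: "f (\<lambda>_. 0) = 1" by (simp add: f_def pair_def)
  have fu: "f (unitvec j) = t (unitvec j)" if j: "j < n" for j
  proof -
    have nz: "t (unitvec j) \<noteq> 0" using charlat_char_eq(2)[of n t "unitvec j"] hom one unitvec_char[OF j] by blast
    have "f (unitvec j) = rcis (cmod (t (unitvec j))) (Arg (t (unitvec j)))"
      using nz j by (simp add: f_def pair_unitvec a_def b_def rcis_def)
    then show ?thesis by (simp only: rcis_cmod_Arg)
  qed
  have "t lam = f lam" if lam: "lam \<in> charlat n" for lam
  proof -
    have "t lam = mono_char n (\<lambda>j. t (unitvec j)) lam" using charlat_char_eq(1)[of n t lam] hom one lam by blast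
    also have "\<dots> = mono_char n (\<lambda>j. f (unitvec j)) lam" using fu by (simp add: mono_char_def)
    also have "\<dots> = f lam" using charlat_char_eq(1)[of n f lam] f_hom f1 lam by metis
    finally show ?thesis .
  qed
  then show ?thesis using that[of a b] by (simp add: a_def b_def f_def)
qed

lemma cis_eq_iff_Ints: "cis (2 * pi * x) = cis (2 * pi * y) \<longleftrightarrow> x - y \<in> \<int>"
proof -
  have "cis (2 * pi * x) = cis (2 * pi * y) \<longleftrightarrow> (\<exists>k::int. 2 * pi * x = 2 * pi * y + 2 * pi * k)"
    by (subst sin_cos_eq_iff[symmetric]) (auto simp: cis.ctr complex_eq_iff)
  also have "\<dots> \<longleftrightarrow> (\<exists>k::int. x = y + k)"
    by (simp only: distrib_left[symmetric] mult_cancel_left) simp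
  also have "\<dots> \<longleftrightarrow> x - y \<in> \<int>" by (auto elim!: Ints_cases simp: algebra_simps)
  finally show ?thesis .
qed

section \<open>Existence of points and the conjugacy class of their Galois action\<close>

context weyl
begin

lemma pM_idem: "pM n l al J (pM n l al J x) = pM n l al J x"
proof
  fix j
  let ?y = "pM n l al J x"
  have "(\<Sum>w\<in>W J. snd w ?y j) = (\<Sum>w\<in>W J. ?y j)"
    by (rule sum.cong[OF refl]) (simp only: W_pM)
  also have "\<dots> = real (card (W J)) * ?y j" by (rule sum_constant)
  finally have e: "(\<Sum>w\<in>W J. snd w ?y j) = real (card (W J)) * ?y j" .
  have "real (card (W J)) \<noteq> 0" using finW[of J] W_nonempty[of J] by simp
  then show "pM n l al J ?y j = ?y j" unfolding pM_def[of n l al J ?y] e by (rule nonzero_mult_div_cancel_left)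
qed

text \<open>Needed so that the coordinates of \<open>nu\<close> can serve as exponents of
  epsilon.\<close>

lemma pM_Rats: "pM n l al J (rv k) j \<in> \<rat>"
proof -
  have "snd w (rv k) j \<in> \<rat>" if w: "w \<in> W J" for w
  proof -
    obtain k' where "snd w (rv k) = rv k'" using Wa_int[OF w] by blast
    then show ?thesis by simp
  qed
  then show ?thesis unfolding pM_def by (intro Rats_divide Rats_sum) auto
qed

lemma torus_Omega_val:
  assumes chi: "torus_pt n chi" and val: "\<And>lam. lam \<in> charlat n \<Longrightarrow> p_val (chi lam) = Some (pr lam nu)"
  shows "p_val (Omega n l al chi) = Some (m_nu n l al nu) \<longleftrightarrow>
    (\<forall>a\<in>roots n l al. pr a nu = 0 \<longrightarrow> chi a 0 \<noteq> 1)"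
proof -
  obtain d where d: "d > 0" "\<And>e. e > 0 \<Longrightarrow> \<exists>u. (\<forall>j<n. u j \<noteq> 0) \<and> (\<forall>lam\<in>charlat n. chi lam = pu (d * e) (mono_char n u lam))"
    using torus_pt_fls[OF chi] by blast
  obtain u where u: "\<And>j. j < n \<Longrightarrow> u j \<noteq> 0" "\<And>lam. lam \<in> charlat n \<Longrightarrow> chi lam = pu d (mono_char n u lam)"
    using d(2)[of 1] by auto
  show ?thesis by (rule Omega_val[OF d(1) u(2) mono_char_nonzero[OF u(1)] val])
qed

lemma X_nu_nonempty:
  assumes J: "J \<subseteq> I" and lam: "lam \<in> charlat n" and nu: "nu = pM n l al J (rv lam)"
    and dom: "\<And>i. i < l \<Longrightarrow> i \<notin> J \<Longrightarrow> 0 < pr (al i) nu"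
  shows "X_nu n l al nu \<noteq> {}"
proof -
  obtain w mu x where w: "w \<in> W J" and mu: "mu \<in> charlat n" "pM n l al J (rv mu) = pM n l al J (rv lam)"
    and x: "x \<in> alcove n l al J" "(\<lambda>j. snd w x j + of_int (mu j)) \<in> alcove n l al J"
    by (rule psiM_exists[OF J lam]) (rule that; assumption)
  note mu = mu(1) mu(2)[folded nu]
  have nu0: "pr \<beta> nu = 0" if "rootpair J \<beta> b" for \<beta> b using pM_rootpair[OF that] by (simp add: nu)
  \<comment> \<open>Subtracting \<open>nu\<close> removes the coordinates outside J and leaves
    values on roots of J unchanged, hence integral: the two conditions for a fixed point in the
    alcove.\<close>
  define m where "m = (\<lambda>j. of_int (mu j) - nu j)"
  have prm: "pr \<beta> m = pr \<beta> (rv mu)" if "rootpair J \<beta> b" for \<beta> b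
    using nu0[OF that] by (simp add: m_def pair_diff)
  have "\<exists>z\<in>alcove n l al J. (\<lambda>j. snd w z j + m j) = z"
  proof (rule alcove_fixed_point[OF J w _ _ x(1)])
    show "pr \<beta> m \<in> \<int>" if "rootpair J \<beta> b" for \<beta> b using prm[OF that] pair_Ints by metis
    show "m j = 0" if "j \<notin> J" for j using pM_support[OF that, of "rv mu"] mu(2) by (simp add: m_def)
    show "(\<lambda>j. snd w x j + m j) \<in> alcove n l al J"
      using x(2) unfolding alcove_iff pair_add by (metis prm)
  qed
  then obtain z where z: "z \<in> alcove n l al J" "(\<lambda>j. snd w z j + m j) = z" by blast
  have "\<exists>r. nu j = of_rat r" for j using pM_Rats[of J lam j] unfolding nu by (auto elim: Rats_cases)
  then obtain r where r: "\<And>j. nu j = of_rat (r j)" by metis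
  define e where "e a = - (\<Sum>j<n. of_int (a j) * r j)" for a :: "nat \<Rightarrow> int"
  have e: "of_rat (e a) = - pr a nu" for a
    by (simp add: e_def pair_def r of_rat_minus of_rat_sum of_rat_mult)
  \<comment> \<open>The exponent is minus the pairing with \<open>nu\<close> because epsilon has
    valuation -1; the phase uses \<open>-z\<close> so that the fixed-point equation becomes the
    Galois equation modulo integers.\<close>
  define chi where "chi a = p_mono (cis (2 * pi * - pr a z)) (e a)" for a
  have torus: "torus_pt n chi"
    unfolding torus_pt_def
  proof (intro conjI ballI)
    show "chi a \<in> puiseux" for a by (simp add: chi_def p_mono_puiseux)
    show "chi (\<lambda>_. 0) = p_one" by (auto simp: chi_def p_mono_def p_one_def e_def pair_def)
    show "chi (\<lambda>j. a j + b j) = p_mult (chi a) (chi b)" for a b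
    proof -
      have "e (\<lambda>j. a j + b j) = e a + e b" by (simp add: e_def distrib_right sum.distrib)
      then show ?thesis unfolding chi_def
        by (subst p_mono_mult) (simp_all add: cis_mult pair_add_left algebra_simps)
    qed
  qed
  have val: "p_val (chi a) = Some (pr a nu)" for a
    unfolding chi_def by (subst p_mono_val) (simp_all add: e)
  have sig: "sigma_eq n chi w"
    unfolding sigma_eq_def
  proof (intro ballI ext)
    fix a q
    have wnu: "pr (fst w a) nu = pr a nu" using W_pair[OF w, of a nu] W_pM[OF w, of "rv lam"] by (simp add: nu)
    have "real_of_rat (e (fst w a)) = of_rat (e a)" using wnu by (simp add: e)
    then have ew: "e (fst w a) = e a" by simp
    have zz: "pr (fst w a) z = pr (fst w a) (\<lambda>j. snd w z j + m j)" using z(2) by simp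
    have "pr (fst w a) z = pr a z + pr (fst w a) m"
      unfolding zz pair_add W_pair[OF w] ..
    also have "pr (fst w a) m = pr (fst w a) (rv mu) - pr a nu"
      by (simp add: m_def pair_diff wnu)
    finally have "- pr a nu + - pr (fst w a) z - - pr a z \<in> \<int>"
      using pair_Ints[of n "fst w a" mu] by (simp add: Ints_minus)
    then have c: "cis (2 * pi * (- pr a nu + - pr (fst w a) z)) = cis (2 * pi * - pr a z)"
      by (simp only: cis_eq_iff_Ints)
    have "exp (2 * of_real pi * \<i> * of_real (of_rat (e a))) = cis (2 * pi * - pr a nu)"
      by (simp add: cis_conv_exp e mult_ac)
    then have "exp (2 * of_real pi * \<i> * of_real (of_rat (e a))) * cis (2 * pi * - pr (fst w a) z) = cis (2 * pi * - pr a z)"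
      using c by (simp only: cis_mult distrib_left)
    then show "p_sigma (chi (fst w a)) q = chi a q"
      by (simp add: p_sigma_def chi_def p_mono_def ew)
  qed
  have "p_val (Omega n l al chi) = Some (m_nu n l al nu)"
    unfolding torus_Omega_val[OF torus val]
  proof (intro ballI impI)
    fix a assume a: "a \<in> roots n l al" "pr a nu = 0"
    obtain b where "rootpair I a b" using root_rootpair[OF a(1)] by blast
    then have "a \<in> rootsJ n l al J"
      using roots_orthogonal[OF J, of nu a b] dom nu0 rootpair_simple a(2) J by blast
    then obtain b where b: "rootpair J a b" using root_rootpair by blast
    have "pr a z \<notin> \<int>" using alcove_not_Ints[OF z(1) b] .
    then have "cis (2 * pi * - pr a z) \<noteq> cis (2 * pi * 0)"
      unfolding cis_eq_iff_Ints by simp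
    moreover have "real_of_rat (e a) = 0" using a(2) by (simp add: e)
    then have "e a = 0" by simp
    ultimately show "chi a 0 \<noteq> 1" by (simp add: chi_def p_mono_def)
  qed
  moreover have "w \<in> W I" using w W_sub by blast
  ultimately have "cmap n l al chi \<in> X_nu n l al nu"
    unfolding X_nu_def AF_nu_def using torus val sig by blast
  then show ?thesis by blast
qed

text \<open>Only leading terms matter: the Galois equation on them yields an exact invariance for
  the moduli and a congruence for the arguments, which together lead to the equation of
  \<open>psiM_conj\<close>.\<close>

lemma sigma_psiM:
  assumes J: "J \<subseteq> I" and lam0: "lam0 \<in> charlat n" and nu: "nu = pM n l al J (rv lam0)"
    and dom: "\<And>i. i < l \<Longrightarrow> i \<notin> J \<Longrightarrow> 0 < pr (al i) nu"
    and chi: "torus_pt n chi" and val: "\<And>lam. lam \<in> charlat n \<Longrightarrow> p_val (chi lam) = Some (pr lam nu)"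
    and Om: "p_val (Omega n l al chi) = Some (m_nu n l al nu)"
    and g: "g \<in> W I" and sig: "sigma_eq n chi g"
  obtains u where "u \<in> W J" "fst (psiM n l al J nu) \<circ> fst u = fst u \<circ> fst g"
    "snd (psiM n l al J nu) \<circ> snd u = snd u \<circ> snd g"
proof -
  have nuz: "nu j = 0" if "j \<ge> n" for j
  proof -
    have "j \<notin> J" using that J l_le_n by force
    then show ?thesis using lam0 that pM_support[of j J "rv lam0"] by (simp add: nu charlat_def)
  qed
  obtain d where d: "d > 0" "\<And>e. e > 0 \<Longrightarrow> \<exists>u. (\<forall>j<n. u j \<noteq> 0) \<and> (\<forall>lam\<in>charlat n. chi lam = pu (d * e) (mono_char n u lam))"
    using torus_pt_fls[OF chi] by blast
  obtain u where u: "\<And>j. j < n \<Longrightarrow> u j \<noteq> 0" "\<And>lam. lam \<in> charlat n \<Longrightarrow> chi lam = pu d (mono_char n u lam)"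
    using d(2)[of 1] by auto
  let ?F = "mono_char n u"
  have Fnz: "?F a \<noteq> 0" for a by (rule mono_char_nonzero) (rule u(1))
  have sd: "of_rat (of_int (fls_subdegree (?F a)) / of_nat d) = - pr a nu" if "a \<in> charlat n" for a
    using val[OF that] p_val_pu[OF d(1) Fnz] u(2)[OF that] by (simp add: of_rat_divide)
  define t where "t a = ?F a $$ fls_subdegree (?F a)" for a
  \<comment> \<open>The valuation pins the leading exponent, so the leading coefficient can be read
    at any \<open>q\<close> known to equal it.\<close>
  have tq: "t a = chi a q" if "a \<in> charlat n" "of_rat q = - pr a nu" for a q
  proof -
    have "q = of_int (fls_subdegree (?F a)) / of_nat d"
      using sd[OF that(1)] that(2) by (metis of_rat_eq_iff)
    then show ?thesis using u(2)[OF that(1)] by (simp add: t_def pu_nth[OF d(1)])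
  qed
  obtain a b where ab: "\<And>j. j \<ge> n \<Longrightarrow> a j = 0" "\<And>j. j \<ge> n \<Longrightarrow> b j = 0"
    and t: "\<And>lam. lam \<in> charlat n \<Longrightarrow> t lam = of_real (exp (pr lam b)) * cis (2 * pi * pr lam a)"
  proof (rule char_polar[of n t])
    show "t (\<lambda>j. x j + y j) = t x * t y" for x y
    proof -
      have e: "?F (\<lambda>j. x j + y j) = ?F x * ?F y" by (rule mono_char_add) (rule u(1))
      show ?thesis unfolding t_def e by (rule fls_lead_mult[OF Fnz Fnz])
    qed
    show "t (\<lambda>_. 0) = 1" by (simp add: t_def mono_char_zero)
  qed blast
  have gch: "fst g mu \<in> charlat n" if "mu \<in> charlat n" for mu using WX_char[OF g that] .
  have gnu: "pr (fst g mu) nu = pr mu nu" if mu: "mu \<in> charlat n" for mu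
  proof -
    have "p_val (chi (fst g mu)) = p_val (chi mu)"
      using sig mu p_val_sigma[of "chi (fst g mu)"] by (simp add: sigma_eq_def)
    then show ?thesis using val[OF gch[OF mu]] val[OF mu] by simp
  qed
  have rel: "pr (fst g mu) b = pr mu b \<and> pr (fst g mu) a - pr mu nu - pr mu a \<in> \<int>" if mu: "mu \<in> charlat n" for mu
  proof -
    define q where "q = (of_int (fls_subdegree (?F mu)) / of_nat d :: rat)"
    have q: "of_rat q = - pr mu nu" using sd[OF mu] by (simp add: q_def)
    have "p_sigma (chi (fst g mu)) q = chi mu q" using sig mu by (simp add: sigma_eq_def)
    moreover have "chi (fst g mu) q = t (fst g mu)" using tq[OF gch[OF mu], of q] q gnu[OF mu] by simp
    moreover have "chi mu q = t mu" using tq[OF mu q] by simp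
    moreover have "exp (2 * of_real pi * \<i> * of_real (of_rat q)) = cis (2 * pi * - pr mu nu)"
      by (simp add: cis_conv_exp q mult_ac)
    ultimately have E: "cis (2 * pi * - pr mu nu) * t (fst g mu) = t mu" by (simp add: p_sigma_def)
    have "cmod (t (fst g mu)) = cmod (t mu)" using arg_cong[OF E, of cmod] by (simp add: norm_mult)
    then have b: "pr (fst g mu) b = pr mu b" using t[OF mu] t[OF gch[OF mu]] by (simp add: norm_mult)
    have "of_real (exp (pr mu b)) * (cis (2 * pi * - pr mu nu) * cis (2 * pi * pr (fst g mu) a)) =
        of_real (exp (pr mu b)) * cis (2 * pi * pr mu a)"
      using E t[OF mu] t[OF gch[OF mu]] b by (simp add: mult_ac)
    then have "cis (2 * pi * - pr mu nu) * cis (2 * pi * pr (fst g mu) a) = cis (2 * pi * pr mu a)"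
      by simp
    then have "cis (2 * pi * (- pr mu nu + pr (fst g mu) a)) = cis (2 * pi * pr mu a)"
      by (simp only: cis_mult distrib_left)
    then show ?thesis using b unfolding cis_eq_iff_Ints by (simp add: algebra_simps)
  qed
  define R where "R = {\<beta>. \<exists>c. rootpair J \<beta> c}"
  have nu0: "pr \<beta> nu = 0" if "rootpair J \<beta> c" for \<beta> c using pM_rootpair[OF that] by (simp add: nu)
  have "\<exists>s. \<forall>\<beta>\<in>R. pr \<beta> a + s * pr \<beta> b \<notin> \<int>"
  proof (rule avoid_integers)
    show "finite R" by (rule finite_subset[OF _ finite_roots[of J]]) (auto simp: R_def rootpair_root)
    fix \<beta> assume "\<beta> \<in> R"
    then obtain c where rp: "rootpair J \<beta> c" by (auto simp: R_def)
    have "\<beta> \<in> roots n l al" using rootpair_root[OF rootpair_mono[OF J rp]] .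
    moreover have "\<forall>a\<in>roots n l al. pr a nu = 0 \<longrightarrow> chi a 0 \<noteq> 1"
      using torus_Omega_val[of chi nu] chi val Om by blast
    ultimately have "chi \<beta> 0 \<noteq> 1" using nu0[OF rp] by blast
    then have ne: "t \<beta> \<noteq> 1" using tq[OF rootpair_char[OF rp], of 0] nu0[OF rp] by simp
    show "pr \<beta> a \<notin> \<int> \<or> pr \<beta> b \<noteq> 0"
    proof (rule ccontr)
      assume "\<not> ?thesis"
      then have "cis (2 * pi * pr \<beta> a) = cis (2 * pi * 0)" "pr \<beta> b = 0" unfolding cis_eq_iff_Ints by simp_all
      then show False using ne t[OF rootpair_char[OF rp]] by simp
    qed
  qed
  then obtain s where s: "\<And>\<beta> c. rootpair J \<beta> c \<Longrightarrow> pr \<beta> a + s * pr \<beta> b \<notin> \<int>" unfolding R_def by blast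
  \<comment> \<open>Adding a multiple of \<open>b\<close> preserves the congruence satisfied by
    \<open>a\<close>, since pairings with \<open>b\<close> are exactly invariant under
    \<open>g\<close>; it is chosen to leave no root of J integral.\<close>
  define y where "y = (\<lambda>j. a j + s * b j)"
  have pry: "pr mu y = pr mu a + s * pr mu b" for mu by (simp add: y_def pair_add pair_scale)
  obtain v where v: "v \<in> W I" "fst v \<circ> fst g = id" "snd v \<circ> snd g = id" "snd g \<circ> snd v = id" using W_inv[OF g] by metis
  have prv: "pr mu (snd v x) = pr (fst g mu) x" for mu x
    using W_pair_left[OF v(1,2)] by simp
  have vnu: "snd v nu = nu"
  proof
    fix j show "snd v nu j = nu j"
    proof (cases "j < n")
      case True
      then show ?thesis using prv[of "unitvec j" nu] gnu[OF unitvec_char[OF True]] by (simp add: pair_unitvec)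
    next
      case False
      then show ?thesis using Wa_support[OF v(1), of j] l_le_n by simp
    qed
  qed
  have gnu': "snd g nu = nu" using v(4) vnu by (metis comp_apply id_apply)
  have gJ: "g \<in> W J"
  proof -
    have nn: "0 \<le> pr (al i) nu" if "i < l" for i
      using dom[OF that] nu0[OF rootpair_simple[of i J]] that by (cases "i \<in> J") auto
    have "g \<in> W {i \<in> I. i < l \<and> pr (al i) nu = 0}"
      using dominant_stabilizer[OF g, of nu] nn gnu' by simp
    moreover have "{i \<in> I. i < l \<and> pr (al i) nu = 0} \<subseteq> J" using dom by force
    ultimately show ?thesis using W_mono by blast
  qed
  have "\<exists>k. \<forall>j. snd v y j - nu j - y j = of_int (k j) \<and> (j \<ge> n \<longrightarrow> k j = 0)"
  proof -
    have "\<exists>k::int. snd v y j - nu j - y j = of_int k \<and> (j \<ge> n \<longrightarrow> k = 0)" for j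
    proof (cases "j < n")
      case True
      note r = rel[OF unitvec_char[OF True]]
      have "snd v y j = pr (fst g (unitvec j)) y" using prv[of "unitvec j" y] True by (simp add: pair_unitvec)
      then have "snd v y j - nu j - y j = pr (fst g (unitvec j)) a - pr (unitvec j) nu - pr (unitvec j) a"
        using r pair_unitvec[OF True, of y] pair_unitvec[OF True, of nu] unfolding pry by simp
      then show ?thesis using r True by (auto elim!: Ints_cases)
    next
      case False
      then have "snd v y j = y j" using Wa_support[OF v(1), of j] l_le_n by simp
      then show ?thesis using nuz[of j] False by simp
    qed
    then show ?thesis by metis
  qed
  then obtain k where k: "\<And>j. snd v y j - nu j - y j = of_int (k j)" "\<And>j. j \<ge> n \<Longrightarrow> k j = 0" by blast
  obtain k' where k': "snd g (rv k) = rv k'" using Wa_int[OF g] by blast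
  \<comment> \<open>The signs are fixed by rewriting the equation for \<open>y\<close> as one for
    \<open>-y\<close>.\<close>
  define lam where "lam = (\<lambda>j. - k' j)"
  define z where "z = (\<lambda>j. - y j)"
  have lamc: "lam \<in> charlat n"
    unfolding charlat_def
  proof (intro CollectI allI impI)
    fix j assume j: "n \<le> j"
    have "rv k' j = rv k j" using Wa_support[OF g, of j "rv k"] j l_le_n k' by simp
    then show "lam j = 0" using k(2)[OF j] by (simp add: lam_def)
  qed
  have "snd v y = (\<lambda>j. nu j + y j + of_int (k j))" using k(1) by (auto simp: fun_eq_iff algebra_simps)
  then have "snd g (snd v y) = (\<lambda>j. nu j + snd g y j + of_int (k' j))"
    by (simp add: Wa_add[OF g] gnu' k')
  moreover have "snd g (snd v y) = y" using v(4) by (simp add: pointfree_idE)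
  ultimately have yeq: "y j = nu j + snd g y j + of_int (k' j)" for j by metis
  have zeq: "z = (\<lambda>j. snd g z j + of_int (lam j) - nu j)"
  proof
    fix j
    have "snd g z j = - snd g y j" by (simp add: z_def Wa_uminus[OF g])
    then show "z j = snd g z j + of_int (lam j) - nu j" using yeq[of j] by (simp add: z_def lam_def)
  qed
  \<comment> \<open>Averaging the equation for \<open>z\<close> cancels \<open>z\<close>, so the
    integral vector produced by the congruences is automatically a lift of
    \<open>nu\<close>.\<close>
  have plam: "nu = pM n l al J (rv lam)"
  proof
    fix j
    have "pM n l al J z = pM n l al J (\<lambda>j. snd g z j + of_int (lam j) - nu j)" using zeq by simp
    also have "\<dots> = (\<lambda>j. pM n l al J z j + pM n l al J (rv lam) j - nu j)"
      unfolding pM_diff pM_add pM_W[OF gJ] nu pM_idem ..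
    finally have "pM n l al J z j = pM n l al J z j + pM n l al J (rv lam) j - nu j" by (rule fun_cong)
    then show "nu j = pM n l al J (rv lam) j" by simp
  qed
  have zI: "pr \<beta> z \<notin> \<int>" if "rootpair J \<beta> c" for \<beta> c
  proof
    assume "pr \<beta> z \<in> \<int>"
    moreover have "pr \<beta> z = - pr \<beta> y" using pair_scale[of n \<beta> "-1" y] by (simp add: z_def)
    ultimately show False using s[OF that] unfolding pry by (metis Ints_minus minus_minus)
  qed
  show ?thesis
    by (rule psiM_conj[OF J lamc plam gJ zI zeq]) (assumption, rule that)
qed

text \<open>Membership provides \<open>chi1\<close> with the right valuations and
  \<open>chi2\<close> with the right Omega. Both are Weyl translates of \<open>chi\<close>, and
  Omega is invariant, so \<open>chi1\<close> has both properties; its Galois element is a conjugate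
  of \<open>h\<close>.\<close>

lemma X_nu_conj:
  assumes J: "J \<subseteq> I" and lam0: "lam0 \<in> charlat n" and nu: "nu = pM n l al J (rv lam0)"
    and dom: "\<And>i. i < l \<Longrightarrow> i \<notin> J \<Longrightarrow> 0 < pr (al i) nu"
    and chi: "torus_pt n chi" and X: "cmap n l al chi \<in> X_nu n l al nu"
    and h: "h \<in> W I" and sig: "sigma_eq n chi h"
  shows "W_conj n l al h (psiM n l al J nu)"
proof -
  obtain chi1 where chi1: "torus_pt n chi1" "cmap n l al chi = cmap n l al chi1"
    "\<And>lam. lam \<in> charlat n \<Longrightarrow> p_val (chi1 lam) = Some (pr lam nu)"
    using X unfolding X_nu_def AF_nu_def by blast
  obtain chi2 where chi2: "torus_pt n chi2" "cmap n l al chi = cmap n l al chi2"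
    "p_val (Omega n l al chi2) = Some (m_nu n l al nu)"
    using X unfolding X_nu_def by blast
  obtain v where v: "v \<in> W I" "\<And>lam. lam \<in> charlat n \<Longrightarrow> chi lam = chi1 (fst v lam)"
    using cmap_separates[OF chi chi1(1,2)] by blast
  obtain v2 where v2: "v2 \<in> W I" "\<And>lam. lam \<in> charlat n \<Longrightarrow> chi lam = chi2 (fst v2 lam)"
    using cmap_separates[OF chi chi2(1,2)] by blast
  have Om: "p_val (Omega n l al chi1) = Some (m_nu n l al nu)"
    using Omega_W[OF chi1(1) v] Omega_W[OF chi2(1) v2] chi2(3) by simp
  obtain v' where v': "v' \<in> W I" "fst v' \<circ> fst v = id" "fst v \<circ> fst v' = id" "snd v' \<circ> snd v = id" "snd v \<circ> snd v' = id"
    using W_inv[OF v(1)] by blast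
  define g where "g = (fst v \<circ> fst h \<circ> fst v', snd v \<circ> snd h \<circ> snd v')"
  have g: "g \<in> W I" using W_comp[OF W_comp[OF v(1) h] v'(1)] by (simp add: g_def)
  have "sigma_eq n chi1 g"
    unfolding sigma_eq_def
  proof
    fix mu assume mu: "mu \<in> charlat n"
    have m': "fst v' mu \<in> charlat n" using WX_char[OF v'(1) mu] .
    have "p_sigma (chi1 (fst g mu)) = p_sigma (chi (fst h (fst v' mu)))"
      using v(2)[OF WX_char[OF h m']] by (simp add: g_def)
    also have "\<dots> = chi (fst v' mu)" using sig m' by (simp add: sigma_eq_def)
    also have "\<dots> = chi1 mu" using v(2)[OF m'] v'(3) by (simp add: pointfree_idE)
    finally show "p_sigma (chi1 (fst g mu)) = chi1 mu" .
  qed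
  then obtain u where u: "u \<in> W J" "fst (psiM n l al J nu) \<circ> fst u = fst u \<circ> fst g"
    "snd (psiM n l al J nu) \<circ> snd u = snd u \<circ> snd g"
    using sigma_psiM[of J lam0 nu chi1 g] J lam0 nu dom chi1(1,3) Om g by blast
  obtain u' where u': "u' \<in> W J" "fst u' \<circ> fst u = id" "fst u \<circ> fst u' = id" "snd u' \<circ> snd u = id" "snd u \<circ> snd u' = id"
    using W_inv[OF u(1)] by blast
  \<comment> \<open>Composes the two conjugations, from \<open>h\<close> to \<open>g\<close> and
    from \<open>g\<close> to psi, once for both components of a group element.\<close>
  have conj: "h1 \<circ> (v1 \<circ> u1) = (v1 \<circ> u1) \<circ> p"
    if "p \<circ> u2 = u2 \<circ> (v2 \<circ> h1 \<circ> v1)" "v1 \<circ> v2 = id" "u1 \<circ> u2 = id" "u2 \<circ> u1 = id"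
    for h1 v1 v2 u1 u2 p :: "'x \<Rightarrow> 'x"
  proof
    fix x
    have p: "p (u2 y) = u2 (v2 (h1 (v1 y)))" for y using fun_cong[OF that(1), of y] by simp
    have i: "v1 (v2 y) = y" "u1 (u2 y) = y" "u2 (u1 y) = y" for y using that by (simp_all add: pointfree_idE)
    show "(h1 \<circ> (v1 \<circ> u1)) x = ((v1 \<circ> u1) \<circ> p) x"
      using p[of "u1 x"] by (simp add: i)
  qed
  have "(fst v' \<circ> fst u', snd v' \<circ> snd u') \<in> W I"
    using W_comp[OF v'(1), of u'] u'(1) W_sub by auto
  moreover have "fst h \<circ> (fst v' \<circ> fst u') = (fst v' \<circ> fst u') \<circ> fst (psiM n l al J nu)"
    by (rule conj[of _ "fst u" "fst v"]) (use u(2) v' u' in \<open>simp_all add: g_def\<close>)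
  moreover have "snd h \<circ> (snd v' \<circ> snd u') = (snd v' \<circ> snd u') \<circ> snd (psiM n l al J nu)"
    by (rule conj[of _ "snd u" "snd v"]) (use u(3) v' u' in \<open>simp_all add: g_def\<close>)
  ultimately show ?thesis unfolding W_conj_def by (metis fst_conv snd_conv)
qed

end

theorem theorem2p4:
  fixes n l :: nat and al :: "nat \<Rightarrow> nat \<Rightarrow> int" and J :: "nat set" and nu :: "nat \<Rightarrow> real"
  assumes "root_datum n l al"
    and "J \<subseteq> {..<l}"
    and "nu \<in> LambdaPplus n l al J"
  shows "X_nu n l al nu \<noteq> {} \<and>
    (\<forall>chi h. torus_pt n chi \<and> cmap n l al chi \<in> X_nu n l al nu \<and> h \<in> Weyl n l al \<and> sigma_eq n chi h
        \<longrightarrow> W_conj n l al h (psiM n l al J nu))"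
proof -
  interpret weyl n l al by standard (rule assms(1))
  obtain lam where lam: "lam \<in> charlat n" "nu = pM n l al J (rv lam)"
    using assms(3) unfolding LambdaPplus_def LambdaM_def by blast
  have dom: "0 < pair n (al i) nu" if "i < l" "i \<notin> J" for i
    using assms(3) that unfolding LambdaPplus_def by blast
  show ?thesis
    using X_nu_nonempty[OF assms(2) lam dom] X_nu_conj[OF assms(2) lam dom] by blast
qed

end
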